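(* In the fluid queue model described in the context, let $\{\xi_n,n\ge1\}$ and $\{\eta_n,n\ge1\}$ be two positive i.i.d. sequences with $\mathbb{E}\xi_1<\infty$ and $\mathbb{E}\eta_1<\infty$. Suppose that $n^{-1}\tau_n\to\lambda_R^{-1}$ and $n^{-1}\sigma_n\to\lambda_V^{-1}$ in probability as $n\to\infty$, where $0<\lambda_R^{-1}<\infty$ and $0<\lambda_V^{-1}<\infty$. Assume further that $\{W_{\tau_k},k\ge1\}$ and $\{W_{\tau_k}-\xi_k,k\ge1\}$ are stationary and ergodic, such that $(W_{\tau_k}-\xi_k,W_{\tau_k})$ converges in distribution to $(W^-,W^+)$, where $W^-,W^+$ are two proper random variables. If $\xi_n$ is independent of $\mathbf{1}_{\{N_1^R\ge n\}}$ and $\eta_n$ is independent of $\mathbf{1}_{\{N_1^V\ge n\}}$ (for every $n\ge1$), then there is a constant $p$ with $0\le p\le1$ such that $$\lambda_R=\frac{p\,\varphi'(0)}{\mathbb{E}\xi_1},\qquad \lambda_V=\frac{(1-p)\,\varphi'(0)}{\mathbb{E}\eta_1},$$ $$\lim_{t\to\infty}t^{-1}\mathbb{E}\sum_{k=1}^{N_t^R}\xi_k=-p\,\mathbb{E}Y_1,\qquad \lim_{t\to\infty}t^{-1}\mathbb{E}\sum_{k=1}^{N_t^V}\eta_k=-(1-p)\,\mathbb{E}Y_1,$$ and, for all $\theta>0$, $$\lim_{t\to\infty}\mathbb{E}e^{-\theta W_t}=\mathbb{E}e^{-\theta W}=\frac{\theta\varphi'(0)}{\varphi(\theta)}\left[p\,\frac{\mathbb{E}e^{-\theta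 W^-}-\mathbb{E}e^{-\theta W^+}}{\theta\,\mathbb{E}\xi_1}+(1-p)\,\frac{1-\mathbb{E}e^{-\theta\eta_1}}{\theta\,\mathbb{E}\eta_1}\right].$$
   Context: Model. $(\Omega,\mathcal{F},\mathbb{P})$ is a complete probability space with a filtration $\{\mathcal{F}_t\}_{t\ge 0}$ satisfying the usual conditions; adaptedness, stopping times and martingales are with respect to it. Lévy processes have càdlàg paths. $X=\{X_t,t\ge0\}$ (cumulative fluid input) is a subordinator with $\mathbb{E}e^{-\theta X_t}=e^{t\phi(\theta)}$, $\phi(\theta)=-a\theta+\int_{\mathbb{R}_+}(e^{-\theta x}-1)\,\nu(dx)$, where $a\ge0$ and $\int_{\mathbb{R}_+}x\,\nu(dx)<\infty$. The server processes fluid at constant rate $r$. Set $Y_t=X_t-rt$, a spectrally positive Lévy process with exponent $\varphi(\theta)=\phi(\theta)+r\theta$, i.e. $\mathbb{E}e^{-\theta Y_t}=e^{t\varphi(\theta)}$. Standing assumptions: $\rho:=-\phi'(0)<r$ and $\mathbb{E}|Y_t|<\infty$ for all $t\ge0$ (so $\varphi'(0)=-\mathbb{E}Y_1=r-\rho>0$). The server fails at a strictly increasing sequence of stopping times $\{\tau_n,n\ge1\}$; the $n$th repair time $\xi_n$ is a positive $\mathcal{F}_{\tau_n}$-measurable random variable. Whenever the system becomes empty, the server takes a vacation; vacations continue until, on return, the server finds the system non-empty. The vacation starting times form a strictly increasing sequence of stopping times $\{\sigma_n,n\ge1\}$, and the $n$th vacation length $\eta_n$ is a positive $\mathcal{F}_{\sigma_n}$-measurable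 random variable. Let $W_0\ge0$ be $\mathcal{F}_0$-measurable. The virtual waiting time process is $$W_t=W_0+X_t-rt+\sum_{i=1}^{N_t^R}\xi_i+\sum_{i=1}^{N_t^V}\eta_i,\quad t\ge0,$$ (empty sums are zero), where $N_t^R=\sup\{n\mid\tau_n\le t\}$, $N_t^V=\sup\{n\mid\sigma_n\le t\}$ and $\sigma_n=\inf\{t\ge0\mid W_0+X_t-rt+\sum_{i=1}^{N_t^R}\xi_i+\sum_{i=1}^{n-1}\eta_i=0\}$, $n\ge1$. Steady-state standing assumption: as $t\to\infty$, $W_t$ converges in distribution to a random variable $W$, and $t^{-1}\mathbb{E}W_t\to0$. *)

theory Defs
  imports "HOL-Probability.Probability"
begin

section \<open>Modes of convergence\<close>

definition tendsto_in_prob :: "'a measure \<Rightarrow> (nat \<Rightarrow> 'a \<Rightarrow> real) \<Rightarrow> real \<Rightarrow> bool" where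
  "tendsto_in_prob M Z c \<longleftrightarrow>
     (\<forall>\<epsilon>>0. (\<lambda>n. measure M {\<omega> \<in> space M. \<epsilon> < \<bar>Z n \<omega> - c\<bar>}) \<longlonglongrightarrow> 0)"

text \<open>
  The library's \<^const>\<open>weak_conv_m\<close> covers only sequences of laws on the real line. Here the index may
  be continuous time and the values may be pairs, and the limit may live on another space.
\<close>

definition tendsto_in_distr ::
  "'a measure \<Rightarrow> ('i \<Rightarrow> 'a \<Rightarrow> 'v::topological_space) \<Rightarrow> 'b measure \<Rightarrow> ('b \<Rightarrow> 'v) \<Rightarrow> 'i filter \<Rightarrow> bool" where
  "tendsto_in_distr M Z N L G \<longleftrightarrow>
     (\<forall>f::'v \<Rightarrow> real. continuous_on UNIV f \<longrightarrow> bounded (range f) \<longrightarrow>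
        ((\<lambda>i. \<integral>\<omega>. f (Z i \<omega>) \<partial>M) \<longlongrightarrow> (\<integral>\<omega>. f (L \<omega>) \<partial>N)) G)"

section \<open>Sequences of random variables\<close>

text \<open>Indexed from 1; the index-0 term plays no role.\<close>

definition iid_seq :: "'a measure \<Rightarrow> (nat \<Rightarrow> 'a \<Rightarrow> real) \<Rightarrow> bool" where
  "iid_seq M Z \<longleftrightarrow>
     prob_space.indep_vars M (\<lambda>_. borel) Z {1..} \<and>
     (\<forall>n\<ge>1. distr M borel (Z n) = distr M borel (Z 1))"

definition stationary_seq :: "'a measure \<Rightarrow> (nat \<Rightarrow> 'a \<Rightarrow> real) \<Rightarrow> bool" where
  "stationary_seq M Z \<longleftrightarrow> (\<forall>n. Z n \<in> borel_measurable M) \<and>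
     distr M (\<Pi>\<^sub>M n\<in>UNIV. borel) (\<lambda>\<omega> n. Z (Suc n) \<omega>) =
     distr M (\<Pi>\<^sub>M n\<in>UNIV. borel) (\<lambda>\<omega> n. Z n \<omega>)"

text \<open>This is ergodicity of the left shift on sequence space under the law of the sequence.\<close>

definition ergodic_seq :: "'a measure \<Rightarrow> (nat \<Rightarrow> 'a \<Rightarrow> real) \<Rightarrow> bool" where
  "ergodic_seq M Z \<longleftrightarrow>
     (\<forall>A \<in> sets (\<Pi>\<^sub>M n\<in>UNIV. (borel :: real measure)).
        (\<lambda>x n. x (Suc n)) -` A = A \<longrightarrow>
        measure M {\<omega> \<in> space M. (\<lambda>n. Z n \<omega>) \<in> A} \<in> {0, 1})"

section \<open>Levy processes\<close>

definition cadlag :: "(real \<Rightarrow> real) \<Rightarrow> bool" where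
  "cadlag x \<longleftrightarrow>
     (\<forall>t\<ge>0. (x \<longlongrightarrow> x t) (at_right t)) \<and> (\<forall>t>0. \<exists>l. (x \<longlongrightarrow> l) (at_left t))"

text \<open>
  Levy process with respect to a filtration: the increment after time \<open>s\<close> is independent of all of
  \<open>F s\<close>, not merely of the past of the process itself.
\<close>

definition levy_process :: "'a measure \<Rightarrow> (real \<Rightarrow> 'a measure) \<Rightarrow> (real \<Rightarrow> 'a \<Rightarrow> real) \<Rightarrow> bool" where
  "levy_process M F X \<longleftrightarrow>
     (\<forall>t\<ge>0. X t \<in> borel_measurable (F t)) \<and>
     (AE \<omega> in M. X 0 \<omega> = 0) \<and>
     (AE \<omega> in M. cadlag (\<lambda>t. X t \<omega>)) \<and>
     (\<forall>s t. 0 \<le> s \<longrightarrow> s \<le> t \<longrightarrow>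
        prob_space.indep_set M (sets (F s))
          (sets (vimage_algebra (space M) (\<lambda>\<omega>. X t \<omega> - X s \<omega>) borel)) \<and>
        distr M borel (\<lambda>\<omega>. X t \<omega> - X s \<omega>) = distr M borel (X (t - s)))"

definition subordinator :: "'a measure \<Rightarrow> (real \<Rightarrow> 'a measure) \<Rightarrow> (real \<Rightarrow> 'a \<Rightarrow> real) \<Rightarrow> bool" where
  "subordinator M F X \<longleftrightarrow>
     levy_process M F X \<and> (AE \<omega> in M. mono_on {0..} (\<lambda>t. X t \<omega>))"

definition input_exponent :: "real \<Rightarrow> real measure \<Rightarrow> real \<Rightarrow> real" where
  "input_exponent a \<nu> \<theta> = - a * \<theta> + (\<integral>x. (exp (- \<theta> * x) - 1) \<partial>\<nu>)"

definition net_exponent :: "real \<Rightarrow> real measure \<Rightarrow> real \<Rightarrow> real \<Rightarrow> real" where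
  "net_exponent a \<nu> r \<theta> = input_exponent a \<nu> \<theta> + r * \<theta>"

text \<open>The exponents are meaningful only on \<open>[0, \<infinity>)\<close>, so their derivative at 0 is one-sided.\<close>

abbreviation deriv_at_0 :: "(real \<Rightarrow> real) \<Rightarrow> real" where
  "deriv_at_0 f \<equiv> vector_derivative f (at 0 within {0..})"

section \<open>The fluid queue\<close>

text \<open>
  Sequences of times and durations are indexed from 1; their value at index 0 is never used. The
  supremum is that of \<^typ>\<open>nat\<close>, so it is 0 for the empty set; it carries no information
  when the set is infinite.
\<close>

definition num_events :: "(nat \<Rightarrow> 'a \<Rightarrow> real) \<Rightarrow> real \<Rightarrow> 'a \<Rightarrow> nat" where
  "num_events T t \<omega> = Sup {n. 1 \<le> n \<and> T n \<omega> \<le> t}"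

definition waiting_time ::
  "(real \<Rightarrow> 'a \<Rightarrow> real) \<Rightarrow> real \<Rightarrow> ('a \<Rightarrow> real) \<Rightarrow> (nat \<Rightarrow> 'a \<Rightarrow> real) \<Rightarrow> (nat \<Rightarrow> 'a \<Rightarrow> real) \<Rightarrow>
   (nat \<Rightarrow> 'a \<Rightarrow> real) \<Rightarrow> (nat \<Rightarrow> 'a \<Rightarrow> real) \<Rightarrow> real \<Rightarrow> 'a \<Rightarrow> real" where
  "waiting_time X r W0 \<tau> \<xi> \<sigma> \<eta> t \<omega> =
     W0 \<omega> + X t \<omega> - r * t
       + (\<Sum>i=1..num_events \<tau> t \<omega>. \<xi> i \<omega>) + (\<Sum>i=1..num_events \<sigma> t \<omega>. \<eta> i \<omega>)"

text \<open>
  The filtration has real index, but only times \<open>t \<ge> 0\<close> matter: a filtration on \<open>[0, \<infinity>)\<close> is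
  extended by \<open>F t = F 0\<close> for \<open>t < 0\<close>. Pathwise conditions are required almost surely. A strictly
  increasing sequence of extended stopping times has finite terms, so all times are real; the infimum
  in \<open>vacation_start\<close> is nevertheless taken in \<^typ>\<open>ereal\<close>, where the infimum of the empty set
  is \<open>\<infinity>\<close>, so the empty system is indeed reached.
\<close>

locale fluid_queue = prob_space M + complete_measure M + filtration "space M" F
  for M :: "'a measure" and F :: "real \<Rightarrow> 'a measure" +
  fixes a :: real and \<nu> :: "real measure" and r :: real
    and X :: "real \<Rightarrow> 'a \<Rightarrow> real" and W0 :: "'a \<Rightarrow> real"
    and \<tau> \<xi> \<sigma> \<eta> :: "nat \<Rightarrow> 'a \<Rightarrow> real"
  assumes filtration_subset: "\<And>t. sets (F t) \<subseteq> sets M"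
    and filtration_complete: "null_sets M \<subseteq> sets (F 0)"
    and filtration_right_continuous: "\<And>t. 0 \<le> t \<Longrightarrow> (\<Inter>s\<in>{t<..}. sets (F s)) = sets (F t)"
    and drift_nonneg: "0 \<le> a"
    and jump_measure_sets: "sets \<nu> = sets borel"
    and jump_measure_nonneg: "emeasure \<nu> {..<0} = 0"
    and jump_measure_integrable: "integrable \<nu> (\<lambda>x. x)"
    and input_subordinator: "subordinator M F X"
    and input_laplace: "\<And>t \<theta>. 0 \<le> t \<Longrightarrow> 0 \<le> \<theta> \<Longrightarrow>
          (\<integral>\<omega>. exp (- \<theta> * X t \<omega>) \<partial>M) = exp (t * input_exponent a \<nu> \<theta>)"
    and stable: "- deriv_at_0 (input_exponent a \<nu>) < r"
    and net_input_integrable: "\<And>t. 0 \<le> t \<Longrightarrow> integrable M (\<lambda>\<omega>. X t \<omega> - r * t)"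
    and initial_measurable: "W0 \<in> borel_measurable (F 0)"
    and initial_nonneg: "AE \<omega> in M. 0 \<le> W0 \<omega>"
    and failure_stopping_time: "\<And>n. 1 \<le> n \<Longrightarrow> stopping_time F (\<tau> n)"
    and failure_nonneg: "AE \<omega> in M. \<forall>n\<ge>1. 0 \<le> \<tau> n \<omega>"
    and failure_strict_mono: "AE \<omega> in M. strict_mono_on {1..} (\<lambda>n. \<tau> n \<omega>)"
    and repair_measurable: "\<And>n. 1 \<le> n \<Longrightarrow> \<xi> n \<in> borel_measurable (pre_sigma (\<tau> n))"
    and repair_pos: "AE \<omega> in M. \<forall>n\<ge>1. 0 < \<xi> n \<omega>"
    and vacation_stopping_time: "\<And>n. 1 \<le> n \<Longrightarrow> stopping_time F (\<sigma> n)"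
    and vacation_strict_mono: "AE \<omega> in M. strict_mono_on {1..} (\<lambda>n. \<sigma> n \<omega>)"
    and vacation_measurable: "\<And>n. 1 \<le> n \<Longrightarrow> \<eta> n \<in> borel_measurable (pre_sigma (\<sigma> n))"
    and vacation_pos: "AE \<omega> in M. \<forall>n\<ge>1. 0 < \<eta> n \<omega>"
    and vacation_start: "AE \<omega> in M. \<forall>n\<ge>1. ereal (\<sigma> n \<omega>) =
          Inf (ereal ` {t. 0 \<le> t \<and>
            W0 \<omega> + X t \<omega> - r * t
              + (\<Sum>i=1..num_events \<tau> t \<omega>. \<xi> i \<omega>) + (\<Sum>i=1..n-1. \<eta> i \<omega>) = 0})"

end

theory Submission
  imports Defs "HOL-Real_Asymp.Real_Asymp"
begin

text \<open>
  Let \<open>R t\<close> and \<open>V t\<close> be the repair and vacation times granted up to time \<open>t\<close>, so that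
  \<open>W t = W0 + Y t + R t + V t\<close>. Fix \<open>\<theta> > 0\<close> and write \<open>\<phi>\<close> for the exponent of \<open>Y\<close>.

  The heart of the proof is a balance equation for the Laplace transform at a fixed time,

    \<open>E e^(-\<theta> W t) - E e^(-\<theta> W0) + E (repair losses) + E (vacation losses)
       = \<phi> \<theta> * (integral over [0,t] of E e^(-\<theta> W s) ds)\<close>,

  where the repair beginning at \<open>\<tau> i\<close> loses \<open>e^(-\<theta> (W (\<tau> i) - \<xi> i)) - e^(-\<theta> W (\<tau> i))\<close> and the vacation
  beginning at \<open>\<sigma> j\<close> loses \<open>1 - e^(-\<theta> \<eta> j)\<close>. It is obtained without stochastic integrals. Factor
  \<open>e^(-\<theta> W) = D * Z\<close> with the decreasing step function \<open>D = e^(-\<theta> (W0 + R + V))\<close> and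
  \<open>Z = e^(-\<theta> Y)\<close>. Summation by parts over a grid of \<open>n\<close> cells of \<open>[0,t]\<close> expresses the sum of
  \<open>D * (increment of Z)\<close> through the jumps of \<open>D\<close>, each weighted by \<open>Z\<close> at the next grid point. As
  \<open>n\<close> grows, right-continuity moves that weight to the jump time (\<open>grid_sum_tendsto\<close>), with everything
  bounded because \<open>Y t \<ge> - r t\<close>; and the increments of \<open>Y\<close> are independent of the past, so the
  expected sum is a Riemann sum of \<open>E e^(-\<theta> W s)\<close> (\<open>increment_independent\<close>, \<open>laplace_balance\<close>).
  The form of the losses rests on the sample paths: \<open>Y\<close> has no downward jumps and decreases at rate at
  most \<open>r\<close>, so the workload reaches 0 continuously. Hence it is nonnegative, equals \<open>\<eta> j\<close> at
  \<open>\<sigma> j\<close>, and no failure happens at a vacation start (\<open>level_nonneg\<close>, \<open>failure_not_vacation\<close>).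

  Divide by \<open>t\<close> and let \<open>t\<close> tend to infinity. The right side tends to \<open>\<phi> \<theta>\<close> times the transform
  of the steady-state workload. Each loss sum, divided by \<open>t\<close>, converges in probability to rate times mean loss, by Birkhoff's ergodic theorem
  and the given rates (\<open>ergodic_average\<close>, \<open>random_index_conv_in_prob\<close>). Convergence of the means
  needs a domination: by \<open>1 - e^(-x) \<le> x\<close> the losses are at most \<open>\<theta> (R t + V t)\<close>, and
  \<open>(R t + V t) / t = (W t - W0 - Y t) / t\<close> converges in mean to \<open>- E (Y 1) = \<phi>'(0)\<close>, as \<open>W t / t\<close> is
  nonnegative with vanishing mean and \<open>X t / t\<close> converges in mean to \<open>E (X 1)\<close> (\<open>total_L1\<close>).
  The same domination applied to \<open>R\<close> and \<open>V\<close> themselves gives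
  \<open>lam_R * E \<xi> + lam_V * E \<eta> = \<phi>'(0)\<close> (\<open>random_sum_mean_tendsto\<close>). So \<open>p\<close> is the
  share of \<open>lam_R * E \<xi>\<close> in \<open>\<phi>'(0)\<close>, and the formula is the limiting balance equation divided by
  \<open>\<phi> \<theta>\<close>.
\<close>

section \<open>Birkhoff's ergodic theorem\<close>

context prob_space
begin

lemma stationary_seq_measurable: "stationary_seq M Z \<Longrightarrow> Z n \<in> borel_measurable M"
  unfolding stationary_seq_def by simp

lemma path_measurable:
  assumes [measurable]: "\<And>n. Z n \<in> borel_measurable M"
  shows "(\<lambda>\<omega> n. Z n \<omega>) \<in> measurable M (\<Pi>\<^sub>M n\<in>(UNIV::nat set). (borel :: real measure))"
  by (rule measurable_PiM_single') (auto simp: space_PiM)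

lemma stationary_seq_integral_shift:
  fixes \<Phi> :: "(nat \<Rightarrow> real) \<Rightarrow> real"
  assumes st: "stationary_seq M Z"
    and \<Phi>: "\<Phi> \<in> borel_measurable (\<Pi>\<^sub>M n\<in>UNIV. borel)"
  shows "(\<integral>\<omega>. \<Phi> (\<lambda>n. Z (Suc n) \<omega>) \<partial>M) = (\<integral>\<omega>. \<Phi> (\<lambda>n. Z n \<omega>) \<partial>M)"
    and "integrable M (\<lambda>\<omega>. \<Phi> (\<lambda>n. Z (Suc n) \<omega>)) \<longleftrightarrow> integrable M (\<lambda>\<omega>. \<Phi> (\<lambda>n. Z n \<omega>))"
proof -
  note m = stationary_seq_measurable[OF st]
  have d: "distr M (\<Pi>\<^sub>M n\<in>UNIV. borel) (\<lambda>\<omega> n. Z (Suc n) \<omega>) = distr M (\<Pi>\<^sub>M n\<in>UNIV. borel) (\<lambda>\<omega> n. Z n \<omega>)"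
    using st unfolding stationary_seq_def by simp
  show "(\<integral>\<omega>. \<Phi> (\<lambda>n. Z (Suc n) \<omega>) \<partial>M) = (\<integral>\<omega>. \<Phi> (\<lambda>n. Z n \<omega>) \<partial>M)"
    using integral_distr[OF path_measurable[of "\<lambda>n. Z (Suc n)", OF m] \<Phi>]
      integral_distr[OF path_measurable[of Z, OF m] \<Phi>] d by simp
  show "integrable M (\<lambda>\<omega>. \<Phi> (\<lambda>n. Z (Suc n) \<omega>)) \<longleftrightarrow> integrable M (\<lambda>\<omega>. \<Phi> (\<lambda>n. Z n \<omega>))"
    using integrable_distr_eq[OF path_measurable[of "\<lambda>n. Z (Suc n)", OF m] \<Phi>]
      integrable_distr_eq[OF path_measurable[of Z, OF m] \<Phi>] d by simp
qed

lemma stationary_seq_same_integral: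
  fixes g :: "real \<Rightarrow> real"
  assumes st: "stationary_seq M Z" and [measurable]: "g \<in> borel_measurable borel"
  shows "(\<integral>\<omega>. g (Z n \<omega>) \<partial>M) = (\<integral>\<omega>. g (Z 0 \<omega>) \<partial>M)"
    and "integrable M (\<lambda>\<omega>. g (Z n \<omega>)) \<longleftrightarrow> integrable M (\<lambda>\<omega>. g (Z 0 \<omega>))"
proof (induction n)
  case (Suc n)
  have m: "(\<lambda>x. g (x n)) \<in> borel_measurable (\<Pi>\<^sub>M n\<in>(UNIV::nat set). (borel :: real measure))"
    by measurable
  { case 1 show ?case using stationary_seq_integral_shift(1)[OF st m] Suc by simp }
  { case 2 show ?case using stationary_seq_integral_shift(2)[OF st m] Suc by simp }
qed auto

lemma stationary_seq_comp:
  fixes g :: "real \<Rightarrow> real"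
  assumes st: "stationary_seq M Z" and g: "g \<in> borel_measurable borel"
  shows "stationary_seq M (\<lambda>n \<omega>. g (Z n \<omega>))"
proof -
  note m = stationary_seq_measurable[OF st]
  let ?S = "\<Pi>\<^sub>M n\<in>(UNIV::nat set). (borel :: real measure)"
  have G: "(\<lambda>x n. g (x n)) \<in> measurable ?S ?S"
    using g by (intro measurable_PiM_single') (auto simp: space_PiM)
  have d: "distr M ?S (\<lambda>\<omega> n. Z (Suc n) \<omega>) = distr M ?S (\<lambda>\<omega> n. Z n \<omega>)"
    using st unfolding stationary_seq_def by simp
  have "distr (distr M ?S (\<lambda>\<omega> n. Z (Suc n) \<omega>)) ?S (\<lambda>x n. g (x n)) = distr M ?S (\<lambda>\<omega> n. g (Z (Suc n) \<omega>))"
    by (subst distr_distr[OF G path_measurable[of "\<lambda>n. Z (Suc n)", OF m]]) (simp add: comp_def)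
  moreover have "distr (distr M ?S (\<lambda>\<omega> n. Z n \<omega>)) ?S (\<lambda>x n. g (x n)) = distr M ?S (\<lambda>\<omega> n. g (Z n \<omega>))"
    by (subst distr_distr[OF G path_measurable[of "\<lambda>n. Z n", OF m]]) (simp add: comp_def)
  ultimately show ?thesis
    unfolding stationary_seq_def using d m g by (auto intro: measurable_compose)
qed

text \<open>
  A shift-invariant set of image sequences pulls back to a shift-invariant set.
\<close>

lemma ergodic_seq_comp:
  fixes g :: "real \<Rightarrow> real"
  assumes er: "ergodic_seq M Z" and g: "g \<in> borel_measurable borel"
  shows "ergodic_seq M (\<lambda>n \<omega>. g (Z n \<omega>))"
  unfolding ergodic_seq_def
proof (intro ballI impI)
  let ?S = "\<Pi>\<^sub>M n\<in>(UNIV::nat set). (borel :: real measure)"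
  fix A assume A: "A \<in> sets ?S" and inv: "(\<lambda>x n. x (Suc n)) -` A = A"
  have G: "(\<lambda>x n. g (x n)) \<in> measurable ?S ?S"
    using g by (intro measurable_PiM_single') (auto simp: space_PiM)
  have "(\<lambda>x n. g (x n)) -` A \<in> sets ?S"
    using measurable_sets[OF G A] by (simp add: space_PiM)
  moreover have "(\<lambda>x n. x (Suc n)) -` ((\<lambda>x n. g (x n)) -` A) = (\<lambda>x n. g (x n)) -` A"
  proof -
    have "(\<lambda>n. g (x (Suc n))) \<in> A \<longleftrightarrow> (\<lambda>n. g (x n)) \<in> A" for x
      using arg_cong[OF inv, of "\<lambda>B. (\<lambda>n. g (x n)) \<in> B"] by simp
    then show ?thesis by auto
  qed
  ultimately show "measure M {\<omega> \<in> space M. (\<lambda>n. g (Z n \<omega>)) \<in> A} \<in> {0, 1}"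
    using er unfolding ergodic_seq_def by (auto dest!: bspec)
qed

text \<open>
  Garsia's argument: the maximum \<open>\<Phi>\<close> of the first partial sums, when positive, is at most the
  first term plus the maximum of the shifted sequence, and shifting does not change the mean of
  \<open>\<Phi>\<close>.
\<close>

lemma maximal_ergodic:
  assumes st: "stationary_seq M Z" and int: "integrable M (Z 0)"
  shows "0 \<le> (\<integral>\<omega>. Z 0 \<omega> * indicator {\<omega>. \<exists>k\<le>n. 0 < (\<Sum>i<k. Z i \<omega>)} \<omega> \<partial>M)"
proof -
  let ?S = "\<Pi>\<^sub>M n\<in>(UNIV::nat set). (borel :: real measure)"
  define \<Phi> where "\<Phi> x = Max ((\<lambda>k. \<Sum>i<k. x i) ` {..n})" for x :: "nat \<Rightarrow> real"
  note m [measurable] = stationary_seq_measurable[OF st]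
  have \<Phi>m: "\<Phi> \<in> borel_measurable ?S"
    unfolding \<Phi>_def[abs_def] by (intro borel_measurable_Max) auto
  have Zint: "integrable M (Z i)" for i
    using stationary_seq_same_integral(2)[OF st, of "\<lambda>x. x" i] int by simp
  have sint: "integrable M (\<lambda>\<omega>. \<Sum>i<k. Z i \<omega>)" for k using Zint by simp
  have \<Phi>0: "\<Phi> x \<ge> 0" for x unfolding \<Phi>_def by (rule Max_ge) (auto intro!: image_eqI[where x=0])
  have \<Phi>ub: "\<Phi> x \<le> (\<Sum>i<n. \<bar>x i\<bar>)" for x
    unfolding \<Phi>_def
  proof (intro Max.boundedI; clarsimp)
    fix k assume "k \<le> n"
    have "sum x {..<k} \<le> (\<Sum>i<k. \<bar>x i\<bar>)" by (rule sum_mono) simp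
    also have "\<dots> \<le> (\<Sum>i<n. \<bar>x i\<bar>)" using \<open>k \<le> n\<close> by (intro sum_mono2) auto
    finally show "sum x {..<k} \<le> (\<Sum>i<n. \<bar>x i\<bar>)" .
  qed
  have \<Phi>meas: "(\<lambda>\<omega>. \<Phi> (\<lambda>n. Z n \<omega>)) \<in> borel_measurable M"
    by (rule measurable_compose[OF path_measurable \<Phi>m]) (rule m)
  have \<Phi>int: "integrable M (\<lambda>\<omega>. \<Phi> (\<lambda>n. Z n \<omega>))"
  proof (rule Bochner_Integration.integrable_bound)
    show "integrable M (\<lambda>\<omega>. \<Sum>i<n. \<bar>Z i \<omega>\<bar>)" using Zint by simp
    show "AE x in M. norm (\<Phi> (\<lambda>n. Z n x)) \<le> norm (\<Sum>i<n. \<bar>Z i x\<bar>)"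
      using \<Phi>0 \<Phi>ub by (auto intro!: AE_I2 simp: order.trans[OF _ abs_ge_self])
  qed (rule \<Phi>meas)
  have \<Phi>int': "integrable M (\<lambda>\<omega>. \<Phi> (\<lambda>n. Z (Suc n) \<omega>))"
    using stationary_seq_integral_shift(2)[OF st \<Phi>m] \<Phi>int by simp
  have key: "\<Phi> (\<lambda>n. Z n \<omega>) - \<Phi> (\<lambda>n. Z (Suc n) \<omega>) \<le> Z 0 \<omega> * indicator {\<omega>. \<exists>k\<le>n. 0 < (\<Sum>i<k. Z i \<omega>)} \<omega>" for \<omega>
  proof (cases "\<exists>k\<le>n. 0 < (\<Sum>i<k. Z i \<omega>)")
    case False
    then have "\<Phi> (\<lambda>n. Z n \<omega>) \<le> 0"
      unfolding \<Phi>_def by (intro Max.boundedI) (auto simp: not_less)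
    then show ?thesis using False \<Phi>0[of "\<lambda>n. Z (Suc n) \<omega>"] by auto
  next
    case True
    have "\<Phi> (\<lambda>n. Z n \<omega>) \<in> (\<lambda>k. \<Sum>i<k. Z i \<omega>) ` {..n}"
      unfolding \<Phi>_def by (rule Max_in) auto
    then obtain k where k: "k \<le> n" "\<Phi> (\<lambda>n. Z n \<omega>) = (\<Sum>i<k. Z i \<omega>)" by auto
    from True obtain j where j: "j \<le> n" "0 < (\<Sum>i<j. Z i \<omega>)" by auto
    have "(\<Sum>i<j. Z i \<omega>) \<le> \<Phi> (\<lambda>n. Z n \<omega>)" unfolding \<Phi>_def using j by (intro Max_ge) auto
    with j k have "k \<noteq> 0" by (cases k) auto
    then obtain l where l: "k = Suc l" by (cases k) auto
    have "(\<Sum>i<k. Z i \<omega>) = Z 0 \<omega> + (\<Sum>i<l. Z (Suc i) \<omega>)"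
      unfolding l by (subst sum.lessThan_Suc_shift) simp
    moreover have "(\<Sum>i<l. Z (Suc i) \<omega>) \<le> \<Phi> (\<lambda>n. Z (Suc n) \<omega>)"
      unfolding \<Phi>_def using k l by (intro Max_ge) auto
    ultimately show ?thesis using True k by simp
  qed
  have "0 = (\<integral>\<omega>. \<Phi> (\<lambda>n. Z n \<omega>) - \<Phi> (\<lambda>n. Z (Suc n) \<omega>) \<partial>M)"
    using \<Phi>int \<Phi>int' stationary_seq_integral_shift(1)[OF st \<Phi>m] by simp
  also have "\<dots> \<le> (\<integral>\<omega>. Z 0 \<omega> * indicator {\<omega>. \<exists>k\<le>n. 0 < (\<Sum>i<k. Z i \<omega>)} \<omega> \<partial>M)"
  proof (rule integral_mono)
    have "{\<omega>\<in>space M. \<exists>k\<le>n. 0 < (\<Sum>i<k. Z i \<omega>)} \<in> sets M" by measurable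
    then have "integrable M (\<lambda>\<omega>. Z 0 \<omega> * indicator {\<omega>\<in>space M. \<exists>k\<le>n. 0 < (\<Sum>i<k. Z i \<omega>)} \<omega>)"
      by (rule integrable_real_mult_indicator) (rule int)
    then show "integrable M (\<lambda>\<omega>. Z 0 \<omega> * indicator {\<omega>. \<exists>k\<le>n. 0 < (\<Sum>i<k. Z i \<omega>)} \<omega>)"
      by (rule Bochner_Integration.integrable_cong[THEN iffD1, rotated 2]) (auto simp: indicator_def)
  qed (use \<Phi>int \<Phi>int' key in auto)
  finally show ?thesis .
qed

text \<open>
  Unboundedness of the partial sums is unaffected by dropping the first term, so the event is
  exactly shift invariant and has probability 0 or 1. With probability 1 the indicator in
  \<open>maximal_ergodic\<close> would increase to 1 and the mean would be nonnegative.
\<close>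

lemma partial_sums_bounded_if_negative_mean:
  assumes st: "stationary_seq M Z" and er: "ergodic_seq M Z" and int: "integrable M (Z 0)"
    and neg: "(\<integral>\<omega>. Z 0 \<omega> \<partial>M) < 0"
  shows "AE \<omega> in M. \<exists>K::nat. \<forall>n. (\<Sum>i<n. Z i \<omega>) \<le> K"
proof -
  let ?S = "\<Pi>\<^sub>M n\<in>(UNIV::nat set). (borel :: real measure)"
  note m [measurable] = stationary_seq_measurable[OF st]
  define A where "A = {x :: nat \<Rightarrow> real. \<forall>K::nat. \<exists>n. K < (\<Sum>i<n. x i)}"
  have A: "A \<in> sets ?S"
  proof -
    have "{x \<in> space ?S. \<forall>K::nat. \<exists>n. K < (\<Sum>i<n. x i)} \<in> sets ?S" by measurable
    then show ?thesis by (simp add: A_def space_PiM)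
  qed
  have inv: "(\<lambda>x n. x (Suc n)) -` A = A"
  proof -
    have "(\<forall>K::nat. \<exists>n. K < (\<Sum>i<n. x (Suc i))) \<longleftrightarrow> (\<forall>K::nat. \<exists>n. K < (\<Sum>i<n. x i))" for x :: "nat \<Rightarrow> real"
    proof safe
      fix K :: nat assume *: "\<forall>K::nat. \<exists>n. K < (\<Sum>i<n. x (Suc i))"
      obtain L :: nat where "L \<ge> K - x 0" using real_arch_simple by blast
      moreover obtain n where "L < (\<Sum>i<n. x (Suc i))" using * by blast
      ultimately have "K < (\<Sum>i<Suc n. x i)" by (subst sum.lessThan_Suc_shift) linarith
      then show "\<exists>n. K < (\<Sum>i<n. x i)" by blast
    next
      fix K :: nat assume *: "\<forall>K::nat. \<exists>n. K < (\<Sum>i<n. x i)"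
      obtain L :: nat where "L \<ge> K + x 0" using real_arch_simple by blast
      moreover obtain n where n: "L < (\<Sum>i<n. x i)" using * by blast
      moreover from n have "n \<noteq> 0" by (auto intro: ccontr)
      then obtain l where "n = Suc l" by (cases n) auto
      ultimately have "K < (\<Sum>i<l. x (Suc i))" by (simp only: sum.lessThan_Suc_shift)
      then show "\<exists>n. K < (\<Sum>i<n. x (Suc i))" by blast
    qed
    then show ?thesis unfolding A_def by auto
  qed
  let ?E = "{\<omega> \<in> space M. (\<lambda>n. Z n \<omega>) \<in> A}"
  have Em: "?E \<in> sets M"
    unfolding A_def mem_Collect_eq by measurable
  have "prob ?E \<noteq> 1"
  proof
    assume "prob ?E = 1"
    then have ae: "AE \<omega> in M. (\<lambda>n. Z n \<omega>) \<in> A"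
      using Em by (simp add: prob_eq_1)
    have "(\<lambda>n. \<integral>\<omega>. Z 0 \<omega> * indicator {\<omega>. \<exists>k\<le>n. 0 < (\<Sum>i<k. Z i \<omega>)} \<omega> \<partial>M) \<longlonglongrightarrow> (\<integral>\<omega>. Z 0 \<omega> \<partial>M)"
    proof (rule integral_dominated_convergence[where w="\<lambda>\<omega>. \<bar>Z 0 \<omega>\<bar>"])
      show "AE x in M. (\<lambda>n. Z 0 x * indicator {\<omega>. \<exists>k\<le>n. 0 < (\<Sum>i<k. Z i \<omega>)} x) \<longlonglongrightarrow> Z 0 x"
        using ae
      proof eventually_elim
        case (elim \<omega>)
        then have "\<exists>n. real 0 < (\<Sum>i<n. Z i \<omega>)" unfolding A_def by blast
        then obtain n where n: "0 < (\<Sum>i<n. Z i \<omega>)" by auto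
        have "eventually (\<lambda>k. Z 0 \<omega> = Z 0 \<omega> * indicator {\<omega>. \<exists>j\<le>k. 0 < (\<Sum>i<j. Z i \<omega>)} \<omega>) sequentially"
          using eventually_ge_at_top[of n] by eventually_elim (use n in \<open>auto simp: indicator_def\<close>)
        then show ?case using tendsto_const tendsto_cong by fast
      qed
      show "integrable M (\<lambda>\<omega>. \<bar>Z 0 \<omega>\<bar>)" using int by simp
    qed (auto simp: indicator_def)
    then have "0 \<le> (\<integral>\<omega>. Z 0 \<omega> \<partial>M)"
      using maximal_ergodic[OF st int] by (intro LIMSEQ_le_const) auto
    then show False using neg by simp
  qed
  then have "prob ?E = 0"
    using er A inv unfolding ergodic_seq_def by (auto dest!: bspec)
  then have "AE \<omega> in M. (\<lambda>n. Z n \<omega>) \<notin> A"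
    using Em by (simp add: prob_eq_0)
  then show ?thesis unfolding A_def by eventually_elim (auto simp: not_less)
qed

lemma ergodic_average_upper:
  assumes st: "stationary_seq M Z" and er: "ergodic_seq M Z" and int: "integrable M (Z 0)"
    and c: "(\<integral>\<omega>. Z 0 \<omega> \<partial>M) < c"
  shows "AE \<omega> in M. \<forall>\<^sub>F n in sequentially. (\<Sum>i<n. Z i \<omega>) / n < c"
proof -
  obtain d where d: "(\<integral>\<omega>. Z 0 \<omega> \<partial>M) < d" "d < c" using c dense by blast
  have "AE \<omega> in M. \<exists>K::nat. \<forall>n. (\<Sum>i<n. Z i \<omega> - d) \<le> K"
  proof (rule partial_sums_bounded_if_negative_mean)
    show "stationary_seq M (\<lambda>n \<omega>. Z n \<omega> - d)" by (rule stationary_seq_comp[OF st]) measurable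
    show "ergodic_seq M (\<lambda>n \<omega>. Z n \<omega> - d)" by (rule ergodic_seq_comp[OF er]) measurable
  qed (use int d in \<open>auto simp: prob_space\<close>)
  then show ?thesis
  proof eventually_elim
    case (elim \<omega>)
    then obtain K :: nat where K: "\<And>n. (\<Sum>i<n. Z i \<omega>) - n * d \<le> K" by (auto simp: sum_subtractf)
    have "(\<lambda>n. real K / real n) \<longlonglongrightarrow> 0" by (rule lim_const_over_n)
    then have "\<forall>\<^sub>F n in sequentially. real K / real n < c - d"
      using d by (intro order_tendstoD) auto
    then show ?case using eventually_gt_at_top[of 0]
    proof eventually_elim
      case (elim n)
      then have "K < (c - d) * n" by (simp add: field_simps)
      with K[of n] have "(\<Sum>i<n. Z i \<omega>) < c * n" by (simp add: field_simps)
      then show ?case using elim by (simp add: field_simps)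
    qed
  qed
qed

text \<open>
  The one-sided bound for \<open>Z\<close> and for \<open>- Z\<close>, at levels approaching the mean.
\<close>

theorem ergodic_average:
  assumes st: "stationary_seq M Z" and er: "ergodic_seq M Z" and int: "integrable M (Z 0)"
  shows "AE \<omega> in M. (\<lambda>n. (\<Sum>i<n. Z i \<omega>) / n) \<longlonglongrightarrow> (\<integral>\<omega>. Z 0 \<omega> \<partial>M)"
proof -
  let ?\<mu> = "\<integral>\<omega>. Z 0 \<omega> \<partial>M"
  have up: "AE \<omega> in M. \<forall>\<^sub>F n in sequentially. (\<Sum>i<n. Z i \<omega>) / n < ?\<mu> + 1 / Suc j" for j :: nat
    by (rule ergodic_average_upper[OF st er int]) simp
  have st': "stationary_seq M (\<lambda>n \<omega>. - Z n \<omega>)" by (rule stationary_seq_comp[OF st]) measurable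
  have er': "ergodic_seq M (\<lambda>n \<omega>. - Z n \<omega>)" by (rule ergodic_seq_comp[OF er]) measurable
  have lo: "AE \<omega> in M. \<forall>\<^sub>F n in sequentially. (\<Sum>i<n. - Z i \<omega>) / n < - ?\<mu> + 1 / Suc j" for j :: nat
    by (rule ergodic_average_upper[OF st' er']) (use int in auto)
  have "AE \<omega> in M. (\<forall>j::nat. \<forall>\<^sub>F n in sequentially. (\<Sum>i<n. Z i \<omega>) / n < ?\<mu> + 1 / Suc j) \<and>
    (\<forall>j::nat. \<forall>\<^sub>F n in sequentially. (\<Sum>i<n. - Z i \<omega>) / n < - ?\<mu> + 1 / Suc j)"
    using up lo by (simp only: AE_all_countable AE_conj_iff) blast
  then show ?thesis
  proof eventually_elim
    case (elim \<omega>)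
    show ?case
    proof (rule tendstoI)
      fix e :: real assume "0 < e"
      then obtain j :: nat where j: "1 / Suc j < e" using nat_approx_posE by (metis of_nat_Suc)
      from elim have "\<forall>\<^sub>F n in sequentially. (\<Sum>i<n. Z i \<omega>) / n < ?\<mu> + 1 / Suc j"
        "\<forall>\<^sub>F n in sequentially. (\<Sum>i<n. - Z i \<omega>) / n < - ?\<mu> + 1 / Suc j" by blast+
      then show "\<forall>\<^sub>F n in sequentially. dist ((\<Sum>i<n. Z i \<omega>) / n) ?\<mu> < e"
      proof eventually_elim
        case (elim n)
        then show ?case using j by (auto simp: dist_real_def sum_negf abs_less_iff)
      qed
    qed
  qed
qed

lemma indep_sets_reindex:
  assumes inj: "inj_on f I" and ind: "indep_sets G (f ` I)"
  shows "indep_sets (\<lambda>i. G (f i)) I"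
proof (rule indep_setsI)
  fix i assume "i \<in> I" then show "G (f i) \<subseteq> events" using ind unfolding indep_sets_def by auto
next
  fix A J assume J: "J \<noteq> {}" "J \<subseteq> I" "finite J" "\<forall>j\<in>J. A j \<in> G (f j)"
  have inv: "inv_into I f (f j) = j" if "j \<in> J" for j using inj J that by (auto intro: inv_into_f_f)
  have "prob (\<Inter>i\<in>f ` J. A (inv_into I f i)) = (\<Prod>i\<in>f ` J. prob (A (inv_into I f i)))"
    by (rule indep_setsD[OF ind]) (use J inv in auto)
  moreover have "(\<Prod>i\<in>f ` J. prob (A (inv_into I f i))) = (\<Prod>j\<in>J. prob (A j))"
    using inj_on_subset[OF inj J(2)] by (subst prod.reindex) (auto simp: inv intro: prod.cong)
  moreover have "(\<Inter>i\<in>f ` J. A (inv_into I f i)) = (\<Inter>j\<in>J. A j)" using inv by auto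
  ultimately show "prob (\<Inter>j\<in>J. A j) = (\<Prod>j\<in>J. prob (A j))" by simp
qed

text \<open>
  Every shift of an i.i.d. sequence has the same product law.
\<close>

lemma iid_seq_stationary:
  assumes iid: "iid_seq M Z"
  shows "stationary_seq M (\<lambda>n. Z (Suc n))"
proof -
  let ?S = "\<Pi>\<^sub>M n\<in>(UNIV::nat set). (borel :: real measure)"
  have ind: "indep_vars (\<lambda>_. borel) Z {1..}" and eq: "\<And>n. n \<ge> 1 \<Longrightarrow> distr M borel (Z n) = distr M borel (Z 1)"
    using iid unfolding iid_seq_def by blast+
  have rv: "Z (Suc n) \<in> borel_measurable M" for n using ind unfolding indep_vars_def by auto
  have law: "distr M ?S (\<lambda>\<omega> n. Z (Suc (n + k)) \<omega>) = (\<Pi>\<^sub>M n\<in>UNIV. distr M borel (Z 1))" for k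
  proof -
    have "indep_vars (\<lambda>_. borel) (\<lambda>n. Z (Suc (n + k))) UNIV"
    proof -
      have "indep_sets (\<lambda>n. {Z n -` B \<inter> space M | B. B \<in> sets borel}) (range (\<lambda>n. Suc (n + k)))"
        by (rule indep_sets_mono_index[OF _ ind[unfolded indep_vars_def2, THEN conjunct2]]) auto
      from indep_sets_reindex[OF _ this] show ?thesis
        unfolding indep_vars_def2 using rv by (simp add: inj_on_def)
    qed
    from indep_vars_iff_distr_eq_PiM[THEN iffD1, OF _ _ this] rv
    have "distr M ?S (\<lambda>\<omega> n. Z (Suc (n + k)) \<omega>) = (\<Pi>\<^sub>M n\<in>UNIV. distr M borel (Z (Suc (n+k))))"
      by (simp add: restrict_UNIV)
    also have "\<dots> = (\<Pi>\<^sub>M n\<in>UNIV. distr M borel (Z 1))"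
      by (intro PiM_cong refl eq) simp
    finally show ?thesis .
  qed
  show ?thesis unfolding stationary_seq_def using rv law[of 0] law[of 1] by simp
qed

text \<open>
  A shift-invariant event is determined by the terms from any index on, so it is a tail event and
  Kolmogorov's zero-one law applies.
\<close>

lemma iid_seq_ergodic:
  assumes iid: "iid_seq M Z"
  shows "ergodic_seq M (\<lambda>n. Z (Suc n))"
  unfolding ergodic_seq_def
proof (intro ballI impI)
  let ?S = "\<Pi>\<^sub>M n\<in>(UNIV::nat set). (borel :: real measure)"
  fix A assume A: "A \<in> sets ?S" and inv: "(\<lambda>x n. x (Suc n)) -` A = A"
  have ind: "indep_vars (\<lambda>_. borel) Z {1..}"
    using iid unfolding iid_seq_def by auto
  have rv: "Z (Suc n) \<in> borel_measurable M" for n using ind unfolding indep_vars_def by auto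
  let ?F = "\<lambda>n. {Z (Suc n) -` B \<inter> space M | B. B \<in> sets borel}"
  let ?E = "{\<omega> \<in> space M. (\<lambda>n. Z (Suc n) \<omega>) \<in> A}"
  have sa: "sigma_algebra (space M) (?F n)" for n
    using sets.sigma_algebra_axioms[of "vimage_algebra (space M) (Z (Suc n)) borel"]
    by (simp add: sets_vimage_algebra2)
  have "indep_sets (\<lambda>n. {Z n -` B \<inter> space M | B. B \<in> sets borel}) {1..}"
    using ind unfolding indep_vars_def2 by simp
  then have ind': "indep_sets ?F UNIV"
    by (intro indep_sets_reindex[of Suc UNIV] indep_sets_mono_index[of "range Suc" "{1..}"]) auto
  have "?E \<in> tail_events ?F"
    unfolding tail_events_def
  proof
    fix k :: nat
    let ?G = "sigma (space M) (\<Union> (?F ` {k..}))"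
    have shift: "(\<lambda>n. x (n + k)) \<in> A \<longleftrightarrow> x \<in> A" for x
    proof (induction k arbitrary: x)
      case (Suc k)
      have "(\<lambda>n. x (n + Suc k)) \<in> A \<longleftrightarrow> (\<lambda>n. x (Suc n)) \<in> A" using Suc[of "\<lambda>n. x (Suc n)"] by simp
      also have "\<dots> \<longleftrightarrow> x \<in> A" using arg_cong[OF inv, of "\<lambda>B. x \<in> B"] by simp
      finally show ?case .
    qed simp
    have sub: "\<Union> (?F ` {k..}) \<subseteq> Pow (space M)" by auto
    have meas: "Z (Suc (n + k)) \<in> borel_measurable ?G" for n
    proof (rule measurableI)
      fix B :: "real set" assume "B \<in> sets borel"
      then have "Z (Suc (n + k)) -` B \<inter> space M \<in> \<Union> (?F ` {k..})" by (auto intro!: bexI[of _ "n+k"])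
      then show "Z (Suc (n + k)) -` B \<inter> space ?G \<in> sets ?G"
        using sub by (simp add: sigma_sets.Basic)
    qed auto
    have "(\<lambda>\<omega> n. Z (Suc (n + k)) \<omega>) \<in> measurable ?G ?S"
      using meas by (intro measurable_PiM_single') (auto simp: space_PiM)
    from measurable_sets[OF this A] have "{\<omega> \<in> space M. (\<lambda>n. Z (Suc (n + k)) \<omega>) \<in> A} \<in> sigma_sets (space M) (\<Union> (?F ` {k..}))"
      using sub by (simp add: vimage_def Int_def conj_commute)
    then show "?E \<in> sigma_sets (space M) (\<Union> (?F ` {k..}))"
      using shift[of "\<lambda>n. Z (Suc n) _"] by simp
  qed
  from kolmogorov_0_1_law[OF sa ind' this]
  show "prob ?E \<in> {0, 1}" by auto
qed

end

section \<open>Convergence in probability and random sums\<close>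

text \<open>
  The index filter is arbitrary: sequences of averages and processes in continuous time both occur.
\<close>

definition conv_in_prob :: "'a measure \<Rightarrow> ('i \<Rightarrow> 'a \<Rightarrow> real) \<Rightarrow> real \<Rightarrow> 'i filter \<Rightarrow> bool" where
  "conv_in_prob M Z c G \<longleftrightarrow>
     (\<forall>\<epsilon>>0. ((\<lambda>i. measure M {\<omega> \<in> space M. \<epsilon> < \<bar>Z i \<omega> - c\<bar>}) \<longlongrightarrow> 0) G)"

lemma conv_in_probD:
  "conv_in_prob M Z c G \<Longrightarrow> 0 < \<epsilon> \<Longrightarrow> ((\<lambda>i. measure M {\<omega> \<in> space M. \<epsilon> < \<bar>Z i \<omega> - c\<bar>}) \<longlongrightarrow> 0) G"
  unfolding conv_in_prob_def by blast

context prob_space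
begin

lemma conv_in_prob_AE:
  assumes [measurable]: "\<And>n. Z n \<in> borel_measurable M"
    and ae: "AE \<omega> in M. (\<lambda>n. Z n \<omega>) \<longlonglongrightarrow> c"
  shows "conv_in_prob M Z c sequentially"
  unfolding conv_in_prob_def
proof (intro allI impI)
  fix \<epsilon> :: real assume \<epsilon>: "0 < \<epsilon>"
  have "(\<lambda>n. \<integral>\<omega>. indicator {\<omega> \<in> space M. \<epsilon> < \<bar>Z n \<omega> - c\<bar>} \<omega> \<partial>M) \<longlonglongrightarrow> (\<integral>\<omega>. (0::real) \<partial>M)"
  proof (rule integral_dominated_convergence[where w="\<lambda>_. 1"])
    show "AE x in M. (\<lambda>n. indicator {\<omega> \<in> space M. \<epsilon> < \<bar>Z n \<omega> - c\<bar>} x) \<longlonglongrightarrow> (0::real)"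
      using ae
    proof eventually_elim
      case (elim \<omega>)
      from tendstoD[OF this \<epsilon>]
      have "eventually (\<lambda>n. (0::real) = indicator {\<omega> \<in> space M. \<epsilon> < \<bar>Z n \<omega> - c\<bar>} \<omega>) sequentially"
        by eventually_elim (auto simp: indicator_def dist_real_def)
      then show ?case using tendsto_const tendsto_cong by fast
    qed
  qed (auto simp: indicator_def)
  then show "(\<lambda>n. measure M {\<omega> \<in> space M. \<epsilon> < \<bar>Z n \<omega> - c\<bar>}) \<longlonglongrightarrow> 0"
    by simp
qed

text \<open>
  A substitute for uniform integrability when both limits are constants: outside a small event
  \<open>A\<close> is near \<open>a\<close>, and on that event \<open>\<bar>A - a\<bar>\<close> is at most \<open>\<bar>B - b\<bar> + \<bar>a\<bar> + \<bar>b\<bar>\<close>.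
\<close>

lemma mean_tendsto_if_dominated:
  assumes A: "\<forall>\<^sub>F i in G. A i \<in> borel_measurable M"
    and B: "\<forall>\<^sub>F i in G. integrable M (B i)"
    and dom: "\<forall>\<^sub>F i in G. AE \<omega> in M. 0 \<le> A i \<omega> \<and> A i \<omega> \<le> B i \<omega>"
    and L1: "((\<lambda>i. \<integral>\<omega>. \<bar>B i \<omega> - b\<bar> \<partial>M) \<longlongrightarrow> 0) G"
    and prob: "conv_in_prob M A a G"
  shows "((\<lambda>i. \<integral>\<omega>. A i \<omega> \<partial>M) \<longlongrightarrow> a) G"
proof (rule tendstoI)
  fix e :: real assume e: "0 < e"
  let ?P = "\<lambda>i. measure M {\<omega> \<in> space M. e/2 < \<bar>A i \<omega> - a\<bar>}"
  have "((\<lambda>i. (\<integral>\<omega>. \<bar>B i \<omega> - b\<bar> \<partial>M) + (\<bar>a\<bar> + \<bar>b\<bar>) * ?P i) \<longlongrightarrow> 0 + (\<bar>a\<bar> + \<bar>b\<bar>) * 0) G"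
    by (intro tendsto_intros L1 conv_in_probD[OF prob] half_gt_zero e)
  then have "\<forall>\<^sub>F i in G. (\<integral>\<omega>. \<bar>B i \<omega> - b\<bar> \<partial>M) + (\<bar>a\<bar> + \<bar>b\<bar>) * ?P i < e/2"
    using e by (intro order_tendstoD(2)) auto
  then show "\<forall>\<^sub>F i in G. dist (\<integral>\<omega>. A i \<omega> \<partial>M) a < e"
    using A B dom
  proof eventually_elim
    case (elim i)
    note [measurable] = elim(2)
    have Bi: "integrable M (B i)" by fact
    have Ai: "integrable M (A i)"
      by (rule Bochner_Integration.integrable_bound[OF Bi]) (use elim in auto)
    define S where "S = {\<omega> \<in> space M. e/2 < \<bar>A i \<omega> - a\<bar>}"
    have [measurable]: "S \<in> sets M" unfolding S_def by measurable
    then have int_S: "integrable M (indicator S :: _ \<Rightarrow> real)" by (simp add: emeasure_eq_measure)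
    have "\<bar>(\<integral>\<omega>. A i \<omega> \<partial>M) - a\<bar> = \<bar>\<integral>\<omega>. A i \<omega> - a \<partial>M\<bar>"
      using Ai by (simp add: prob_space)
    also have "\<dots> \<le> (\<integral>\<omega>. \<bar>A i \<omega> - a\<bar> \<partial>M)" by (rule integral_abs_bound)
    also have "\<dots> \<le> (\<integral>\<omega>. e/2 + \<bar>B i \<omega> - b\<bar> + (\<bar>a\<bar> + \<bar>b\<bar>) * indicator S \<omega> \<partial>M)"
    proof (rule integral_mono_AE)
      show "AE \<omega> in M. \<bar>A i \<omega> - a\<bar> \<le> e/2 + \<bar>B i \<omega> - b\<bar> + (\<bar>a\<bar> + \<bar>b\<bar>) * indicator S \<omega>"
        using elim(4) AE_space
      proof eventually_elim
        case w: (elim \<omega>)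
        show ?case
        proof (cases "\<omega> \<in> S")
          case True
          have "\<bar>A i \<omega> - a\<bar> \<le> \<bar>B i \<omega> - b\<bar> + (\<bar>a\<bar> + \<bar>b\<bar>)" using w by argo
          then show ?thesis using True e by simp
        next
          case False
          then have "\<bar>A i \<omega> - a\<bar> \<le> e/2" using w by (simp add: S_def)
          then show ?thesis using False by (simp add: add_increasing2)
        qed
      qed
      show "integrable M (\<lambda>\<omega>. e/2 + \<bar>B i \<omega> - b\<bar> + (\<bar>a\<bar> + \<bar>b\<bar>) * indicator S \<omega>)"
        using Bi int_S by simp
    qed (use Ai in auto)
    also have "\<dots> = e/2 + (\<integral>\<omega>. \<bar>B i \<omega> - b\<bar> \<partial>M) + (\<bar>a\<bar> + \<bar>b\<bar>) * ?P i"
      using Bi int_S by (simp add: prob_space S_def)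
    also have "\<dots> < e" using elim(1) by simp
    finally show ?case by (simp add: dist_real_def)
  qed
qed

text \<open>
  Monotonicity replaces any joint control of the sums and the counting process: with high
  probability the count at time \<open>t\<close> lies between two deterministic indices close to \<open>lam * t\<close>, and the
  random sum lies between the sums up to them. The bounds on the count come from the event times
  through \<open>count\<close>.
\<close>

lemma random_index_conv_in_prob:
  assumes Tm: "\<And>n. 1 \<le> n \<Longrightarrow> T n \<in> borel_measurable M"
    and count: "AE \<omega> in M. \<forall>t\<ge>0. \<forall>n\<ge>1. n \<le> num_events T t \<omega> \<longleftrightarrow> T n \<omega> \<le> t"
    and rate: "tendsto_in_prob M (\<lambda>n \<omega>. T n \<omega> / real n) (1 / lam)" and lam: "0 < lam"
    and Sm [measurable]: "\<And>n. S n \<in> borel_measurable M"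
    and mono: "AE \<omega> in M. mono (\<lambda>n. S n \<omega>)"
    and S: "conv_in_prob M (\<lambda>n \<omega>. S n \<omega> / real n) c sequentially" and c: "0 \<le> c"
  shows "conv_in_prob M (\<lambda>t \<omega>. S (num_events T t \<omega>) \<omega> / t) (lam * c) at_top"
  unfolding conv_in_prob_def
proof (intro allI impI)
  fix \<epsilon> :: real assume \<epsilon>: "0 < \<epsilon>"
  define \<delta> where "\<delta> = min (lam/2) (min 1 (\<epsilon> / (2 * (c + lam + 2))))"
  have \<delta>: "0 < \<delta>" "\<delta> < lam" "\<delta> \<le> 1" "\<delta> * (c + lam + 2) < \<epsilon>"
  proof -
    have "\<delta> * (c + lam + 2) \<le> \<epsilon> / (2 * (c + lam + 2)) * (c + lam + 2)"
      using c lam by (intro mult_right_mono) (auto simp: \<delta>_def)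
    also have "\<dots> = \<epsilon>/2" using c lam by (simp add: add_nonneg_pos divide_simps)
    finally show "\<delta> * (c + lam + 2) < \<epsilon>" using \<epsilon> by simp
  qed (use lam \<epsilon> c in \<open>auto simp: \<delta>_def\<close>)
  have up: "(c + \<delta>) * (lam + \<delta>) < lam * c + \<epsilon>"
  proof -
    have "\<delta> * \<delta> \<le> \<delta>" using \<delta> by (simp add: mult_left_le)
    moreover have "(c + \<delta>) * (lam + \<delta>) = lam * c + (\<delta> * (c + lam + 2) - 2 * \<delta>) + \<delta> * \<delta>" by (simp add: algebra_simps)
    ultimately show ?thesis using \<delta> by linarith
  qed
  have lo: "lam * c - \<epsilon> < (c - \<delta>) * (lam - \<delta>)"
  proof -
    have "0 \<le> \<delta> * \<delta>" by simp
    moreover have "(c - \<delta>) * (lam - \<delta>) = lam * c - (\<delta> * (c + lam + 2) - 2 * \<delta>) + \<delta> * \<delta>" by (simp add: algebra_simps)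
    ultimately show ?thesis using \<delta> by linarith
  qed
  define n1 where "n1 t = nat \<lfloor>(lam - \<delta>) * t\<rfloor>" for t
  define n2 where "n2 t = nat \<lceil>(lam + \<delta>) * t\<rceil>" for t
  have n1_lim: "((\<lambda>t. real (n1 t) / t) \<longlongrightarrow> lam - \<delta>) at_top"
    unfolding n1_def using \<delta> by real_asymp
  have n2_lim: "((\<lambda>t. real (n2 t) / t) \<longlongrightarrow> lam + \<delta>) at_top"
    unfolding n2_def using \<delta> lam by real_asymp
  have n1_top: "filterlim n1 sequentially at_top"
    unfolding n1_def using \<delta> by real_asymp
  have n2_top: "filterlim n2 sequentially at_top"
    unfolding n2_def using \<delta> lam by real_asymp
  \<comment> \<open>Half the gaps that \<open>T n / n\<close> must bridge for the count to leave the window from \<open>n1 t\<close> to \<open>n2 t\<close>.\<close>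
  define \<kappa>1 where "\<kappa>1 = (1 / (lam - \<delta>) - 1 / lam) / 2"
  define \<kappa>2 where "\<kappa>2 = (1 / lam - 1 / (lam + \<delta>)) / 2"
  have \<kappa>: "0 < \<kappa>1" "0 < \<kappa>2" unfolding \<kappa>1_def \<kappa>2_def using \<delta> lam by (auto intro!: divide_strict_left_mono)
  let ?PT = "\<lambda>\<kappa> n. measure M {\<omega> \<in> space M. \<kappa> < \<bar>T n \<omega> / real n - 1 / lam\<bar>}"
  let ?PS = "\<lambda>n. measure M {\<omega> \<in> space M. \<delta> < \<bar>S n \<omega> / real n - c\<bar>}"
  have "((\<lambda>t. ?PT \<kappa>1 (n1 t) + ?PT \<kappa>2 (n2 t) + ?PS (n1 t) + ?PS (n2 t)) \<longlongrightarrow> 0 + 0 + 0 + 0) at_top"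
    using rate \<kappa> S \<delta> unfolding conv_in_prob_def tendsto_in_prob_def
    by (intro tendsto_add filterlim_compose[OF _ n1_top] filterlim_compose[OF _ n2_top]) auto
  then have lim: "((\<lambda>t. ?PT \<kappa>1 (n1 t) + ?PT \<kappa>2 (n2 t) + ?PS (n1 t) + ?PS (n2 t)) \<longlongrightarrow> 0) at_top"
    by simp
  show "((\<lambda>t. measure M {\<omega> \<in> space M. \<epsilon> < \<bar>S (num_events T t \<omega>) \<omega> / t - lam * c\<bar>}) \<longlongrightarrow> 0) at_top"
  proof (rule tendsto_sandwich[OF _ _ tendsto_const lim])
    have e1: "\<forall>\<^sub>F t in at_top. (c + \<delta>) * (n2 t / t) < lam * c + \<epsilon>"
      by (rule order_tendstoD(2)[OF _ up]) (intro tendsto_intros n2_lim)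
    have e2: "\<forall>\<^sub>F t in at_top. lam * c - \<epsilon> < (c - \<delta>) * (n1 t / t)"
      by (rule order_tendstoD(1)[OF _ lo]) (intro tendsto_intros n1_lim)
    have e3: "\<forall>\<^sub>F t in at_top. 1 \<le> n1 t" "\<forall>\<^sub>F t in at_top. 1 \<le> n2 t"
      using n1_top n2_top unfolding filterlim_at_top by auto
    show "\<forall>\<^sub>F t in at_top. measure M {\<omega> \<in> space M. \<epsilon> < \<bar>S (num_events T t \<omega>) \<omega> / t - lam * c\<bar>}
        \<le> ?PT \<kappa>1 (n1 t) + ?PT \<kappa>2 (n2 t) + ?PS (n1 t) + ?PS (n2 t)"
      using e1 e2 e3 eventually_gt_at_top[of 0]
    proof eventually_elim
      case (elim t)
      have [measurable]: "T (n1 t) \<in> borel_measurable M" "T (n2 t) \<in> borel_measurable M" using Tm elim by auto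
      have n1: "real (n1 t) \<le> (lam - \<delta>) * t" unfolding n1_def using elim \<delta> by (simp add: of_nat_nat)
      have n2: "(lam + \<delta>) * t \<le> real (n2 t)" unfolding n2_def using elim \<delta> by linarith
      let ?E1 = "{\<omega> \<in> space M. \<kappa>1 < \<bar>T (n1 t) \<omega> / real (n1 t) - 1 / lam\<bar>}"
      let ?E2 = "{\<omega> \<in> space M. \<kappa>2 < \<bar>T (n2 t) \<omega> / real (n2 t) - 1 / lam\<bar>}"
      let ?E3 = "{\<omega> \<in> space M. \<delta> < \<bar>S (n1 t) \<omega> / real (n1 t) - c\<bar>}"
      let ?E4 = "{\<omega> \<in> space M. \<delta> < \<bar>S (n2 t) \<omega> / real (n2 t) - c\<bar>}"
      have sub: "AE \<omega> in M. \<omega> \<in> {\<omega> \<in> space M. \<epsilon> < \<bar>S (num_events T t \<omega>) \<omega> / t - lam * c\<bar>} \<longrightarrow>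
        \<omega> \<in> ?E1 \<union> ?E2 \<union> ?E3 \<union> ?E4"
        using count mono
      proof eventually_elim
        case w: (elim \<omega>)
        show ?case
        proof (rule ccontr, simp, elim conjE)
          assume \<omega>: "\<omega> \<in> space M" and far: "\<epsilon> < \<bar>S (num_events T t \<omega>) \<omega> / t - lam * c\<bar>"
            and "\<not> \<kappa>1 < \<bar>T (n1 t) \<omega> / real (n1 t) - 1 / lam\<bar>" "\<not> \<kappa>2 < \<bar>T (n2 t) \<omega> / real (n2 t) - 1 / lam\<bar>"
            "\<not> \<delta> < \<bar>S (n1 t) \<omega> / real (n1 t) - c\<bar>" "\<not> \<delta> < \<bar>S (n2 t) \<omega> / real (n2 t) - c\<bar>"
          then have T1: "T (n1 t) \<omega> / real (n1 t) \<le> 1 / lam + \<kappa>1"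
            and T2: "T (n2 t) \<omega> / real (n2 t) \<ge> 1 / lam - \<kappa>2"
            and S1: "S (n1 t) \<omega> / real (n1 t) \<ge> c - \<delta>"
            and S2: "S (n2 t) \<omega> / real (n2 t) \<le> c + \<delta>" by auto
          have "T (n1 t) \<omega> / real (n1 t) < 1 / (lam - \<delta>)" using T1 \<kappa> unfolding \<kappa>1_def by argo
          then have "T (n1 t) \<omega> < real (n1 t) / (lam - \<delta>)" using elim by (simp add: field_simps)
          also have "\<dots> \<le> t" using n1 \<delta> by (simp add: field_simps)
          finally have N1: "n1 t \<le> num_events T t \<omega>" using w elim by auto
          have "T (n2 t) \<omega> / real (n2 t) > 1 / (lam + \<delta>)" using T2 \<kappa> unfolding \<kappa>2_def by argo
          then have "T (n2 t) \<omega> > real (n2 t) / (lam + \<delta>)" using elim by (simp add: field_simps)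
          moreover have "real (n2 t) / (lam + \<delta>) \<ge> t" using n2 \<delta> lam by (simp add: field_simps)
          ultimately have "\<not> T (n2 t) \<omega> \<le> t" by simp
          then have N2: "num_events T t \<omega> \<le> n2 t" using w elim by (metis less_eq_real_def linorder_le_cases)
          have "S (num_events T t \<omega>) \<omega> \<le> S (n2 t) \<omega>" using w N2 by (auto dest: monoD)
          also have "S (n2 t) \<omega> \<le> (c + \<delta>) * n2 t" using S2 elim by (simp add: field_simps)
          finally have "S (num_events T t \<omega>) \<omega> / t \<le> (c + \<delta>) * (n2 t / t)" using elim by (simp add: field_simps)
          moreover have "S (n1 t) \<omega> \<le> S (num_events T t \<omega>) \<omega>" using w N1 by (auto dest: monoD)
          moreover have "(c - \<delta>) * n1 t \<le> S (n1 t) \<omega>" using S1 elim by (simp add: field_simps)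
          ultimately have "(c - \<delta>) * n1 t / t \<le> S (num_events T t \<omega>) \<omega> / t"
            using elim by (intro divide_right_mono) auto
          with \<open>S (num_events T t \<omega>) \<omega> / t \<le> (c + \<delta>) * (n2 t / t)\<close>
          have "S (num_events T t \<omega>) \<omega> / t \<le> (c + \<delta>) * (n2 t / t) \<and>
              (c - \<delta>) * (n1 t / t) \<le> S (num_events T t \<omega>) \<omega> / t" by simp
          then show False using far elim by linarith
        qed
      qed
      have "measure M {\<omega> \<in> space M. \<epsilon> < \<bar>S (num_events T t \<omega>) \<omega> / t - lam * c\<bar>} \<le> measure M (?E1 \<union> ?E2 \<union> ?E3 \<union> ?E4)"
        using sub by (intro finite_measure_mono_AE) auto
      also have "\<dots> \<le> measure M (?E1 \<union> ?E2 \<union> ?E3) + measure M ?E4"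
        by (rule measure_Un_le) auto
      also have "measure M (?E1 \<union> ?E2 \<union> ?E3) \<le> measure M (?E1 \<union> ?E2) + measure M ?E3"
        by (rule measure_Un_le) auto
      also have "measure M (?E1 \<union> ?E2) \<le> measure M ?E1 + measure M ?E2"
        by (rule measure_Un_le) auto
      finally show ?case by simp
    qed
  qed auto
qed

end

section \<open>Limits in distribution\<close>

lemma tendsto_in_distr_continuous:
  fixes g :: "'d :: topological_space \<Rightarrow> 'e :: topological_space"
  assumes d: "tendsto_in_distr M Z N L G" and g: "continuous_on UNIV g"
  shows "tendsto_in_distr M (\<lambda>i \<omega>. g (Z i \<omega>)) N (\<lambda>\<omega>. g (L \<omega>)) G"
  unfolding tendsto_in_distr_def
proof (intro allI impI)
  fix f :: "'e \<Rightarrow> real" assume f: "continuous_on UNIV f" "bounded (range f)"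
  have "continuous_on UNIV (\<lambda>x. f (g x))"
    using continuous_on_compose2[OF f(1) g] by simp
  moreover have "bounded (range (\<lambda>x. f (g x)))"
    by (rule bounded_subset[OF f(2)]) auto
  ultimately show "((\<lambda>i. \<integral>\<omega>. f (g (Z i \<omega>)) \<partial>M) \<longlongrightarrow> (\<integral>\<omega>. f (g (L \<omega>)) \<partial>N)) G"
    using d unfolding tendsto_in_distr_def by blast
qed

text \<open>
  The continuous test function \<open>min 1 (max 0 (- x))\<close> charges exactly the negative half-line.
\<close>

lemma tendsto_in_distr_nonneg:
  fixes L :: "'b \<Rightarrow> real"
  assumes d: "tendsto_in_distr M Z N L G" and N: "prob_space N" and L: "L \<in> borel_measurable N"
    and G: "G \<noteq> bot" and nonneg: "\<forall>\<^sub>F i in G. AE \<omega> in M. 0 \<le> Z i \<omega>"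
  shows "AE \<omega> in N. 0 \<le> L \<omega>"
proof -
  interpret N: prob_space N by (rule N)
  note [measurable] = L
  let ?f = "\<lambda>x::real. min 1 (max 0 (- x))"
  have "continuous_on UNIV ?f" by (intro continuous_intros)
  moreover have "bounded (range ?f)" unfolding bounded_iff by (intro exI[of _ 1]) auto
  ultimately have "((\<lambda>i. \<integral>\<omega>. ?f (Z i \<omega>) \<partial>M) \<longlongrightarrow> (\<integral>\<omega>. ?f (L \<omega>) \<partial>N)) G"
    using d unfolding tendsto_in_distr_def by blast
  moreover have "\<forall>\<^sub>F i in G. (\<integral>\<omega>. ?f (Z i \<omega>) \<partial>M) = 0"
    using nonneg
  proof eventually_elim
    case (elim i)
    show ?case by (rule integral_eq_zero_AE) (use elim in eventually_elim, auto)
  qed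
  ultimately have "((\<lambda>i. 0) \<longlongrightarrow> (\<integral>\<omega>. ?f (L \<omega>) \<partial>N)) G"
    using tendsto_cong by fastforce
  then have "(\<integral>\<omega>. ?f (L \<omega>) \<partial>N) = 0"
    using tendsto_unique[OF G _ tendsto_const] by blast
  moreover have "integrable N (\<lambda>\<omega>. ?f (L \<omega>))"
    by (rule N.integrable_const_bound[where B=1]) auto
  ultimately have "AE \<omega> in N. ?f (L \<omega>) = 0"
    by (subst (asm) integral_nonneg_eq_0_iff_AE) auto
  then show ?thesis by eventually_elim (auto simp: min_def max_def split: if_splits)
qed

text \<open>
  The exponential is unbounded on the negative half-line, so the test function is
  \<open>exp (- \<theta> * max 0 x)\<close>, which agrees with it almost surely.
\<close>

lemma tendsto_in_distr_laplace:
  fixes L :: "'b \<Rightarrow> real"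
  assumes d: "tendsto_in_distr M Z N L G" and N: "prob_space N" and L: "L \<in> borel_measurable N"
    and G: "G \<noteq> bot" and nonneg: "\<forall>\<^sub>F i in G. AE \<omega> in M. 0 \<le> Z i \<omega>"
    and Z: "\<forall>\<^sub>F i in G. Z i \<in> borel_measurable M" and \<theta>: "0 \<le> \<theta>"
  shows "((\<lambda>i. \<integral>\<omega>. exp (- \<theta> * Z i \<omega>) \<partial>M) \<longlongrightarrow> (\<integral>\<omega>. exp (- \<theta> * L \<omega>) \<partial>N)) G"
proof -
  note [measurable] = L
  let ?f = "\<lambda>x::real. exp (- \<theta> * max 0 x)"
  have "continuous_on UNIV ?f" by (intro continuous_intros)
  moreover have "bounded (range ?f)" unfolding bounded_iff using \<theta> by (intro exI[of _ 1]) auto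
  ultimately have "((\<lambda>i. \<integral>\<omega>. ?f (Z i \<omega>) \<partial>M) \<longlongrightarrow> (\<integral>\<omega>. ?f (L \<omega>) \<partial>N)) G"
    using d unfolding tendsto_in_distr_def by blast
  moreover have "(\<integral>\<omega>. ?f (L \<omega>) \<partial>N) = (\<integral>\<omega>. exp (- \<theta> * L \<omega>) \<partial>N)"
  proof (rule integral_cong_AE)
    show "AE \<omega> in N. ?f (L \<omega>) = exp (- \<theta> * L \<omega>)"
      using tendsto_in_distr_nonneg[OF d N L G nonneg] by eventually_elim simp
  qed measurable
  moreover have "\<forall>\<^sub>F i in G. (\<integral>\<omega>. ?f (Z i \<omega>) \<partial>M) = (\<integral>\<omega>. exp (- \<theta> * Z i \<omega>) \<partial>M)"
    using nonneg Z
  proof eventually_elim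
    case (elim i)
    note [measurable] = elim(2)
    show ?case
    proof (rule integral_cong_AE)
      show "AE \<omega> in M. ?f (Z i \<omega>) = exp (- \<theta> * Z i \<omega>)" using elim(1) by eventually_elim simp
    qed measurable
  qed
  ultimately show ?thesis using tendsto_cong by fastforce
qed

section \<open>Laplace transforms and the fluid input\<close>

text \<open>
  The gap between \<open>exp (- u)\<close> and its tangent at 0. It is convex with its only zero at 0, so a small
  mean gap forces \<open>u\<close> to be small in mean.
\<close>

definition exp_excess :: "real \<Rightarrow> real" where
  "exp_excess u = exp (- u) - 1 + u"

lemma exp_excess_nonneg: "0 \<le> exp_excess u"
  using exp_ge_add_one_self[of "-u"] by (simp add: exp_excess_def)

lemma exp_excess_pos: "u \<noteq> 0 \<Longrightarrow> 0 < exp_excess u"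
  using exp_minus_greater[of u] by (simp add: exp_excess_def)

lemma exp_excess_convex: "convex_on UNIV exp_excess"
proof -
  have "convex_on UNIV (\<lambda>u. exp (- u) :: real)"
    by (rule f''_ge0_imp_convex[where f'="\<lambda>u. - exp (- u)" and f''="\<lambda>u. exp (- u)"])
       (auto intro!: derivative_eq_intros)
  then have "convex_on UNIV (\<lambda>u. exp (- u) + (u + (- 1)) :: real)"
    by (intro convex_on_add) (auto simp: convex_on_def algebra_simps)
  then show ?thesis by (simp add: exp_excess_def[abs_def] algebra_simps)
qed

lemma exp_excess_scale:
  assumes "0 \<le> s" "s \<le> 1"
  shows "exp_excess (s * u) \<le> s * exp_excess u"
  using convex_onD[OF exp_excess_convex assms, of 0 u] by (simp add: exp_excess_def)

text \<open>
  Convexity makes the excess grow at least linearly outside any interval around 0.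
\<close>

lemma abs_le_exp_excess:
  assumes e: "0 < e"
  shows "\<exists>K\<ge>0. \<forall>u. \<bar>u\<bar> \<le> e + K * exp_excess u"
proof -
  define k where "k = min (exp_excess e) (exp_excess (- e))"
  have k: "0 < k" unfolding k_def using e by (auto intro!: exp_excess_pos)
  have "\<bar>u\<bar> \<le> e + (e / k) * exp_excess u" for u
  proof (cases "\<bar>u\<bar> \<le> e")
    case True then show ?thesis using exp_excess_nonneg[of u] e k by (simp add: add_increasing2)
  next
    case False
    then have u: "\<bar>u\<bar> > e" by simp
    have "k \<le> exp_excess (e / \<bar>u\<bar> * u)"
      using u e by (cases "u \<ge> 0") (auto simp: k_def)
    also have "\<dots> \<le> e / \<bar>u\<bar> * exp_excess u"
      by (rule exp_excess_scale) (use u e in auto)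
    finally have "\<bar>u\<bar> \<le> (e / k) * exp_excess u" using u e k by (simp add: field_simps)
    then show ?thesis using e by simp
  qed
  then show ?thesis using e k by (intro exI[of _ "e / k"]) auto
qed

text \<open>
  Since the mean of \<open>Z i\<close> is exactly \<open>m\<close>, the mean of \<open>exp_excess (Z i - m)\<close> is
  \<open>exp m * E (exp (- Z i)) - 1\<close>, which tends to 0. One point of the Laplace transform thus suffices for
  a law of large numbers in mean.
\<close>

lemma (in prob_space) L1_tendsto_if_laplace_tendsto:
  fixes m :: real
  assumes int: "\<forall>\<^sub>F i in G. integrable M (Z i) \<and> integrable M (\<lambda>\<omega>. exp (- Z i \<omega>))"
    and mean: "\<forall>\<^sub>F i in G. (\<integral>\<omega>. Z i \<omega> \<partial>M) = m"
    and lap: "((\<lambda>i. \<integral>\<omega>. exp (- Z i \<omega>) \<partial>M) \<longlongrightarrow> exp (- m)) G"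
  shows "((\<lambda>i. \<integral>\<omega>. \<bar>Z i \<omega> - m :: real\<bar> \<partial>M) \<longlongrightarrow> 0) G"
proof (rule tendstoI)
  fix e :: real assume e: "0 < e"
  obtain K where K: "K \<ge> 0" "\<And>u. \<bar>u\<bar> \<le> e/2 + K * exp_excess u"
    using abs_le_exp_excess[of "e/2"] e by auto
  have "((\<lambda>i. e/2 + K * (exp m * (\<integral>\<omega>. exp (- Z i \<omega>) \<partial>M) - 1)) \<longlongrightarrow> e/2 + K * (exp m * exp (- m) - 1)) G"
    by (intro tendsto_intros lap)
  then have "\<forall>\<^sub>F i in G. e/2 + K * (exp m * (\<integral>\<omega>. exp (- Z i \<omega>) \<partial>M) - 1) < e"
    by (rule order_tendstoD) (use e in \<open>simp add: exp_minus field_simps\<close>)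
  then show "\<forall>\<^sub>F i in G. dist (\<integral>\<omega>. \<bar>Z i \<omega> - m\<bar> \<partial>M) 0 < e"
    using int mean
  proof eventually_elim
    case (elim i)
    have ex: "exp_excess (Z i \<omega> - m) = exp m * exp (- Z i \<omega>) - 1 + (Z i \<omega> - m)" for \<omega>
      by (simp add: exp_excess_def exp_diff exp_minus field_simps)
    have "(\<integral>\<omega>. \<bar>Z i \<omega> - m\<bar> \<partial>M) \<le> (\<integral>\<omega>. e/2 + K * exp_excess (Z i \<omega> - m) \<partial>M)"
    proof (rule integral_mono)
      show "\<bar>Z i \<omega> - m\<bar> \<le> e/2 + K * exp_excess (Z i \<omega> - m)" for \<omega> by (rule K(2))
    qed (use elim in \<open>auto simp: ex\<close>)
    also have "\<dots> = e/2 + K * (exp m * (\<integral>\<omega>. exp (- Z i \<omega>) \<partial>M) - 1)"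
      using elim by (simp add: ex prob_space)
    also have "\<dots> < e" using elim by simp
    finally show ?case by (simp add: dist_real_def)
  qed
qed

text \<open>
  Difference quotients are dominated by \<open>Z\<close>, because \<open>1 - exp (- y) \<le> y\<close>.
\<close>

lemma (in prob_space) laplace_right_derivative:
  assumes int: "integrable M Z" and pos: "AE \<omega> in M. 0 \<le> Z \<omega>"
  shows "((\<lambda>\<theta>. \<integral>\<omega>. exp (- \<theta> * Z \<omega>) \<partial>M) has_real_derivative - (\<integral>\<omega>. Z \<omega> \<partial>M)) (at 0 within {0..})"
proof -
  have [measurable]: "Z \<in> borel_measurable M" using int by auto
  have ie: "integrable M (\<lambda>\<omega>. exp (- \<theta> * Z \<omega>))" if "0 \<le> \<theta>" for \<theta>
    by (rule integrable_const_bound[where B=1]) (use pos that in auto)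
  have "((\<lambda>\<theta>. ((\<integral>\<omega>. exp (- \<theta> * Z \<omega>) \<partial>M) - (\<integral>\<omega>. exp (- 0 * Z \<omega>) \<partial>M)) / (\<theta> - 0)) \<longlongrightarrow> - (\<integral>\<omega>. Z \<omega> \<partial>M)) (at 0 within {0..})"
    unfolding tendsto_at_iff_sequentially
  proof (intro allI impI)
    fix x :: "nat \<Rightarrow> real" assume x: "\<forall>i. x i \<in> {0..} - {0}" and lim: "x \<longlonglongrightarrow> 0"
    then have xp: "0 < x i" for i by (auto simp: less_le)
    have "(\<lambda>i. \<integral>\<omega>. (exp (- x i * Z \<omega>) - 1) / x i \<partial>M) \<longlonglongrightarrow> (\<integral>\<omega>. - Z \<omega> \<partial>M)"
    proof (rule integral_dominated_convergence[where w=Z])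
      show "AE \<omega> in M. (\<lambda>i. (exp (- x i * Z \<omega>) - 1) / x i) \<longlonglongrightarrow> - Z \<omega>"
      proof (rule AE_I2)
        fix \<omega>
        have "((\<lambda>y. exp (- y * Z \<omega>)) has_real_derivative - Z \<omega>) (at 0)"
          by (auto intro!: derivative_eq_intros)
        then have "((\<lambda>y. (exp (- y * Z \<omega>) - 1) / y) \<longlongrightarrow> - Z \<omega>) (at 0)"
          by (simp add: has_field_derivative_iff)
        moreover have "filterlim x (at 0) sequentially"
          using lim xp by (auto simp: filterlim_at less_imp_neq[symmetric] intro!: always_eventually)
        ultimately show "(\<lambda>i. (exp (- x i * Z \<omega>) - 1) / x i) \<longlonglongrightarrow> - Z \<omega>"
          by (rule filterlim_compose)
      qed
      show "AE \<omega> in M. norm ((exp (- x i * Z \<omega>) - 1) / x i) \<le> Z \<omega>" for i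
        using pos
      proof eventually_elim
        case (elim \<omega>)
        have "1 - x i * Z \<omega> \<le> exp (- x i * Z \<omega>)" using exp_ge_add_one_self[of "- x i * Z \<omega>"] by simp
        moreover have "exp (- x i * Z \<omega>) \<le> 1" using elim xp[of i] by simp
        ultimately show ?case using xp[of i] by (simp add: divide_le_eq field_simps)
      qed
    qed (use int in auto)
    moreover have "(\<integral>\<omega>. (exp (- x i * Z \<omega>) - 1) / x i \<partial>M) = ((\<integral>\<omega>. exp (- x i * Z \<omega>) \<partial>M) - 1) / x i" for i
      using ie[of "x i"] less_imp_le[OF xp[of i]] by (simp add: prob_space)
    ultimately have "(\<lambda>i. ((\<integral>\<omega>. exp (- x i * Z \<omega>) \<partial>M) - 1) / x i) \<longlonglongrightarrow> - (\<integral>\<omega>. Z \<omega> \<partial>M)"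
      by (simp only: Bochner_Integration.integral_minus)
    then show "((\<lambda>\<theta>. ((\<integral>\<omega>. exp (- \<theta> * Z \<omega>) \<partial>M) - (\<integral>\<omega>. exp (- 0 * Z \<omega>) \<partial>M)) / (\<theta> - 0)) \<circ> x) \<longlonglongrightarrow> - (\<integral>\<omega>. Z \<omega> \<partial>M)"
      by (simp add: comp_def prob_space)
  qed
  then show ?thesis by (simp add: has_field_derivative_iff)
qed

context fluid_queue
begin

lemma F_subalgebra: "sets (F t) \<subseteq> sets M" "space (F t) = space M"
  using filtration_subset space_F by auto

lemma X_adapted: "0 \<le> t \<Longrightarrow> X t \<in> borel_measurable (F t)"
  using input_subordinator unfolding subordinator_def levy_process_def by blast

lemma borel_measurable_F: "f \<in> borel_measurable (F t) \<Longrightarrow> f \<in> borel_measurable M"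
  using F_subalgebra[of t] by (auto simp: measurable_def)

lemma X_measurable: "0 \<le> t \<Longrightarrow> X t \<in> borel_measurable M"
  using X_adapted borel_measurable_F by blast

lemma X_mono: "AE \<omega> in M. mono_on {0..} (\<lambda>t. X t \<omega>)"
  using input_subordinator unfolding subordinator_def by blast

lemma X_zero: "AE \<omega> in M. X 0 \<omega> = 0"
  using input_subordinator unfolding subordinator_def levy_process_def by blast

lemma X_nonneg: "AE \<omega> in M. \<forall>t\<ge>0. 0 \<le> X t \<omega>"
  using X_mono X_zero by eventually_elim (metis atLeast_iff mono_onD order_refl)

lemma X_right_continuous: "AE \<omega> in M. \<forall>t\<ge>0. ((\<lambda>t. X t \<omega>) \<longlongrightarrow> X t \<omega>) (at_right t)"
proof -
  have "AE \<omega> in M. cadlag (\<lambda>t. X t \<omega>)"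
    using input_subordinator unfolding subordinator_def levy_process_def by blast
  then show ?thesis unfolding cadlag_def by eventually_elim blast
qed

lemma X_integrable:
  assumes "0 \<le> t" shows "integrable M (X t)"
proof -
  have "integrable M (\<lambda>\<omega>. (X t \<omega> - r * t) + r * t)"
    using net_input_integrable[OF assms] by (intro Bochner_Integration.integrable_add) auto
  then show ?thesis by simp
qed

abbreviation "mean_input \<equiv> \<integral>\<omega>. X 1 \<omega> \<partial>M"
abbreviation "\<psi> \<equiv> input_exponent a \<nu>"

lemma input_exponent_0: "\<psi> 0 = 0"
  by (simp add: input_exponent_def)

lemma laplace_derivative:
  assumes "0 \<le> t"
  shows "((\<lambda>\<theta>. exp (t * \<psi> \<theta>)) has_real_derivative - (\<integral>\<omega>. X t \<omega> \<partial>M)) (at 0 within {0..})"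
proof -
  have "AE \<omega> in M. 0 \<le> X t \<omega>" using X_nonneg by eventually_elim (use assms in auto)
  from laplace_right_derivative[OF X_integrable[OF assms] this]
  have "((\<lambda>\<theta>. \<integral>\<omega>. exp (- \<theta> * X t \<omega>) \<partial>M) has_real_derivative - (\<integral>\<omega>. X t \<omega> \<partial>M)) (at 0 within {0..})" .
  then show ?thesis
    by (rule has_field_derivative_transform_within[where d=1])
       (use assms input_laplace in auto)
qed

text \<open>
  On \<open>[0, \<infinity>)\<close> the exponent is the logarithm of the Laplace transform of \<open>X 1\<close>, so its slope at 0 is
  read off from the mean of \<open>X 1\<close>.
\<close>

lemma input_exponent_derivative: "(\<psi> has_real_derivative - mean_input) (at 0 within {0..})"
proof -
  have "((\<lambda>\<theta>. ln (exp (1 * \<psi> \<theta>))) has_real_derivative - mean_input) (at 0 within {0..})"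
    using DERIV_chain2[OF DERIV_ln laplace_derivative[of 1]] by (simp add: input_exponent_0)
  then show ?thesis by simp
qed

lemma mean_X:
  assumes "0 \<le> t" shows "(\<integral>\<omega>. X t \<omega> \<partial>M) = t * mean_input"
proof -
  have "((\<lambda>\<theta>. exp (t * \<psi> \<theta>)) has_real_derivative - t * mean_input) (at 0 within {0..})"
    using DERIV_chain2[OF DERIV_exp DERIV_cmult[OF input_exponent_derivative, of t]]
    by (simp add: input_exponent_0)
  from this[unfolded has_real_derivative_iff_has_vector_derivative] laplace_derivative[OF assms, unfolded has_real_derivative_iff_has_vector_derivative]
  have "- t * mean_input = - (\<integral>\<omega>. X t \<omega> \<partial>M)"
    by (intro vector_derivative_unique_within) (auto simp: at_within_Ici_at_right)
  then show ?thesis by simp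
qed

lemma deriv_at_0_eq:
  assumes "(f has_real_derivative d) (at 0 within {0..})"
  shows "deriv_at_0 f = d"
  using assms by (intro vector_derivative_within)
    (auto simp: at_within_Ici_at_right has_real_derivative_iff_has_vector_derivative)

lemma deriv_input_exponent: "deriv_at_0 \<psi> = - mean_input"
  by (rule deriv_at_0_eq[OF input_exponent_derivative])

lemma deriv_net_exponent: "deriv_at_0 (net_exponent a \<nu> r) = r - mean_input"
  using DERIV_add[OF input_exponent_derivative DERIV_cmult[OF DERIV_ident, of r]]
  by (intro deriv_at_0_eq) (simp add: net_exponent_def[abs_def])

lemma mean_input_less: "mean_input < r"
  using stable deriv_input_exponent by simp

lemma mean_input_nonneg: "0 \<le> mean_input"
  using X_nonneg by (intro integral_nonneg_AE) (auto elim: eventually_mono)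

lemma r_pos: "0 < r"
  using mean_input_less mean_input_nonneg by simp

lemma exp_X_integrable:
  assumes "0 \<le> t" "0 \<le> \<theta>" shows "integrable M (\<lambda>\<omega>. exp (- \<theta> * X t \<omega>))"
proof (rule integrable_const_bound[where B=1])
  show "AE \<omega> in M. norm (exp (- \<theta> * X t \<omega>)) \<le> 1"
    using X_nonneg by eventually_elim (use assms in auto)
qed (use X_measurable[OF assms(1)] in measurable)

text \<open>
  Jensen's inequality, in the form \<open>exp y \<ge> 1 + y\<close> with \<open>y = - \<theta> * (X 1 - r)\<close>, whose mean is positive
  by stability.
\<close>

lemma net_exponent_pos:
  assumes "0 < \<theta>" shows "0 < net_exponent a \<nu> r \<theta>"
proof -
  have int: "integrable M (\<lambda>\<omega>. exp (\<theta> * r) * exp (- \<theta> * X 1 \<omega>))"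
    using exp_X_integrable[of 1 \<theta>] assms by simp
  have "1 < 1 + \<theta> * (r - mean_input)" using mean_input_less assms by simp
  also have "\<dots> = (\<integral>\<omega>. 1 - \<theta> * (X 1 \<omega> - r) \<partial>M)"
    using X_integrable[of 1] by (simp add: prob_space algebra_simps)
  also have "\<dots> \<le> (\<integral>\<omega>. exp (\<theta> * r) * exp (- \<theta> * X 1 \<omega>) \<partial>M)"
  proof (rule integral_mono)
    show "1 - \<theta> * (X 1 \<omega> - r) \<le> exp (\<theta> * r) * exp (- \<theta> * X 1 \<omega>)" for \<omega>
      using exp_ge_add_one_self[of "- \<theta> * (X 1 \<omega> - r)"] by (simp add: exp_add[symmetric] algebra_simps)
  qed (use X_integrable[of 1] int in auto)
  also have "\<dots> = exp (net_exponent a \<nu> r \<theta>)"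
    using input_laplace[of 1 \<theta>] assms by (simp add: net_exponent_def exp_add mult.commute)
  finally show ?thesis by simp
qed

text \<open>
  The Laplace transform of \<open>X t / t\<close> at 1 is \<open>exp (t * \<psi> (1 / t))\<close>, so its limit is governed by the
  slope of \<open>\<psi>\<close> at 0.
\<close>

lemma X_over_t_L1: "((\<lambda>t. \<integral>\<omega>. \<bar>X t \<omega> / t - mean_input\<bar> \<partial>M) \<longlongrightarrow> 0) at_top"
proof (rule L1_tendsto_if_laplace_tendsto)
  show "\<forall>\<^sub>F t in at_top. integrable M (\<lambda>\<omega>. X t \<omega> / t) \<and> integrable M (\<lambda>\<omega>. exp (- (X t \<omega> / t)))"
    using eventually_gt_at_top[of 0]
  proof eventually_elim
    case (elim t)
    then show ?case using X_integrable[of t] exp_X_integrable[of t "1/t"] by simp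
  qed
  show "\<forall>\<^sub>F t in at_top. (\<integral>\<omega>. X t \<omega> / t \<partial>M) = mean_input"
    using eventually_gt_at_top[of 0]
  proof eventually_elim
    case (elim t)
    then show ?case using mean_X[of t] by simp
  qed
  have "((\<lambda>\<theta>. \<psi> \<theta> / \<theta>) \<longlongrightarrow> - mean_input) (at_right 0)"
    using input_exponent_derivative input_exponent_0
    by (simp add: has_field_derivative_iff at_within_Ici_at_right)
  then have "((\<lambda>t. \<psi> (inverse t) / inverse t) \<longlongrightarrow> - mean_input) at_top"
    by (rule filterlim_compose) (rule filterlim_inverse_at_right_top)
  then have "((\<lambda>t. exp (\<psi> (inverse t) / inverse t)) \<longlongrightarrow> exp (- mean_input)) at_top"
    by (rule tendsto_exp)
  then show "((\<lambda>t. \<integral>\<omega>. exp (- (X t \<omega> / t)) \<partial>M) \<longlongrightarrow> exp (- mean_input)) at_top"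
  proof (rule Lim_transform_eventually)
    show "\<forall>\<^sub>F t in at_top. exp (\<psi> (inverse t) / inverse t) = (\<integral>\<omega>. exp (- (X t \<omega> / t)) \<partial>M)"
      using eventually_gt_at_top[of 0]
    proof eventually_elim
      case (elim t)
      have "- inverse t * X t \<omega> = - (X t \<omega> / t)" for \<omega> by (simp add: divide_inverse mult.commute)
      then show ?case using input_laplace[of t "inverse t"] elim by (simp add: divide_inverse mult.commute)
    qed
  qed
qed

end

section \<open>Sample paths\<close>

text \<open>
  Unboundedness of the event times makes the set of past events finite; only then is the supremum in
  \<open>num_events\<close> a count.
\<close>

lemma num_events_ge_iff:
  assumes sm: "strict_mono_on {1..} (\<lambda>n. T n \<omega>)" and unb: "\<exists>n\<ge>1. t < T n \<omega>" and n: "1 \<le> n"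
  shows "n \<le> num_events T t \<omega> \<longleftrightarrow> T n \<omega> \<le> t"
proof -
  let ?S = "{n. 1 \<le> n \<and> T n \<omega> \<le> t}"
  have le: "T i \<omega> \<le> T j \<omega>" if "1 \<le> i" "i \<le> j" for i j
    using strict_mono_on_leD[OF sm, of i j] that by simp
  obtain n0 where n0: "n0 \<ge> 1" "t < T n0 \<omega>" using unb by blast
  have "?S \<subseteq> {..n0}"
  proof
    fix i assume "i \<in> ?S"
    then show "i \<in> {..n0}" using le[of n0 i] n0 by (cases "n0 \<le> i") auto
  qed
  then have fin: "finite ?S" by (rule finite_subset) simp
  show ?thesis
  proof
    assume "T n \<omega> \<le> t"
    then have nS: "n \<in> ?S" using n by simp
    have "Sup ?S = Max ?S" using fin nS by (intro cSup_eq_Max) auto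
    then show "n \<le> num_events T t \<omega>" unfolding num_events_def using Max_ge[OF fin nS] by simp
  next
    assume a: "n \<le> num_events T t \<omega>"
    have "?S \<noteq> {}"
    proof
      assume "?S = {}"
      then have "num_events T t \<omega> = 0" unfolding num_events_def by (simp only: Sup_nat_empty)
      then show False using a n by simp
    qed
    then have "Sup ?S = Max ?S" using fin by (intro cSup_eq_Max) auto
    moreover have "Max ?S \<in> ?S" using fin \<open>?S \<noteq> {}\<close> by (rule Max_in)
    ultimately have "num_events T t \<omega> \<in> ?S" unfolding num_events_def by simp
    then show "T n \<omega> \<le> t" using le[OF n a] by simp
  qed
qed

lemma atLeastAtMost_num_events:
  assumes "strict_mono_on {1..} (\<lambda>n. T n \<omega>)" "\<exists>n\<ge>1. t < T n \<omega>"
  shows "{1..num_events T t \<omega>} = {n. 1 \<le> n \<and> T n \<omega> \<le> t}"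
  using num_events_ge_iff[of T \<omega> t] assms by auto

text \<open>
  A function of an accumulated sum telescopes over the jumps in chronological order. Distinct times
  make the order strict, hence the induction on the latest jump.
\<close>

lemma sum_jumps:
  fixes T :: "'k \<Rightarrow> real" and w :: "'k \<Rightarrow> real" and g :: "real \<Rightarrow> real"
  assumes "finite K" "inj_on T K"
  shows "g (c + sum w K) - g c =
    (\<Sum>k\<in>K. g (c + sum w {l\<in>K. T l \<le> T k}) - g (c + sum w {l\<in>K. T l \<le> T k} - w k))"
  using assms
proof (induction K rule: finite_ranking_induct[where f=T])
  case empty
  then show ?case by simp
next
  case (insert x S)
  show ?case
  proof (cases "x \<in> S")
    case True then show ?thesis using insert by (simp add: insert_absorb)
  next
    case False
    have less: "T y < T x" if "y \<in> S" for y
      using insert.hyps insert.prems that False by (metis inj_on_def insertCI order_le_less)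
    have "{l\<in>insert x S. T l \<le> T x} = insert x S" using less by (auto intro: less_imp_le)
    moreover have "{l\<in>insert x S. T l \<le> T k} = {l\<in>S. T l \<le> T k}" if "k \<in> S" for k
      using less[OF that] by auto
    moreover have "inj_on T S" using insert.prems by simp
    ultimately show ?thesis
      using False insert by (simp add: algebra_simps cong: sum.cong)
  qed
qed

text \<open>
  The increments of \<open>f\<close> over the cells to the right of \<open>s\<close> telescope from the first grid point not
  before \<open>s\<close>, which is \<open>h * \<lceil>s / h\<rceil>\<close>.
\<close>

lemma sum_right_of_grid:
  fixes f :: "real \<Rightarrow> real" and h :: real
  assumes t: "0 < t" and n: "0 < n" and s: "0 \<le> s" "s \<le> t" and h_def: "h = t / real n"
  shows "(\<Sum>k<n. of_bool (s \<le> real k * h) * (f (real (Suc k) * h) - f (real k * h))) =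
    f t - f (h * real_of_int \<lceil>s / h\<rceil>)"
proof -
  have h: "0 < h" using t n by (simp add: h_def)
  define j where "j = nat \<lceil>s / h\<rceil>"
  have "s / h \<le> n" using s h n by (simp add: h_def field_simps)
  then have jn: "j \<le> n" by (simp add: j_def ceiling_le_iff)
  have iff: "s \<le> k * h \<longleftrightarrow> j \<le> k" for k :: nat
    using h by (simp add: j_def ceiling_le_iff pos_divide_le_eq)
  have jr: "real j = \<lceil>s / h\<rceil>" unfolding j_def using s h by (simp add: of_nat_nat)
  have "(\<Sum>k<n. of_bool (s \<le> real k * h) * (f (real (Suc k) * h) - f (real k * h))) =
      (\<Sum>k\<in>{j..<n}. f (real (Suc k) * h) - f (real k * h))"
    unfolding iff by (rule sum.mono_neutral_cong_right) (auto simp: add.commute)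
  also have "\<dots> = f (n * h) - f (j * h)"
    using sum_Suc_diff'[of j n "\<lambda>k. f (k * h)"] jn by simp
  finally show ?thesis using n jr by (simp add: h_def mult.commute)
qed

text \<open>
  The properties that almost every outcome has, at a single outcome \<open>\<omega>\<close>.
\<close>

locale queue_path =
  fixes r :: real and X :: "real \<Rightarrow> 'a \<Rightarrow> real" and W0 :: "'a \<Rightarrow> real"
    and \<tau> \<xi> \<sigma> \<eta> :: "nat \<Rightarrow> 'a \<Rightarrow> real" and \<omega> :: 'a
  assumes r_pos: "0 < r" and W0_nonneg: "0 \<le> W0 \<omega>"
    and X_zero: "X 0 \<omega> = 0" and X_mono: "mono_on {0..} (\<lambda>t. X t \<omega>)"
    and X_right: "\<And>t. 0 \<le> t \<Longrightarrow> ((\<lambda>t. X t \<omega>) \<longlongrightarrow> X t \<omega>) (at_right t)"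
    and \<tau>_nonneg: "\<And>n. 1 \<le> n \<Longrightarrow> 0 \<le> \<tau> n \<omega>"
    and \<tau>_strict: "strict_mono_on {1..} (\<lambda>n. \<tau> n \<omega>)" and \<tau>_unb: "\<And>t. \<exists>n\<ge>1. t < \<tau> n \<omega>"
    and \<sigma>_strict: "strict_mono_on {1..} (\<lambda>n. \<sigma> n \<omega>)" and \<sigma>_unb: "\<And>t. \<exists>n\<ge>1. t < \<sigma> n \<omega>"
    and \<xi>_pos: "\<And>n. 1 \<le> n \<Longrightarrow> 0 < \<xi> n \<omega>" and \<eta>_pos: "\<And>n. 1 \<le> n \<Longrightarrow> 0 < \<eta> n \<omega>"
    and start: "\<And>n. 1 \<le> n \<Longrightarrow> ereal (\<sigma> n \<omega>) =
          Inf (ereal ` {t. 0 \<le> t \<and>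
            W0 \<omega> + X t \<omega> - r * t
              + (\<Sum>i=1..num_events \<tau> t \<omega>. \<xi> i \<omega>) + (\<Sum>i=1..n-1. \<eta> i \<omega>) = 0})"
begin

lemma \<tau>_count: "1 \<le> n \<Longrightarrow> n \<le> num_events \<tau> t \<omega> \<longleftrightarrow> \<tau> n \<omega> \<le> t"
  using num_events_ge_iff[of \<tau> \<omega> t n] \<tau>_strict \<tau>_unb by simp

lemma \<sigma>_count: "1 \<le> n \<Longrightarrow> n \<le> num_events \<sigma> t \<omega> \<longleftrightarrow> \<sigma> n \<omega> \<le> t"
  using num_events_ge_iff[of \<sigma> \<omega> t n] \<sigma>_strict \<sigma>_unb by simp

lemma \<tau>_set: "{1..num_events \<tau> t \<omega>} = {n. 1 \<le> n \<and> \<tau> n \<omega> \<le> t}"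
  using atLeastAtMost_num_events[of \<tau> \<omega> t] \<tau>_strict \<tau>_unb by simp

lemma \<sigma>_set: "{1..num_events \<sigma> t \<omega>} = {n. 1 \<le> n \<and> \<sigma> n \<omega> \<le> t}"
  using atLeastAtMost_num_events[of \<sigma> \<omega> t] \<sigma>_strict \<sigma>_unb by simp

definition repairs :: "real \<Rightarrow> real" where
  "repairs t = (\<Sum>i=1..num_events \<tau> t \<omega>. \<xi> i \<omega>)"

definition vacations :: "real \<Rightarrow> real" where
  "vacations t = (\<Sum>i=1..num_events \<sigma> t \<omega>. \<eta> i \<omega>)"

definition content :: "real \<Rightarrow> real" where
  "content t = waiting_time X r W0 \<tau> \<xi> \<sigma> \<eta> t \<omega>"

lemma content_eq: "content t = W0 \<omega> + X t \<omega> - r * t + repairs t + vacations t"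
  by (simp add: content_def waiting_time_def repairs_def vacations_def)

text \<open>
  The first \<open>n - 1\<close> vacations are credited in full from time 0 on, whether or not they have begun;
  the first zero is then the start of the \<open>n\<close>th vacation.
\<close>

definition level :: "nat \<Rightarrow> real \<Rightarrow> real" where
  "level n t = W0 \<omega> + X t \<omega> - r * t + repairs t + (\<Sum>i=1..n-1. \<eta> i \<omega>)"

lemma finite_events: "finite {n. 1 \<le> n \<and> \<tau> n \<omega> \<le> t}"
  unfolding \<tau>_set[symmetric] by simp

lemma X_nonneg: "0 \<le> t \<Longrightarrow> 0 \<le> X t \<omega>"
  using mono_onD[OF X_mono, of 0 t] X_zero by simp

lemma repairs_mono: "s \<le> t \<Longrightarrow> repairs s \<le> repairs t"
  unfolding repairs_def \<tau>_set
  by (rule sum_mono2[OF finite_events]) (auto intro: less_imp_le[OF \<xi>_pos])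

lemma repairs_nonneg: "0 \<le> repairs t"
  unfolding repairs_def by (rule sum_nonneg) (auto intro: less_imp_le[OF \<xi>_pos])

lemma vacations_nonneg: "0 \<le> vacations t"
  unfolding vacations_def by (rule sum_nonneg) (auto intro: less_imp_le[OF \<eta>_pos])

lemma repairs_jump:
  assumes "1 \<le> i" "s < \<tau> i \<omega>" "\<tau> i \<omega> \<le> t"
  shows "repairs s + \<xi> i \<omega> \<le> repairs t"
proof -
  have "repairs s + \<xi> i \<omega> = (\<Sum>n\<in>insert i {n. 1 \<le> n \<and> \<tau> n \<omega> \<le> s}. \<xi> n \<omega>)"
    unfolding repairs_def \<tau>_set using finite_events assms by (subst sum.insert) auto
  also have "\<dots> \<le> repairs t"
    unfolding repairs_def \<tau>_set
    using assms by (intro sum_mono2[OF finite_events]) (auto intro: less_imp_le[OF \<xi>_pos])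
  finally show ?thesis .
qed

lemma repairs_ge:
  assumes "1 \<le> i" "\<tau> i \<omega> \<le> t" shows "\<xi> i \<omega> \<le> repairs t"
  unfolding repairs_def \<tau>_set
  by (rule member_le_sum) (use assms finite_events[of t] in \<open>auto intro: less_imp_le[OF \<xi>_pos]\<close>)

text \<open>
  Downward continuity without left limits: \<open>level n t + r * t\<close> is nondecreasing.
\<close>

lemma level_drop: "0 \<le> s \<Longrightarrow> s \<le> t \<Longrightarrow> level n s - r * (t - s) \<le> level n t"
  using mono_onD[OF X_mono, of s t] repairs_mono[of s t] by (simp add: level_def algebra_simps)

lemma level_jump:
  "0 \<le> s \<Longrightarrow> 1 \<le> i \<Longrightarrow> s < \<tau> i \<omega> \<Longrightarrow> level n s - r * (\<tau> i \<omega> - s) + \<xi> i \<omega> \<le> level n (\<tau> i \<omega>)"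
  using mono_onD[OF X_mono, of s "\<tau> i \<omega>"] repairs_jump[of i s "\<tau> i \<omega>"] by (simp add: level_def algebra_simps)

lemma level_0: "repairs 0 \<le> level n 0"
proof -
  have "0 \<le> (\<Sum>i=1..n-1. \<eta> i \<omega>)" by (rule sum_nonneg) (auto intro: less_imp_le[OF \<eta>_pos])
  then show ?thesis using W0_nonneg X_zero by (simp add: level_def)
qed

lemma num_events_right_constant: "\<forall>\<^sub>F s in at_right t. num_events \<tau> s \<omega> = num_events \<tau> t \<omega>"
proof -
  let ?N = "num_events \<tau> t \<omega>"
  have "t < \<tau> (Suc ?N) \<omega>" using \<tau>_count[of "Suc ?N" t] by auto
  then have "\<forall>\<^sub>F s in at_right t. s \<in> {t<..<\<tau> (Suc ?N) \<omega>}" by (rule eventually_at_right_real)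
  then show ?thesis
  proof eventually_elim
    case (elim s)
    have "num_events \<tau> s \<omega> < Suc ?N" using \<tau>_count[of "Suc ?N" s] elim by auto
    moreover have "?N \<le> num_events \<tau> s \<omega>"
      using \<tau>_count[of ?N t] \<tau>_count[of ?N s] elim by (cases "?N = 0") auto
    ultimately show ?case by simp
  qed
qed

lemma level_right_continuous:
  assumes "0 \<le> t" shows "(level n \<longlongrightarrow> level n t) (at_right t)"
proof -
  have "(repairs \<longlongrightarrow> repairs t) (at_right t)"
    using num_events_right_constant[of t]
    by (intro tendsto_eventually) (auto elim!: eventually_mono simp: repairs_def)
  then show ?thesis
    unfolding level_def[abs_def] using assms by (intro tendsto_intros X_right)
qed

text \<open>
  By right-continuity the infimum of the zero set is itself a zero.
\<close>

lemma vacation_start_inf: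
  assumes n: "1 \<le> n"
  shows "0 \<le> \<sigma> n \<omega>" "level n (\<sigma> n \<omega>) = 0" "\<And>t. 0 \<le> t \<Longrightarrow> t < \<sigma> n \<omega> \<Longrightarrow> level n t \<noteq> 0"
proof -
  let ?A = "{t. 0 \<le> t \<and> level n t = 0}"
  have eq: "ereal (\<sigma> n \<omega>) = Inf (ereal ` ?A)"
    using start[OF n] by (simp add: level_def repairs_def)
  have low: "\<sigma> n \<omega> \<le> t" if "0 \<le> t" "level n t = 0" for t
  proof -
    have "Inf (ereal ` ?A) \<le> ereal t" using that by (intro Inf_lower) auto
    then show ?thesis unfolding eq[symmetric] by simp
  qed
  show "level n t \<noteq> 0" if "0 \<le> t" "t < \<sigma> n \<omega>" for t using low[of t] that by auto
  have "0 \<le> Inf (ereal ` ?A)" by (intro Inf_greatest) auto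
  then show nonneg: "0 \<le> \<sigma> n \<omega>" using eq by (metis ereal_less_eq(5))
  show "level n (\<sigma> n \<omega>) = 0"
  proof (rule ccontr)
    assume ne: "level n (\<sigma> n \<omega>) \<noteq> 0"
    have "\<forall>\<^sub>F s in at_right (\<sigma> n \<omega>). level n s \<noteq> 0"
      by (rule tendsto_imp_eventually_ne[OF level_right_continuous[OF nonneg] ne])
    then obtain b where b: "b > \<sigma> n \<omega>" "\<And>s. \<sigma> n \<omega> < s \<Longrightarrow> s < b \<Longrightarrow> level n s \<noteq> 0"
      unfolding eventually_at_right_field by blast
    have "Inf (ereal ` ?A) < ereal b" using b eq by (metis less_ereal.simps(1))
    then obtain s where s: "0 \<le> s" "level n s = 0" "s < b" unfolding Inf_less_iff by auto
    then show False using low[of s] b(2)[of s] ne by (cases "s = \<sigma> n \<omega>") auto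
  qed
qed

lemma earlier_time:
  assumes u: "0 < u" and e: "0 < e"
  shows "\<exists>t. 0 \<le> t \<and> t < u \<and> r * (u - t) \<le> e"
proof (intro exI conjI)
  let ?t = "max 0 (u - e / r)"
  show "0 \<le> ?t" "?t < u" using u e r_pos by auto
  have "r * (u - ?t) \<le> r * (e / r)" using r_pos by (intro mult_left_mono) auto
  then show "r * (u - ?t) \<le> e" using r_pos by simp
qed

text \<open>
  At the infimum \<open>u\<close> of the times where the level is negative, the level is nonnegative because it
  cannot jump down (\<open>level_drop\<close>), and nonpositive by right-continuity. So \<open>u\<close> is a zero before
  \<open>\<sigma> n\<close>, which is impossible.
\<close>

lemma level_nonneg:
  assumes n: "1 \<le> n" and s: "0 \<le> s" "s \<le> \<sigma> n \<omega>"
  shows "0 \<le> level n s"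
proof (rule ccontr)
  assume neg: "\<not> 0 \<le> level n s"
  then have s': "s < \<sigma> n \<omega>" using s vacation_start_inf(2)[OF n] by (cases "s = \<sigma> n \<omega>") auto
  let ?B = "{t. 0 \<le> t \<and> t \<le> s \<and> level n t < 0}"
  define u where "u = Inf ?B"
  have B: "s \<in> ?B" "bdd_below ?B" using neg s by (auto intro!: bdd_belowI[of _ 0])
  have u: "0 \<le> u" "u \<le> s"
  proof -
    show "0 \<le> u" unfolding u_def by (rule cInf_greatest) (use B(1) in blast, simp)
    show "u \<le> s" unfolding u_def by (rule cInf_lower[OF B])
  qed
  have before: "0 \<le> level n t" if "0 \<le> t" "t < u" for t
  proof (rule ccontr)
    assume "\<not> 0 \<le> level n t"
    then have "t \<in> ?B" using that u(2) by simp
    then have "u \<le> t" unfolding u_def using B(2) by (rule cInf_lower)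
    then show False using that by simp
  qed
  have "0 \<le> level n u"
  proof (cases "u = 0")
    case True
    then show ?thesis using level_0[of n] repairs_nonneg[of 0] by simp
  next
    case False
    then have pos: "0 < u" using u by simp
    show ?thesis
    proof (rule field_le_epsilon)
      fix e :: real assume e: "0 < e"
      obtain t where "0 \<le> t" "t < u" "r * (u - t) \<le> e"
        using earlier_time[OF pos e] by blast
      then show "0 \<le> level n u + e" using before[of t] level_drop[of t u n] by simp
    qed
  qed
  moreover have "level n u \<noteq> 0" using vacation_start_inf(3)[OF n] u s' by auto
  ultimately have "0 < level n u" by simp
  then have "\<forall>\<^sub>F t in at_right u. 0 < level n t"
    by (rule order_tendstoD(1)[OF level_right_continuous[OF u(1)]])
  then obtain b where b: "b > u" "\<And>t. u < t \<Longrightarrow> t < b \<Longrightarrow> 0 < level n t"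
    unfolding eventually_at_right_field by blast
  have "\<exists>t\<in>?B. t < b" using b(1) unfolding u_def by (subst (asm) cInf_less_iff) (use B in blast)+
  then obtain t where t: "t \<in> ?B" "t < b" by blast
  then have "u \<le> t" unfolding u_def using B(2) by (intro cInf_lower)
  then show False using t b(2)[of t] \<open>0 < level n u\<close> by (cases "t = u") auto
qed

text \<open>
  Exactly the vacations credited in this level have begun by time \<open>t\<close>.
\<close>

lemma content_level: "content t = level (Suc (num_events \<sigma> t \<omega>)) t" "t < \<sigma> (Suc (num_events \<sigma> t \<omega>)) \<omega>"
  using \<sigma>_count[of "Suc (num_events \<sigma> t \<omega>)" t] by (auto simp: content_eq level_def vacations_def)

lemma content_nonneg: "0 \<le> t \<Longrightarrow> 0 \<le> content t"
  using content_level[of t] level_nonneg[of "Suc (num_events \<sigma> t \<omega>)" t] by simp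

text \<open>
  Just before the failure the level is nonnegative, and the failure adds \<open>\<xi> i\<close>. A failure at time 0 is
  separate, as nothing precedes it.
\<close>

lemma level_failure:
  assumes n: "1 \<le> n" and i: "1 \<le> i" and le: "\<tau> i \<omega> \<le> \<sigma> n \<omega>"
  shows "\<xi> i \<omega> \<le> level n (\<tau> i \<omega>)"
proof (cases "\<tau> i \<omega> = 0")
  case True
  then show ?thesis using level_0[of n] repairs_ge[OF i, of 0] by simp
next
  case False
  then have pos: "0 < \<tau> i \<omega>" using \<tau>_nonneg[OF i] by simp
  show ?thesis
  proof (rule field_le_epsilon)
    fix e :: real assume e: "0 < e"
    obtain t where "0 \<le> t" "t < \<tau> i \<omega>" "r * (\<tau> i \<omega> - t) \<le> e"
      using earlier_time[OF pos e] by blast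
    then show "\<xi> i \<omega> \<le> level n (\<tau> i \<omega>) + e"
      using level_nonneg[OF n, of t] level_jump[of t i n] i le by simp
  qed
qed

lemma content_failure: "1 \<le> i \<Longrightarrow> \<xi> i \<omega> \<le> content (\<tau> i \<omega>)"
  using content_level[of "\<tau> i \<omega>"] level_failure[of "Suc (num_events \<sigma> (\<tau> i \<omega>) \<omega>)" i] by simp

lemma failure_not_vacation: "1 \<le> i \<Longrightarrow> 1 \<le> j \<Longrightarrow> \<tau> i \<omega> \<noteq> \<sigma> j \<omega>"
  using level_failure[of j i] vacation_start_inf(2)[of j] \<xi>_pos[of i] by force

lemma num_events_vacation_start:
  assumes j: "1 \<le> j" shows "num_events \<sigma> (\<sigma> j \<omega>) \<omega> = j"
proof (rule antisym)
  show "j \<le> num_events \<sigma> (\<sigma> j \<omega>) \<omega>" using \<sigma>_count[OF j] by simp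
  show "num_events \<sigma> (\<sigma> j \<omega>) \<omega> \<le> j"
  proof (rule ccontr)
    assume "\<not> ?thesis"
    then have "\<sigma> (Suc j) \<omega> \<le> \<sigma> j \<omega>" using \<sigma>_count[of "Suc j" "\<sigma> j \<omega>"] by simp
    then show False using strict_mono_onD[OF \<sigma>_strict, of j "Suc j"] j by simp
  qed
qed

lemma content_vacation:
  assumes j: "1 \<le> j" shows "content (\<sigma> j \<omega>) = \<eta> j \<omega>"
proof -
  have "{1..j} = insert j {1..j-1}" using j by auto
  then have "(\<Sum>i=1..j. \<eta> i \<omega>) = \<eta> j \<omega> + (\<Sum>i=1..j-1. \<eta> i \<omega>)" using j by simp
  then show ?thesis
    using vacation_start_inf(2)[OF j] num_events_vacation_start[OF j] by (simp add: content_eq level_def vacations_def)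
qed

text \<open>
  Failures (\<open>Inl\<close>) and vacation starts (\<open>Inr\<close>) up to a given time; the disjoint sum merges the two
  sequences without ordering them.
\<close>

definition events :: "real \<Rightarrow> (nat + nat) set" where
  "events t = {1..num_events \<tau> t \<omega>} <+> {1..num_events \<sigma> t \<omega>}"

definition event_time :: "nat + nat \<Rightarrow> real" where
  "event_time = case_sum (\<lambda>i. \<tau> i \<omega>) (\<lambda>j. \<sigma> j \<omega>)"

definition event_size :: "nat + nat \<Rightarrow> real" where
  "event_size = case_sum (\<lambda>i. \<xi> i \<omega>) (\<lambda>j. \<eta> j \<omega>)"

lemma finite_event_set: "finite (events t)"
  by (simp add: events_def)

lemma events_eq: "events t = {k \<in> range Inl \<union> range Inr. (case k of Inl i \<Rightarrow> 1 \<le> i | Inr j \<Rightarrow> 1 \<le> j) \<and> event_time k \<le> t}"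
  unfolding events_def \<tau>_set \<sigma>_set event_time_def by (auto simp: Plus_def)

lemma events_sub: "k \<in> events t \<Longrightarrow> {l \<in> events t. event_time l \<le> event_time k} = events (event_time k)"
  unfolding events_eq by auto

lemma events_le: "s \<le> t \<Longrightarrow> {l \<in> events t. event_time l \<le> s} = events s"
  unfolding events_eq by auto

lemma event_time_bounds: "k \<in> events t \<Longrightarrow> 0 \<le> event_time k \<and> event_time k \<le> t"
  unfolding events_def \<tau>_set \<sigma>_set event_time_def
  by (auto simp: \<tau>_nonneg vacation_start_inf(1))

lemma event_size_nonneg: "k \<in> events t \<Longrightarrow> 0 \<le> event_size k"
  unfolding events_def event_size_def by (auto simp: less_imp_le[OF \<xi>_pos] less_imp_le[OF \<eta>_pos])

lemma event_time_inj: "inj_on event_time (events t)"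
proof -
  have 1: "i = j" if "1 \<le> i" "1 \<le> j" "\<tau> i \<omega> = \<tau> j \<omega>" for i j
    using strict_mono_on_imp_inj_on[OF \<tau>_strict] that by (auto dest: inj_onD)
  have 2: "i = j" if "1 \<le> i" "1 \<le> j" "\<sigma> i \<omega> = \<sigma> j \<omega>" for i j
    using strict_mono_on_imp_inj_on[OF \<sigma>_strict] that by (auto dest: inj_onD)
  have 3: "\<tau> i \<omega> \<noteq> \<sigma> j \<omega>" if "1 \<le> i" "1 \<le> j" for i j by (rule failure_not_vacation[OF that])
  show ?thesis
  proof (rule inj_onI)
    fix k l assume kl: "k \<in> events t" "l \<in> events t" "event_time k = event_time l"
    show "k = l"
    proof (cases k; cases l)
      fix i j assume "k = Inl i" "l = Inl j"
      then show ?thesis using kl 1[of i j] by (auto simp: events_def event_time_def)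
    next
      fix i j assume "k = Inr i" "l = Inr j"
      then show ?thesis using kl 2[of i j] by (auto simp: events_def event_time_def)
    next
      fix i j assume "k = Inl i" "l = Inr j"
      then show ?thesis using kl 3[of i j] by (auto simp: events_def event_time_def)
    next
      fix i j assume "k = Inr i" "l = Inl j"
      then show ?thesis using kl 3[of j i] by (auto simp: events_def event_time_def)
    qed
  qed
qed

lemma sum_event_size: "sum event_size (events t) = repairs t + vacations t"
  unfolding events_def repairs_def vacations_def event_size_def by (simp add: sum.Plus comp_def)

text \<open>
  The two factors of \<open>exp (- \<theta> * content t)\<close>: this one carries the net input, and
  \<open>down_discount\<close> the time during which the server is down.
\<close>

definition net_discount :: "real \<Rightarrow> real \<Rightarrow> real" where
  "net_discount \<theta> t = exp (- \<theta> * (X t \<omega> - r * t))"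

definition down_discount :: "real \<Rightarrow> real \<Rightarrow> real" where
  "down_discount \<theta> t = exp (- \<theta> * (W0 \<omega> + (repairs t + vacations t)))"

text \<open>
  The amount by which \<open>down_discount\<close> decreases at an event.
\<close>

definition discount_loss :: "real \<Rightarrow> nat + nat \<Rightarrow> real" where
  "discount_loss \<theta> k = down_discount \<theta> (event_time k) * (exp (\<theta> * event_size k) - 1)"

lemma exp_content: "exp (- \<theta> * content t) = down_discount \<theta> t * net_discount \<theta> t"
  unfolding down_discount_def net_discount_def exp_add[symmetric] by (simp add: content_eq algebra_simps)

lemma down_discount_eq:
  "down_discount \<theta> t = exp (- \<theta> * W0 \<omega>) - sum (discount_loss \<theta>) (events t)"
proof -
  let ?g = "\<lambda>y. exp (- \<theta> * y)"
  have "?g (W0 \<omega> + sum event_size (events t)) - ?g (W0 \<omega>) =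
    (\<Sum>k\<in>events t. ?g (W0 \<omega> + sum event_size {l\<in>events t. event_time l \<le> event_time k}) -
        ?g (W0 \<omega> + sum event_size {l\<in>events t. event_time l \<le> event_time k} - event_size k))"
    by (rule sum_jumps[OF finite_event_set event_time_inj])
  also have "\<dots> = (\<Sum>k\<in>events t. - discount_loss \<theta> k)"
  proof (rule sum.cong[OF refl])
    fix k assume k: "k \<in> events t"
    show "?g (W0 \<omega> + sum event_size {l\<in>events t. event_time l \<le> event_time k}) -
        ?g (W0 \<omega> + sum event_size {l\<in>events t. event_time l \<le> event_time k} - event_size k) = - discount_loss \<theta> k"
      unfolding events_sub[OF k] sum_event_size discount_loss_def down_discount_def
      by (simp add: algebra_simps exp_add[symmetric])
  qed
  finally show ?thesis by (simp add: sum_event_size down_discount_def sum_negf)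
qed

lemma discount_loss_nonneg: "0 \<le> \<theta> \<Longrightarrow> k \<in> events t \<Longrightarrow> 0 \<le> discount_loss \<theta> k"
  unfolding discount_loss_def down_discount_def using event_size_nonneg by simp

text \<open>
  Weighted with \<open>net_discount\<close> at the event, the loss becomes a difference of transforms of the
  workload before and after the event. Before a vacation the workload is 0.
\<close>

lemma discount_loss_net:
  "(\<Sum>k\<in>events t. discount_loss \<theta> k * net_discount \<theta> (event_time k)) =
     (\<Sum>i=1..num_events \<tau> t \<omega>. exp (- \<theta> * (content (\<tau> i \<omega>) - \<xi> i \<omega>)) - exp (- \<theta> * content (\<tau> i \<omega>))) +
     (\<Sum>j=1..num_events \<sigma> t \<omega>. 1 - exp (- \<theta> * \<eta> j \<omega>))"
proof -
  have *: "discount_loss \<theta> k * net_discount \<theta> (event_time k) =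
      exp (- \<theta> * (content (event_time k) - event_size k)) - exp (- \<theta> * content (event_time k))" for k
  proof -
    have "discount_loss \<theta> k * net_discount \<theta> (event_time k) = exp (- \<theta> * content (event_time k)) * (exp (\<theta> * event_size k) - 1)"
      unfolding discount_loss_def exp_content by simp
    also have "\<dots> = exp (- \<theta> * (content (event_time k) - event_size k)) - exp (- \<theta> * content (event_time k))"
      by (simp add: algebra_simps exp_add[symmetric])
    finally show ?thesis .
  qed
  show ?thesis
    unfolding * events_def by (simp add: sum.Plus comp_def event_time_def event_size_def content_vacation)
qed

lemma net_discount_bounds:
  assumes "0 \<le> \<theta>" "0 \<le> s" "s \<le> t"
  shows "0 \<le> net_discount \<theta> s" "net_discount \<theta> s \<le> exp (\<theta> * r * t)"
proof -
  have "- \<theta> * (X s \<omega> - r * s) \<le> \<theta> * (r * s)" using assms X_nonneg[of s] by (simp add: algebra_simps)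
  also have "\<dots> \<le> \<theta> * (r * t)" using assms r_pos by (intro mult_left_mono) auto
  finally show "net_discount \<theta> s \<le> exp (\<theta> * r * t)" by (simp add: net_discount_def)
qed (simp add: net_discount_def)

text \<open>
  A left-point sum of \<open>down_discount\<close> against the increments of \<open>net_discount\<close>, over \<open>n\<close> equal cells of
  \<open>[0, t]\<close>. The left points make each summand a product of a quantity known at the grid point and a
  later increment.
\<close>

definition grid_sum :: "real \<Rightarrow> real \<Rightarrow> nat \<Rightarrow> real" where
  "grid_sum \<theta> t n = (\<Sum>k<n. down_discount \<theta> (real k * (t / real n)) *
     (net_discount \<theta> (real (Suc k) * (t / real n)) - net_discount \<theta> (real k * (t / real n))))"

text \<open>
  Summation by parts, exact for every mesh since \<open>down_discount\<close> is a step function: each jump collects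
  the increments of \<open>net_discount\<close> over the cells after it.
\<close>

lemma grid_sum_eq:
  assumes t: "0 < t" and n: "0 < n"
  shows "grid_sum \<theta> t n = exp (- \<theta> * content t) - exp (- \<theta> * W0 \<omega>)
     + (\<Sum>k\<in>events t. discount_loss \<theta> k * net_discount \<theta> (t / real n * real_of_int \<lceil>event_time k / (t / real n)\<rceil>))"
proof -
  define h where "h = t / real n"
  have h: "0 < h" "real n * h = t" using t n by (auto simp: h_def)
  define \<Delta> where "\<Delta> k = net_discount \<theta> (real (Suc k) * h) - net_discount \<theta> (real k * h)" for k :: nat
  let ?c = "\<lambda>e. h * real_of_int \<lceil>event_time e / h\<rceil>"
  have tel: "(\<Sum>k<n. of_bool (s \<le> real k * h) * \<Delta> k) = net_discount \<theta> t - net_discount \<theta> (h * real_of_int \<lceil>s / h\<rceil>)"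
    if "0 \<le> s" "s \<le> t" for s
    unfolding \<Delta>_def by (rule sum_right_of_grid[OF t n that h_def])
  have down: "down_discount \<theta> (real k * h) = exp (- \<theta> * W0 \<omega>) -
      (\<Sum>e\<in>events t. of_bool (event_time e \<le> real k * h) * discount_loss \<theta> e)" if "k < n" for k :: nat
  proof -
    have "real k * h \<le> real n * h" using that h by (intro mult_right_mono) auto
    then have "events (real k * h) = {e\<in>events t. event_time e \<le> real k * h}" using h by (simp add: events_le)
    then have "sum (discount_loss \<theta>) (events (real k * h)) =
        (\<Sum>e\<in>events t. if event_time e \<le> real k * h then discount_loss \<theta> e else 0)"
      by (simp only: sum.inter_filter[OF finite_event_set])
    also have "\<dots> = (\<Sum>e\<in>events t. of_bool (event_time e \<le> real k * h) * discount_loss \<theta> e)"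
      by (rule sum.cong) simp_all
    finally show ?thesis unfolding down_discount_eq by simp
  qed
  have "grid_sum \<theta> t n = (\<Sum>k<n. down_discount \<theta> (real k * h) * \<Delta> k)"
    unfolding grid_sum_def h_def[symmetric] \<Delta>_def ..
  also have "\<dots> = (\<Sum>k<n. exp (- \<theta> * W0 \<omega>) * \<Delta> k -
      (\<Sum>e\<in>events t. discount_loss \<theta> e * (of_bool (event_time e \<le> real k * h) * \<Delta> k)))"
  proof (rule sum.cong[OF refl])
    fix k assume "k \<in> {..<n}"
    then have k: "k < n" by simp
    show "down_discount \<theta> (real k * h) * \<Delta> k = exp (- \<theta> * W0 \<omega>) * \<Delta> k -
        (\<Sum>e\<in>events t. discount_loss \<theta> e * (of_bool (event_time e \<le> real k * h) * \<Delta> k))"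
      unfolding down[OF k] left_diff_distrib sum_distrib_right by (simp only: ac_simps)
  qed
  also have "\<dots> = exp (- \<theta> * W0 \<omega>) * (\<Sum>k<n. \<Delta> k) -
      (\<Sum>e\<in>events t. discount_loss \<theta> e * (\<Sum>k<n. of_bool (event_time e \<le> real k * h) * \<Delta> k))"
    unfolding sum_subtractf sum_distrib_left by (subst sum.swap) simp
  also have "(\<Sum>e\<in>events t. discount_loss \<theta> e * (\<Sum>k<n. of_bool (event_time e \<le> real k * h) * \<Delta> k)) =
      (\<Sum>e\<in>events t. discount_loss \<theta> e * (net_discount \<theta> t - net_discount \<theta> (?c e)))"
  proof (rule sum.cong[OF refl])
    fix e assume "e \<in> events t"
    then have "0 \<le> event_time e" "event_time e \<le> t" using event_time_bounds by auto
    from tel[OF this] show "discount_loss \<theta> e * (\<Sum>k<n. of_bool (event_time e \<le> real k * h) * \<Delta> k) =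
        discount_loss \<theta> e * (net_discount \<theta> t - net_discount \<theta> (?c e))" by (rule arg_cong)
  qed
  also have "(\<Sum>k<n. \<Delta> k) = net_discount \<theta> t - 1"
    using tel[of 0] t h X_zero by (simp add: net_discount_def)
  also have "(\<Sum>e\<in>events t. discount_loss \<theta> e * (net_discount \<theta> t - net_discount \<theta> (?c e))) =
      net_discount \<theta> t * sum (discount_loss \<theta>) (events t) -
      (\<Sum>e\<in>events t. discount_loss \<theta> e * net_discount \<theta> (?c e))"
    by (simp add: right_diff_distrib sum_subtractf sum_distrib_left ac_simps)
  finally show ?thesis
    unfolding exp_content down_discount_eq[of \<theta> t] h_def[symmetric] by (simp add: algebra_simps)
qed

lemma grid_point_bounds:
  assumes t: "0 < t" and n: "0 < n" and s: "0 \<le> s" "s \<le> t"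
  shows "s \<le> t / real n * real_of_int \<lceil>s / (t / real n)\<rceil>" "t / real n * real_of_int \<lceil>s / (t / real n)\<rceil> \<le> t" "t / real n * real_of_int \<lceil>s / (t / real n)\<rceil> \<le> s + t / real n"
proof -
  define h where "h = t / real n"
  have h: "0 < h" "real n * h = t" using t n by (auto simp: h_def)
  have "s = h * (s / h)" using h by simp
  also have "\<dots> \<le> h * real_of_int \<lceil>s / h\<rceil>" using h by (intro mult_left_mono) auto
  finally show "s \<le> t / real n * real_of_int \<lceil>s / (t / real n)\<rceil>" by (simp add: h_def)
  have "s / h \<le> n" using s h by (simp add: field_simps)
  then have "\<lceil>s / h\<rceil> \<le> int n" by (simp add: ceiling_le_iff)
  then have "real_of_int \<lceil>s / h\<rceil> \<le> real n" by linarith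
  then have "h * real_of_int \<lceil>s / h\<rceil> \<le> h * n" using h by (intro mult_left_mono) auto
  then show "t / real n * real_of_int \<lceil>s / (t / real n)\<rceil> \<le> t" using h by (simp add: h_def)
  have "h * real_of_int \<lceil>s / h\<rceil> \<le> h * (s / h + 1)" using h by (intro mult_left_mono) linarith+
  also have "\<dots> = s + h" using h by (simp add: algebra_simps)
  finally show "t / real n * real_of_int \<lceil>s / (t / real n)\<rceil> \<le> s + t / real n" by (simp add: h_def)
qed

text \<open>
  The losses add up to at most 1, and \<open>net_discount\<close> is at most \<open>exp (\<theta> * r * t)\<close> since the input is
  nonnegative.
\<close>

lemma grid_sum_bound:
  assumes t: "0 < t" and \<theta>: "0 \<le> \<theta>"
  shows "\<bar>grid_sum \<theta> t n\<bar> \<le> 2 + exp (\<theta> * r * t)"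
proof (cases "n = 0")
  case False
  let ?L = "\<Sum>k\<in>events t. discount_loss \<theta> k * net_discount \<theta> (t / real n * real_of_int \<lceil>event_time k / (t / real n)\<rceil>)"
  have nd: "0 \<le> net_discount \<theta> (t / real n * real_of_int \<lceil>event_time k / (t / real n)\<rceil>) \<and>
      net_discount \<theta> (t / real n * real_of_int \<lceil>event_time k / (t / real n)\<rceil>) \<le> exp (\<theta> * r * t)" if "k \<in> events t" for k
    using net_discount_bounds[OF \<theta>, of "t / real n * real_of_int \<lceil>event_time k / (t / real n)\<rceil>" t]
      grid_point_bounds[OF t _, of n "event_time k"] False event_time_bounds[OF that] by linarith
  have "0 \<le> ?L" using nd discount_loss_nonneg[OF \<theta>] by (intro sum_nonneg mult_nonneg_nonneg) auto
  moreover have "?L \<le> exp (\<theta> * r * t)"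
  proof -
    have "?L \<le> (\<Sum>k\<in>events t. discount_loss \<theta> k * exp (\<theta> * r * t))"
      using nd discount_loss_nonneg[OF \<theta>] by (intro sum_mono mult_left_mono) auto
    also have "\<dots> = sum (discount_loss \<theta>) (events t) * exp (\<theta> * r * t)" by (simp add: sum_distrib_right)
    also have "\<dots> \<le> 1 * exp (\<theta> * r * t)"
    proof (rule mult_right_mono)
      have "0 \<le> down_discount \<theta> t" by (simp add: down_discount_def)
      moreover have "exp (- \<theta> * W0 \<omega>) \<le> 1" using \<theta> W0_nonneg by simp
      ultimately show "sum (discount_loss \<theta>) (events t) \<le> 1" using down_discount_eq[of \<theta> t] by linarith
    qed simp
    finally show ?thesis by simp
  qed
  moreover have "0 \<le> exp (- \<theta> * content t)" "exp (- \<theta> * content t) \<le> 1" "0 \<le> exp (- \<theta> * W0 \<omega>)" "exp (- \<theta> * W0 \<omega>) \<le> 1"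
    using \<theta> W0_nonneg content_nonneg[of t] t by auto
  ultimately show ?thesis using grid_sum_eq[OF t, of n \<theta>] False by linarith
qed (simp add: grid_sum_def add_nonneg_nonneg)

lemma grid_sum_tendsto:
  assumes t: "0 < t"
  shows "grid_sum \<theta> t \<longlonglongrightarrow> exp (- \<theta> * content t) - exp (- \<theta> * W0 \<omega>)
     + (\<Sum>i=1..num_events \<tau> t \<omega>. exp (- \<theta> * (content (\<tau> i \<omega>) - \<xi> i \<omega>)) - exp (- \<theta> * content (\<tau> i \<omega>)))
     + (\<Sum>j=1..num_events \<sigma> t \<omega>. 1 - exp (- \<theta> * \<eta> j \<omega>))"
proof -
  have nd: "(\<lambda>n. net_discount \<theta> (t / real n * real_of_int \<lceil>s / (t / real n)\<rceil>)) \<longlonglongrightarrow> net_discount \<theta> s" if s: "0 \<le> s" "s \<le> t" for s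
  proof -
    have 0: "(net_discount \<theta> \<longlongrightarrow> net_discount \<theta> s) (at_right s)"
      unfolding net_discount_def[abs_def] using s by (intro tendsto_intros X_right)
    have cont: "continuous (at s within {s..}) (net_discount \<theta>)"
      using 0 by (simp add: continuous_within at_within_Ici_at_right)
    have lim: "(\<lambda>n. t / real n * real_of_int \<lceil>s / (t / real n)\<rceil>) \<longlonglongrightarrow> s"
    proof (rule tendsto_sandwich[OF _ _ tendsto_const])
      show "(\<lambda>n. s + t / real n) \<longlonglongrightarrow> s" using tendsto_add[OF tendsto_const lim_const_over_n[of t], of s] by simp
      show "\<forall>\<^sub>F n in sequentially. s \<le> t / real n * real_of_int \<lceil>s / (t / real n)\<rceil>"
        using eventually_gt_at_top[of 0] by eventually_elim (rule grid_point_bounds[OF t _ s])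
      show "\<forall>\<^sub>F n in sequentially. t / real n * real_of_int \<lceil>s / (t / real n)\<rceil> \<le> s + t / real n"
        using eventually_gt_at_top[of 0] by eventually_elim (rule grid_point_bounds[OF t _ s])
    qed
    have "\<forall>\<^sub>F n in sequentially. t / real n * real_of_int \<lceil>s / (t / real n)\<rceil> \<in> {s..}"
      using eventually_gt_at_top[of 0] by eventually_elim (use grid_point_bounds(1)[OF t _ s] in simp)
    from continuous_within_tendsto_compose[OF cont this lim] show ?thesis .
  qed
  have "(\<lambda>n. exp (- \<theta> * content t) - exp (- \<theta> * W0 \<omega>)
     + (\<Sum>k\<in>events t. discount_loss \<theta> k * net_discount \<theta> (t / real n * real_of_int \<lceil>event_time k / (t / real n)\<rceil>)))
     \<longlonglongrightarrow> exp (- \<theta> * content t) - exp (- \<theta> * W0 \<omega>)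
     + (\<Sum>k\<in>events t. discount_loss \<theta> k * net_discount \<theta> (event_time k))"
    using event_time_bounds by (intro tendsto_intros nd) auto
  then have "grid_sum \<theta> t \<longlonglongrightarrow> exp (- \<theta> * content t) - exp (- \<theta> * W0 \<omega>)
     + (\<Sum>k\<in>events t. discount_loss \<theta> k * net_discount \<theta> (event_time k))"
  proof (rule Lim_transform_eventually)
    show "\<forall>\<^sub>F n in sequentially. exp (- \<theta> * content t) - exp (- \<theta> * W0 \<omega>)
     + (\<Sum>k\<in>events t. discount_loss \<theta> k * net_discount \<theta> (t / real n * real_of_int \<lceil>event_time k / (t / real n)\<rceil>)) = grid_sum \<theta> t n"
      using eventually_gt_at_top[of 0] by eventually_elim (simp add: grid_sum_eq[OF t])
  qed
  then show ?thesis unfolding discount_loss_net by (simp add: add.assoc)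
qed

end

section \<open>The balance equation\<close>

text \<open>
  If \<open>m\<close> converges at infinity, so do its time averages, with the averages given only as limits of
  Riemann sums: at most about \<open>n * t0 / t\<close> of the \<open>n\<close> grid points lie before \<open>t0\<close>, and \<open>m\<close> is near
  \<open>l\<close> at all others.
\<close>

lemma grid_average_tendsto:
  fixes m :: "real \<Rightarrow> real" and B :: "real \<Rightarrow> real"
  assumes m: "\<And>s. 0 \<le> s \<Longrightarrow> 0 \<le> m s \<and> m s \<le> 1" and lim: "(m \<longlongrightarrow> l) at_top" and c: "0 < c"
    and B: "\<And>t. 0 < t \<Longrightarrow> (\<lambda>n. \<Sum>k<n. m (real k * (t / real n)) * (exp (t / real n * c) - 1)) \<longlonglongrightarrow> B t"
  shows "((\<lambda>t. B t / t) \<longlongrightarrow> c * l) at_top"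
proof (rule tendstoI)
  fix e :: real assume e: "0 < e"
  have l01: "0 \<le> l" "l \<le> 1"
    using tendsto_lowerbound[OF lim, of 0] tendsto_upperbound[OF lim, of 1] m
    by (auto simp: eventually_at_top_linorder)
  define \<delta> where "\<delta> = e / (3 * c)"
  have \<delta>: "0 < \<delta>" using e c by (simp add: \<delta>_def)
  have "\<forall>\<^sub>F s in at_top. \<bar>m s - l\<bar> < \<delta>" using tendstoD[OF lim \<delta>] by (simp add: dist_real_def)
  then obtain s0 where s0: "\<And>s. s0 \<le> s \<Longrightarrow> \<bar>m s - l\<bar> < \<delta>" unfolding eventually_at_top_linorder by blast
  define t0 where "t0 = max s0 1"
  have t0: "0 < t0" "\<And>s. t0 \<le> s \<Longrightarrow> \<bar>m s - l\<bar> < \<delta>" using s0 by (auto simp: t0_def)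
  have main: "\<bar>B t - t * c * l\<bar> \<le> t * c * (\<delta> + t0 / t)" if t: "0 < t" for t
  proof -
    define E where "E n = exp (t / real n * c) - 1" for n :: nat
    have E0: "0 \<le> E n" for n using t c by (simp add: E_def)
    have nE: "(\<lambda>n. real n * E n) \<longlonglongrightarrow> t * c"
      unfolding E_def using t c by real_asymp
    have bound: "\<bar>(\<Sum>k<n. m (real k * (t / real n)) * E n) - real n * E n * l\<bar> \<le> real n * E n * (\<delta> + t0 / t + 1 / n)"
      if n: "0 < n" for n :: nat
    proof -
      have "card {k. k < n \<and> real k * (t / real n) < t0} \<le> card {..<nat \<lceil>t0 * n / t\<rceil>}"
      proof (rule card_mono)
        show "{k. k < n \<and> real k * (t / real n) < t0} \<subseteq> {..<nat \<lceil>t0 * n / t\<rceil>}"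
        proof
          fix k assume "k \<in> {k. k < n \<and> real k * (t / real n) < t0}"
          then have "real k < t0 * n / t" using t n by (simp add: field_simps)
          then show "k \<in> {..<nat \<lceil>t0 * n / t\<rceil>}" by (simp add: less_ceiling_iff zless_nat_eq_int_zless)
        qed
      qed simp
      also have "real (card {..<nat \<lceil>t0 * n / t\<rceil>}) \<le> t0 * n / t + 1"
        using t0 t by (simp add: of_nat_nat)
      finally have card: "real (card {k. k < n \<and> real k * (t / real n) < t0}) \<le> t0 * n / t + 1" by simp
      have "\<bar>(\<Sum>k<n. m (real k * (t / real n)) * E n) - real n * E n * l\<bar> = \<bar>\<Sum>k<n. (m (real k * (t / real n)) - l) * E n\<bar>"
        by (simp add: left_diff_distrib sum_subtractf mult.assoc mult.commute[of l])
      also have "\<dots> \<le> (\<Sum>k<n. \<bar>(m (real k * (t / real n)) - l) * E n\<bar>)" by (rule sum_abs)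
      also have "\<dots> \<le> (\<Sum>k<n. (\<delta> + of_bool (real k * (t / real n) < t0)) * E n)"
      proof (rule sum_mono)
        fix k assume "k \<in> {..<n}"
        have "\<bar>m (real k * (t / real n)) - l\<bar> \<le> \<delta> + of_bool (real k * (t / real n) < t0)"
        proof (cases "real k * (t / real n) < t0")
          case True
          have "\<bar>m (real k * (t / real n)) - l\<bar> \<le> 1" using m[of "real k * (t / real n)"] l01 t by auto
          then show ?thesis using True \<delta> by simp
        next
          case False then show ?thesis using t0(2)[of "real k * (t / real n)"] by simp
        qed
        then show "\<bar>(m (real k * (t / real n)) - l) * E n\<bar> \<le> (\<delta> + of_bool (real k * (t / real n) < t0)) * E n"
          using E0[of n] by (simp add: abs_mult mult_right_mono)
      qed
      also have "\<dots> = (n * \<delta> + card {k. k < n \<and> real k * (t / real n) < t0}) * E n"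
      proof -
        have "(\<Sum>k<n. of_bool (real k * (t / real n) < t0)) = real (card {k. k < n \<and> real k * (t / real n) < t0})"
          by (subst sum_of_bool_eq) (auto intro!: arg_cong[where f=card])
        then show ?thesis by (simp add: sum_distrib_right[symmetric] sum.distrib)
      qed
      also have "\<dots> \<le> (n * \<delta> + (t0 * n / t + 1)) * E n" using card E0 by (intro mult_right_mono) auto
      also have "\<dots> = real n * E n * (\<delta> + t0 / t + 1 / n)"
      proof -
        have "n * \<delta> + (t0 * n / t + 1) = n * (\<delta> + t0 / t + 1 / n)" using n by (simp add: distrib_left)
        then show ?thesis by (simp only: ac_simps)
      qed
      finally show ?thesis .
    qed
    have "(\<lambda>n. real n * E n * (\<delta> + t0 / t + 1 / n)) \<longlonglongrightarrow> t * c * (\<delta> + t0 / t + 0)"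
      by (intro tendsto_intros nE lim_const_over_n)
    moreover have "(\<lambda>n. \<bar>(\<Sum>k<n. m (real k * (t / real n)) * E n) - real n * E n * l\<bar>) \<longlonglongrightarrow> \<bar>B t - t * c * l\<bar>"
      using B[OF t] by (intro tendsto_intros nE) (simp add: E_def)
    moreover have "\<forall>\<^sub>F n in sequentially. \<bar>(\<Sum>k<n. m (real k * (t / real n)) * E n) - real n * E n * l\<bar>
        \<le> real n * E n * (\<delta> + t0 / t + 1 / n)"
      using eventually_gt_at_top[of 0] by eventually_elim (rule bound)
    ultimately have "\<bar>B t - t * c * l\<bar> \<le> t * c * (\<delta> + t0 / t + 0)"
      by (rule tendsto_le[OF sequentially_bot])
    then show ?thesis by simp
  qed
  have "((\<lambda>t. t0 / t) \<longlongrightarrow> 0) at_top" by real_asymp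
  then have "\<forall>\<^sub>F t in at_top. t0 / t < \<delta>" using \<delta> by (rule order_tendstoD)
  then show "\<forall>\<^sub>F t in at_top. dist (B t / t) (c * l) < e"
    using eventually_gt_at_top[of 0]
  proof eventually_elim
    case (elim t)
    have "dist (B t / t) (c * l) = \<bar>B t - t * c * l\<bar> / t"
    proof -
      have "B t / t - c * l = (B t - t * c * l) / t" using elim by (simp add: diff_divide_distrib)
      then show ?thesis using elim by (simp add: dist_real_def abs_divide)
    qed
    also have "\<dots> \<le> t * c * (\<delta> + t0 / t) / t" using main elim by (intro divide_right_mono) auto
    also have "\<dots> = c * (\<delta> + t0 / t)" using elim by simp
    also have "\<dots> < c * (\<delta> + \<delta>)" using c elim by simp
    also have "\<dots> \<le> e" using c e by (simp add: \<delta>_def)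
    finally show ?case .
  qed
qed

lemma (in complete_measure) measurable_AE_modification:
  assumes G: "sets G \<subseteq> sets M" "space G = space M" "null_sets M \<subseteq> sets G"
    and f: "f \<in> borel_measurable G" and eq: "AE \<omega> in M. f \<omega> = g \<omega>"
  shows "g \<in> borel_measurable G"
proof (rule measurableI)
  obtain D where D: "{x \<in> space M. f x \<noteq> g x} \<subseteq> D" "emeasure M D = 0" "D \<in> sets M"
    using eq by (rule AE_E)
  then have nD: "D \<in> null_sets M" by auto
  fix A :: "'b set" assume A: "A \<in> sets borel"
  have "g -` A \<inter> space G = (f -` A \<inter> space G - D) \<union> (g -` A \<inter> space M \<inter> D)"
    using D(1) G(2) by auto
  moreover have "g -` A \<inter> space M \<inter> D \<in> sets G"
    using complete2[of _ D] nD G(3) by (meson inf_le2 subsetD)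
  moreover have "f -` A \<inter> space G - D \<in> sets G"
    using measurable_sets[OF f A] nD G(3) by auto
  ultimately show "g -` A \<inter> space G \<in> sets G" by auto
qed simp

text \<open>
  A bound \<open>T n \<le> K\<close> for all \<open>n\<close> would keep \<open>T n / n\<close> away from the positive number \<open>1 / lam\<close>.
\<close>

lemma (in prob_space) AE_unbounded_if_linear_growth:
  assumes [measurable]: "\<And>n. n \<ge> 1 \<Longrightarrow> T n \<in> borel_measurable M"
    and rate: "tendsto_in_prob M (\<lambda>n \<omega>. T n \<omega> / real n) (1 / lam)" and lam: "0 < lam"
  shows "AE \<omega> in M. \<forall>t. \<exists>n\<ge>1. t < T n \<omega>"
proof -
  have "AE \<omega> in M. \<exists>n\<ge>1. real K < T n \<omega>" for K :: nat
  proof -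
    let ?B = "{\<omega> \<in> space M. \<forall>n\<in>{1..}. T n \<omega> \<le> real K}"
    have B: "?B \<in> sets M" by measurable
    let ?P = "\<lambda>n. prob {\<omega> \<in> space M. 1 / (2 * lam) < \<bar>T n \<omega> / real n - 1 / lam\<bar>}"
    have "(\<lambda>n. ?P n) \<longlonglongrightarrow> 0" using rate lam unfolding tendsto_in_prob_def by simp
    moreover have "\<forall>\<^sub>F n in sequentially. prob ?B \<le> ?P n"
    proof -
      have "(\<lambda>n. real K / real n) \<longlonglongrightarrow> 0" by (rule lim_const_over_n)
      then have "\<forall>\<^sub>F n in sequentially. real K / real n < 1 / (2 * lam)"
        using lam by (intro order_tendstoD) auto
      then show ?thesis using eventually_ge_at_top[of 1]
      proof eventually_elim
        case (elim n)
        have [measurable]: "T n \<in> borel_measurable M" using elim by simp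
        show ?case
        proof (rule finite_measure_mono)
          show "?B \<subseteq> {\<omega> \<in> space M. 1 / (2 * lam) < \<bar>T n \<omega> / real n - 1 / lam\<bar>}"
          proof safe
            fix \<omega> assume "\<forall>n\<in>{1..}. T n \<omega> \<le> real K"
            then have "T n \<omega> \<le> real K" using elim by auto
            then have "T n \<omega> / real n \<le> real K / real n" by (intro divide_right_mono) auto
            then have "T n \<omega> / real n < 1 / (2 * lam)" using elim by simp
            moreover have "1 / lam = 1 / (2 * lam) + 1 / (2 * lam)" by (simp add: field_simps)
            ultimately show "1 / (2 * lam) < \<bar>T n \<omega> / real n - 1 / lam\<bar>" by simp
          qed
        qed measurable
      qed
    qed
    ultimately have "prob ?B \<le> 0" by (intro tendsto_lowerbound) auto
    then have "prob ?B = 0" by (simp add: measure_le_0_iff)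
    then have "AE \<omega> in M. \<omega> \<notin> ?B" using B by (simp add: prob_eq_0)
    then show ?thesis using AE_space by eventually_elim (auto simp: not_le)
  qed
  then have "AE \<omega> in M. \<forall>K::nat. \<exists>n\<ge>1. real K < T n \<omega>" by (simp add: AE_all_countable)
  then show ?thesis
  proof eventually_elim
    case (elim \<omega>)
    show ?case
    proof
      fix t :: real
      obtain K :: nat where "t \<le> real K" using real_arch_simple by blast
      moreover obtain n where "n \<ge> 1" "real K < T n \<omega>" using elim by blast
      ultimately show "\<exists>n\<ge>1. t < T n \<omega>" by (intro exI[of _ n]) auto
    qed
  qed
qed

lemma (in prob_space) indep_set_subset:
  "indep_set A B \<Longrightarrow> A' \<subseteq> A \<Longrightarrow> indep_set A' B"
  unfolding indep_sets2_eq by blast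

locale recurrent_fluid_queue = fluid_queue +
  fixes lam_R lam_V :: real
  assumes rates_pos: "0 < lam_R" "0 < lam_V"
    and failure_rate: "tendsto_in_prob M (\<lambda>n \<omega>. \<tau> n \<omega> / real n) (1 / lam_R)"
    and vacation_rate: "tendsto_in_prob M (\<lambda>n \<omega>. \<sigma> n \<omega> / real n) (1 / lam_V)"
begin

lemma \<tau>_measurable: "n \<ge> 1 \<Longrightarrow> \<tau> n \<in> borel_measurable M"
  using measurable_stopping_time[OF failure_stopping_time F_subalgebra] by simp

lemma \<sigma>_measurable: "n \<ge> 1 \<Longrightarrow> \<sigma> n \<in> borel_measurable M"
  using measurable_stopping_time[OF vacation_stopping_time F_subalgebra] by simp

lemma AE_queue_path: "AE \<omega> in M. queue_path r X W0 \<tau> \<xi> \<sigma> \<eta> \<omega>"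
proof -
  have "AE \<omega> in M. \<forall>t. \<exists>n\<ge>1. t < \<tau> n \<omega>"
    by (rule AE_unbounded_if_linear_growth[OF _ failure_rate rates_pos(1)]) (rule \<tau>_measurable)
  moreover have "AE \<omega> in M. \<forall>t. \<exists>n\<ge>1. t < \<sigma> n \<omega>"
    by (rule AE_unbounded_if_linear_growth[OF _ vacation_rate rates_pos(2)]) (rule \<sigma>_measurable)
  ultimately show ?thesis
    using initial_nonneg X_zero X_mono X_right_continuous failure_nonneg failure_strict_mono
      vacation_strict_mono repair_pos vacation_pos vacation_start
  proof eventually_elim
    case (elim \<omega>)
    show ?case by unfold_locales (use elim r_pos in blast)+
  qed
qed

abbreviation "W \<equiv> waiting_time X r W0 \<tau> \<xi> \<sigma> \<eta>"

text \<open>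
  Almost surely the random sum is the series of the summands whose event has occurred, which is
  measurable; completeness transfers this to the sum itself.
\<close>

lemma random_sum_measurable:
  assumes G: "sets G \<subseteq> sets M" "space G = space M" "null_sets M \<subseteq> sets G"
    and T: "T \<in> {\<tau>, \<sigma>}"
    and f: "\<And>n. 1 \<le> n \<Longrightarrow> (\<lambda>\<omega>. if T n \<omega> \<le> t then f n \<omega> else (0::real)) \<in> borel_measurable G"
  shows "(\<lambda>\<omega>. \<Sum>i=1..num_events T t \<omega>. f i \<omega>) \<in> borel_measurable G"
proof (rule measurable_AE_modification[OF G])
  let ?g = "\<lambda>n \<omega>. if T (Suc n) \<omega> \<le> t then f (Suc n) \<omega> else 0"
  show "(\<lambda>\<omega>. \<Sum>n. ?g n \<omega>) \<in> borel_measurable G"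
    using f by (intro borel_measurable_suminf) simp
  show "AE \<omega> in M. (\<Sum>n. ?g n \<omega>) = (\<Sum>i=1..num_events T t \<omega>. f i \<omega>)"
    using AE_queue_path
  proof eventually_elim
    case (elim \<omega>)
    interpret p: queue_path r X W0 \<tau> \<xi> \<sigma> \<eta> \<omega> by fact
    have count: "n \<le> num_events T t \<omega> \<longleftrightarrow> T n \<omega> \<le> t" if "1 \<le> n" for n
      using T p.\<tau>_count[OF that] p.\<sigma>_count[OF that] by auto
    have "(\<Sum>n. ?g n \<omega>) = (\<Sum>n<num_events T t \<omega>. ?g n \<omega>)"
    proof (rule suminf_finite)
      fix n assume "n \<notin> {..<num_events T t \<omega>}"
      then show "?g n \<omega> = 0" using count[of "Suc n"] by auto
    qed simp
    also have "\<dots> = (\<Sum>n<num_events T t \<omega>. f (Suc n) \<omega>)"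
    proof (rule sum.cong[OF refl])
      fix n assume "n \<in> {..<num_events T t \<omega>}"
      then show "?g n \<omega> = f (Suc n) \<omega>" using count[of "Suc n"] by auto
    qed
    also have "\<dots> = (\<Sum>i=1..num_events T t \<omega>. f i \<omega>)"
      by (simp add: sum.atLeast1_atMost_eq)
    finally show ?case .
  qed
qed

lemma null_sets_F: "0 \<le> t \<Longrightarrow> null_sets M \<subseteq> sets (F t)"
  using filtration_complete sets_F_mono[of 0 t] by auto

lemma random_sum_measurable_M:
  assumes T: "T \<in> {\<tau>, \<sigma>}" and f: "\<And>n. 1 \<le> n \<Longrightarrow> f n \<in> borel_measurable M"
  shows "(\<lambda>\<omega>. \<Sum>i=1..num_events T t \<omega>. f i \<omega> :: real) \<in> borel_measurable M"
proof (rule random_sum_measurable[OF _ _ _ T])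
  fix n :: nat assume n: "1 \<le> n"
  have [measurable]: "T n \<in> borel_measurable M" "f n \<in> borel_measurable M"
    using T \<tau>_measurable[OF n] \<sigma>_measurable[OF n] f[OF n] by auto
  show "(\<lambda>\<omega>. if T n \<omega> \<le> t then f n \<omega> else 0) \<in> borel_measurable M" by measurable
qed auto

lemma stopped_measurable:
  assumes T: "stopping_time F T" and f: "f \<in> borel_measurable (pre_sigma T)"
  shows "(\<lambda>\<omega>. if T \<omega> \<le> t then f \<omega> else (0::real)) \<in> borel_measurable (F t)"
proof (rule measurableI)
  fix A :: "real set" assume A: "A \<in> sets borel"
  have 1: "{\<omega> \<in> f -` A \<inter> space M. T \<omega> \<le> t} \<in> sets (F t)"
    using sets_pre_sigmaD[OF T measurable_sets[OF f A]] by (simp add: space_pre_sigma)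
  have 2: "{\<omega> \<in> space (F t). t < T \<omega>} \<in> sets (F t)"
    using stopping_timeD2[OF T] by (simp add: Measurable.pred_def)
  have "(\<lambda>\<omega>. if T \<omega> \<le> t then f \<omega> else 0) -` A \<inter> space (F t) =
    {\<omega> \<in> f -` A \<inter> space M. T \<omega> \<le> t} \<union> (if 0 \<in> A then {\<omega> \<in> space (F t). t < T \<omega>} else {})"
    by (auto simp: F_subalgebra split: if_splits)
  then show "(\<lambda>\<omega>. if T \<omega> \<le> t then f \<omega> else 0) -` A \<inter> space (F t) \<in> sets (F t)"
    using 1 2 by auto
qed simp

lemma W_adapted:
  assumes t: "0 \<le> t" shows "W t \<in> borel_measurable (F t)"
proof -
  have "W0 \<in> borel_measurable (F t)"
    using initial_measurable sets_F_mono[OF t] by (auto simp: measurable_def space_F)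
  moreover have "(\<lambda>\<omega>. \<Sum>i=1..num_events \<tau> t \<omega>. \<xi> i \<omega>) \<in> borel_measurable (F t)"
    by (rule random_sum_measurable[OF F_subalgebra null_sets_F[OF t]])
       (auto intro!: stopped_measurable failure_stopping_time repair_measurable)
  moreover have "(\<lambda>\<omega>. \<Sum>i=1..num_events \<sigma> t \<omega>. \<eta> i \<omega>) \<in> borel_measurable (F t)"
    by (rule random_sum_measurable[OF F_subalgebra null_sets_F[OF t]])
       (auto intro!: stopped_measurable vacation_stopping_time vacation_measurable)
  ultimately show ?thesis
    unfolding waiting_time_def[abs_def] using X_adapted[OF t] by measurable
qed

lemma W_measurable: "0 \<le> t \<Longrightarrow> W t \<in> borel_measurable M"
  using W_adapted borel_measurable_F by blast

lemma W0_measurable: "W0 \<in> borel_measurable M"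
  using initial_measurable borel_measurable_F by blast

lemma AE_W_nonneg: "0 \<le> t \<Longrightarrow> AE \<omega> in M. 0 \<le> W t \<omega>"
  using AE_queue_path
  by eventually_elim (metis queue_path.content_nonneg queue_path.content_def)

abbreviation "\<phi> \<equiv> net_exponent a \<nu> r"
abbreviation "Y t \<omega> \<equiv> X t \<omega> - r * t"
definition "laplace_W \<theta> t = (\<integral>\<omega>. exp (- \<theta> * W t \<omega>) \<partial>M)"

lemma exp_W_integrable:
  assumes "0 \<le> t" "0 \<le> \<theta>" shows "integrable M (\<lambda>\<omega>. exp (- \<theta> * W t \<omega>))"
proof (rule integrable_const_bound[where B=1])
  show "AE \<omega> in M. norm (exp (- \<theta> * W t \<omega>)) \<le> 1"
    using AE_W_nonneg[OF assms(1)] by eventually_elim (use assms in auto)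
qed (use W_measurable[OF assms(1)] in measurable)

lemma laplace_W_bounds:
  assumes "0 \<le> t" "0 \<le> \<theta>" shows "0 \<le> laplace_W \<theta> t \<and> laplace_W \<theta> t \<le> 1"
proof
  show "0 \<le> laplace_W \<theta> t" by (simp add: laplace_W_def)
  have "laplace_W \<theta> t \<le> (\<integral>\<omega>. 1 \<partial>M)"
    unfolding laplace_W_def
  proof (rule integral_mono_AE)
    show "AE \<omega> in M. exp (- \<theta> * W t \<omega>) \<le> 1"
      using AE_W_nonneg[OF assms(1)] by eventually_elim (use assms in auto)
  qed (use exp_W_integrable[OF assms] in auto)
  then show "laplace_W \<theta> t \<le> 1" by (simp add: prob_space)
qed

text \<open>
  The workload at \<open>s\<close> is known at time \<open>s\<close>, so the later increment of the input is independent of it.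
\<close>

lemma increment_independent:
  assumes st: "0 \<le> s" "s \<le> t" and \<theta>: "0 \<le> \<theta>"
  shows "(\<integral>\<omega>. exp (- \<theta> * W s \<omega>) * (exp (- \<theta> * (Y t \<omega> - Y s \<omega>)) - 1) \<partial>M) =
      laplace_W \<theta> s * (exp ((t - s) * \<phi> \<theta>) - 1)"
    and "integrable M (\<lambda>\<omega>. exp (- \<theta> * W s \<omega>) * (exp (- \<theta> * (Y t \<omega> - Y s \<omega>)) - 1))"
proof -
  let ?D = "\<lambda>\<omega>. X t \<omega> - X s \<omega>"
  have [measurable]: "X t \<in> borel_measurable M" "X s \<in> borel_measurable M" "W s \<in> borel_measurable M"
    using X_measurable W_measurable st by auto
  have levy: "indep_set (sets (F s)) (sets (vimage_algebra (space M) ?D borel))"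
    "distr M borel ?D = distr M borel (X (t - s))"
    using input_subordinator st unfolding subordinator_def levy_process_def by auto
  let ?A = "\<lambda>\<omega>. exp (- \<theta> * W s \<omega>)" and ?B = "\<lambda>\<omega>. exp (- \<theta> * ?D \<omega>)"
  have WD: "indep_var borel (W s) borel ?D"
    unfolding indep_var_eq
  proof (intro conjI)
    have "{W s -` A \<inter> space M |A. A \<in> sets borel} \<subseteq> sets (F s)"
      using measurable_sets[OF W_adapted[OF st(1)]] by (auto simp: F_subalgebra(2))
    then have sub: "sigma_sets (space M) {W s -` A \<inter> space M |A. A \<in> sets borel} \<subseteq> sets (F s)"
      using sets.sigma_sets_subset[of _ "F s"] by (simp only: F_subalgebra(2))
    have eq: "sigma_sets (space M) {?D -` A \<inter> space M |A. A \<in> sets borel} = sets (vimage_algebra (space M) ?D borel)"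
      unfolding vimage_algebra_def by (rule sets_measure_of[symmetric]) auto
    show "indep_set (sigma_sets (space M) {W s -` A \<inter> space M |A. A \<in> sets borel})
        (sigma_sets (space M) {?D -` A \<inter> space M |A. A \<in> sets borel})"
      unfolding eq by (rule indep_set_subset[OF levy(1) sub])
  qed measurable
  have AB: "indep_var borel ?A borel ?B"
    using indep_var_compose[OF WD, of "\<lambda>x. exp (- \<theta> * x)" borel "\<lambda>x. exp (- \<theta> * x)" borel] by (simp add: comp_def)
  have iA: "integrable M ?A" by (rule exp_W_integrable[OF st(1) \<theta>])
  have eB: "(\<integral>\<omega>. exp (- \<theta> * ?D \<omega>) \<partial>M) = (\<integral>\<omega>. exp (- \<theta> * X (t - s) \<omega>) \<partial>M)"
    using integral_distr[of ?D M borel "\<lambda>x. exp (- \<theta> * x)"] integral_distr[of "X (t - s)" M borel "\<lambda>x. exp (- \<theta> * x)"]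
      levy(2) X_measurable[of "t - s"] st by simp
  have iB: "integrable M ?B"
    using integrable_distr_eq[of ?D M borel "\<lambda>x. exp (- \<theta> * x)"] integrable_distr_eq[of "X (t - s)" M borel "\<lambda>x. exp (- \<theta> * x)"]
      levy(2) X_measurable[of "t - s"] exp_X_integrable[of "t - s" \<theta>] st \<theta> by simp
  have eq: "?A \<omega> * (exp (- \<theta> * (Y t \<omega> - Y s \<omega>)) - 1) = exp (\<theta> * r * (t - s)) * (?A \<omega> * ?B \<omega>) - ?A \<omega>" for \<omega>
  proof -
    have "- \<theta> * (Y t \<omega> - Y s \<omega>) = \<theta> * r * (t - s) + - \<theta> * ?D \<omega>" by (simp add: algebra_simps)
    then have "exp (- \<theta> * (Y t \<omega> - Y s \<omega>)) = exp (\<theta> * r * (t - s)) * ?B \<omega>" by (simp only: exp_add)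
    then show ?thesis by (simp only: right_diff_distrib mult_1_right ac_simps)
  qed
  note prod = indep_var_lebesgue_integral[OF AB iA iB] indep_var_integrable[OF AB iA iB]
  show "integrable M (\<lambda>\<omega>. ?A \<omega> * (exp (- \<theta> * (Y t \<omega> - Y s \<omega>)) - 1))"
    unfolding eq using prod iA by simp
  have "(\<integral>\<omega>. ?A \<omega> * (exp (- \<theta> * (Y t \<omega> - Y s \<omega>)) - 1) \<partial>M) =
      exp (\<theta> * r * (t - s)) * (laplace_W \<theta> s * exp ((t - s) * input_exponent a \<nu> \<theta>)) - laplace_W \<theta> s"
    unfolding eq using prod iA eB input_laplace[of "t - s" \<theta>] st \<theta> by (simp add: laplace_W_def)
  also have "\<dots> = laplace_W \<theta> s * (exp ((t - s) * \<phi> \<theta>) - 1)"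
  proof -
    have "(t - s) * \<phi> \<theta> = \<theta> * r * (t - s) + (t - s) * \<psi> \<theta>" by (simp add: net_exponent_def algebra_simps)
    then have "exp ((t - s) * \<phi> \<theta>) = exp (\<theta> * r * (t - s)) * exp ((t - s) * \<psi> \<theta>)" by (simp only: exp_add)
    then show ?thesis by (simp only: right_diff_distrib mult_1_right ac_simps)
  qed
  finally show "(\<integral>\<omega>. ?A \<omega> * (exp (- \<theta> * (Y t \<omega> - Y s \<omega>)) - 1) \<partial>M) = laplace_W \<theta> s * (exp ((t - s) * \<phi> \<theta>) - 1)" .
qed

definition repair_loss :: "real \<Rightarrow> real \<Rightarrow> 'a \<Rightarrow> real" where
  "repair_loss \<theta> t \<omega> = (\<Sum>i=1..num_events \<tau> t \<omega>. exp (- \<theta> * (W (\<tau> i \<omega>) \<omega> - \<xi> i \<omega>)) - exp (- \<theta> * W (\<tau> i \<omega>) \<omega>))"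

definition vacation_loss :: "real \<Rightarrow> real \<Rightarrow> 'a \<Rightarrow> real" where
  "vacation_loss \<theta> t \<omega> = (\<Sum>j=1..num_events \<sigma> t \<omega>. 1 - exp (- \<theta> * \<eta> j \<omega>))"

text \<open>
  The grid sums have the stated means by independence, and they converge boundedly along almost every
  path.
\<close>

lemma laplace_balance:
  assumes t: "0 < t" and \<theta>: "0 \<le> \<theta>"
    and loss: "repair_loss \<theta> t \<in> borel_measurable M" "vacation_loss \<theta> t \<in> borel_measurable M"
  shows "(\<lambda>n. \<Sum>k<n. laplace_W \<theta> (real k * (t / real n)) * (exp (t / real n * \<phi> \<theta>) - 1))
    \<longlonglongrightarrow> (\<integral>\<omega>. exp (- \<theta> * W t \<omega>) - exp (- \<theta> * W0 \<omega>) + repair_loss \<theta> t \<omega> + vacation_loss \<theta> t \<omega> \<partial>M)"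
proof -
  define Q where "Q n \<omega> = (\<Sum>k<n. exp (- \<theta> * W (real k * (t / real n)) \<omega>) *
     (exp (- \<theta> * (Y (real (Suc k) * (t / real n)) \<omega> - Y (real k * (t / real n)) \<omega>)) - 1))" for n \<omega>
  have Q_int: "integrable M (Q n)" and Q_mean: "(\<integral>\<omega>. Q n \<omega> \<partial>M) =
      (\<Sum>k<n. laplace_W \<theta> (real k * (t / real n)) * (exp (t / real n * \<phi> \<theta>) - 1))" for n
  proof -
    have le: "0 \<le> real k * (t / real n)" "real k * (t / real n) \<le> real (Suc k) * (t / real n)" for k
      using t mult_right_mono[of "real k" "real (Suc k)" "t / real n"] by simp_all
    have diff: "real (Suc k) * (t / real n) - real k * (t / real n) = t / real n" for k
      by (simp only: of_nat_Suc distrib_right mult_1_left add_diff_cancel_right')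
    show "integrable M (Q n)"
      unfolding Q_def by (rule Bochner_Integration.integrable_sum) (rule increment_independent(2)[OF le \<theta>])
    show "(\<integral>\<omega>. Q n \<omega> \<partial>M) = (\<Sum>k<n. laplace_W \<theta> (real k * (t / real n)) * (exp (t / real n * \<phi> \<theta>) - 1))"
    proof -
      have "(\<integral>\<omega>. Q n \<omega> \<partial>M) = (\<Sum>k<n. \<integral>\<omega>. exp (- \<theta> * W (real k * (t / real n)) \<omega>) *
          (exp (- \<theta> * (Y (real (Suc k) * (t / real n)) \<omega> - Y (real k * (t / real n)) \<omega>)) - 1) \<partial>M)"
        unfolding Q_def by (rule Bochner_Integration.integral_sum) (rule increment_independent(2)[OF le \<theta>])
      also have "\<dots> = (\<Sum>k<n. laplace_W \<theta> (real k * (t / real n)) * (exp (t / real n * \<phi> \<theta>) - 1))"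
        by (rule sum.cong[OF refl]) (simp only: increment_independent(1)[OF le \<theta>] diff)
      finally show ?thesis .
    qed
  qed
  have Q_path: "AE \<omega> in M. \<forall>n. Q n \<omega> = queue_path.grid_sum r X W0 \<tau> \<xi> \<sigma> \<eta> \<omega> \<theta> t n"
    using AE_queue_path
  proof eventually_elim
    case (elim \<omega>)
    interpret p: queue_path r X W0 \<tau> \<xi> \<sigma> \<eta> \<omega> by fact
    have cell: "exp (- \<theta> * W s \<omega>) * (exp (- \<theta> * (Y u \<omega> - Y s \<omega>)) - 1) =
        p.down_discount \<theta> s * (p.net_discount \<theta> u - p.net_discount \<theta> s)" for s u
    proof -
      have "p.net_discount \<theta> u = p.net_discount \<theta> s * exp (- \<theta> * (Y u \<omega> - Y s \<omega>))"
        unfolding p.net_discount_def exp_add[symmetric] by (simp add: algebra_simps)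
      moreover have "exp (- \<theta> * W s \<omega>) = p.down_discount \<theta> s * p.net_discount \<theta> s"
        using p.exp_content[of \<theta> s] unfolding p.content_def .
      ultimately show ?thesis by (simp only: right_diff_distrib mult.assoc mult_1_right)
    qed
    show ?case unfolding Q_def p.grid_sum_def cell by (intro allI refl)
  qed
  have "(\<lambda>n. \<integral>\<omega>. Q n \<omega> \<partial>M) \<longlonglongrightarrow>
    (\<integral>\<omega>. exp (- \<theta> * W t \<omega>) - exp (- \<theta> * W0 \<omega>) + repair_loss \<theta> t \<omega> + vacation_loss \<theta> t \<omega> \<partial>M)"
  proof (rule integral_dominated_convergence[where w="\<lambda>_. 2 + exp (\<theta> * r * t)"])
    show "AE \<omega> in M. (\<lambda>n. Q n \<omega>) \<longlonglongrightarrow>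
        exp (- \<theta> * W t \<omega>) - exp (- \<theta> * W0 \<omega>) + repair_loss \<theta> t \<omega> + vacation_loss \<theta> t \<omega>"
      using AE_queue_path Q_path
    proof eventually_elim
      case (elim \<omega>)
      interpret p: queue_path r X W0 \<tau> \<xi> \<sigma> \<eta> \<omega> by fact
      show ?case
        using p.grid_sum_tendsto[OF t, of \<theta>] elim(2) unfolding repair_loss_def vacation_loss_def p.content_def by simp
    qed
    show "AE \<omega> in M. norm (Q n \<omega>) \<le> 2 + exp (\<theta> * r * t)" for n
      using AE_queue_path Q_path
    proof eventually_elim
      case (elim \<omega>)
      then show ?case using queue_path.grid_sum_bound[OF elim(1) t \<theta>, of n] by simp
    qed
    show "(\<lambda>\<omega>. exp (- \<theta> * W t \<omega>) - exp (- \<theta> * W0 \<omega>) + repair_loss \<theta> t \<omega> + vacation_loss \<theta> t \<omega>) \<in> borel_measurable M"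
    proof -
      have [measurable]: "W t \<in> borel_measurable M" "W0 \<in> borel_measurable M"
        "repair_loss \<theta> t \<in> borel_measurable M" "vacation_loss \<theta> t \<in> borel_measurable M"
        using W_measurable[of t] W0_measurable t loss by auto
      show ?thesis by measurable
    qed
    show "Q n \<in> borel_measurable M" for n using Q_int by auto
  qed simp
  then show ?thesis unfolding Q_mean .
qed

end

section \<open>Long-run means\<close>

lemma (in prob_space) integral_pos:
  assumes int: "integrable M f" and pos: "AE \<omega> in M. 0 < (f \<omega> :: real)"
  shows "0 < (\<integral>\<omega>. f \<omega> \<partial>M)"
proof -
  have nonneg: "AE \<omega> in M. 0 \<le> f \<omega>" using pos by eventually_elim simp
  have "(\<integral>\<omega>. f \<omega> \<partial>M) \<noteq> 0"
  proof
    assume "(\<integral>\<omega>. f \<omega> \<partial>M) = 0"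
    then have "AE \<omega> in M. f \<omega> = 0" using integral_nonneg_eq_0_iff_AE[OF int nonneg] by simp
    with pos have "AE \<omega> in M. False" by eventually_elim simp
    then show False by simp
  qed
  then show ?thesis using integral_nonneg_AE[OF nonneg] by simp
qed

lemma exp_jump_bounds:
  fixes \<theta> x w :: real
  assumes \<theta>: "0 \<le> \<theta>" and x: "0 \<le> x" "x \<le> w"
  shows "0 \<le> exp (- \<theta> * (w - x)) - exp (- \<theta> * w) \<and> exp (- \<theta> * (w - x)) - exp (- \<theta> * w) \<le> \<theta> * x"
proof
  have "- \<theta> * w \<le> - \<theta> * (w - x)" using assms by (simp add: right_diff_distrib)
  then show "0 \<le> exp (- \<theta> * (w - x)) - exp (- \<theta> * w)" by simp
  have "- \<theta> * w = - \<theta> * (w - x) + - \<theta> * x" by (simp add: algebra_simps)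
  then have "exp (- \<theta> * w) = exp (- \<theta> * (w - x)) * exp (- \<theta> * x)" by (simp only: exp_add)
  then have "exp (- \<theta> * (w - x)) - exp (- \<theta> * w) = exp (- \<theta> * (w - x)) * (1 - exp (- \<theta> * x))"
    by (simp only: right_diff_distrib[of "exp (- \<theta> * (w - x))"] mult_1_right)
  also have "\<dots> \<le> 1 * (\<theta> * x)"
  proof (rule mult_mono)
    show "exp (- \<theta> * (w - x)) \<le> 1" using assms by simp
    show "1 - exp (- \<theta> * x) \<le> \<theta> * x" using exp_ge_add_one_self[of "- \<theta> * x"] by simp
  qed (use assms in auto)
  finally show "exp (- \<theta> * (w - x)) - exp (- \<theta> * w) \<le> \<theta> * x" by simp
qed

text \<open>
  By stationarity the transform of \<open>Z k\<close> is constant in \<open>k\<close>, hence equal to its limit, the transform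
  of \<open>L\<close>.
\<close>

lemma (in prob_space) ergodic_laplace_average:
  assumes st: "stationary_seq M (\<lambda>k. Z (Suc k))" and er: "ergodic_seq M (\<lambda>k. Z (Suc k))"
    and nonneg: "AE \<omega> in M. \<forall>k\<ge>1. 0 \<le> Z k \<omega>"
    and d: "tendsto_in_distr M Z N L sequentially" and N: "prob_space N" "L \<in> borel_measurable N"
    and \<theta>: "0 \<le> \<theta>"
  shows "AE \<omega> in M. (\<lambda>n. (\<Sum>i=1..n. exp (- \<theta> * Z i \<omega>)) / real n) \<longlonglongrightarrow> (\<integral>\<omega>. exp (- \<theta> * L \<omega>) \<partial>N)"
proof -
  define g where "g x = exp (- \<theta> * max 0 x)" for x
  have g [measurable]: "g \<in> borel_measurable borel" unfolding g_def[abs_def] by measurable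
  have m: "Z k \<in> borel_measurable M" if "1 \<le> k" for k
    using stationary_seq_measurable[OF st, of "k - 1"] that by simp
  have g_eq: "g (Z k \<omega>) = exp (- \<theta> * Z k \<omega>)" if "0 \<le> Z k \<omega>" for k \<omega> using that by (simp add: g_def)
  have g_int: "integrable M (\<lambda>\<omega>. g (Z (Suc 0) \<omega>))"
    by (rule integrable_const_bound[where B=1]) (use m[of "Suc 0"] \<theta> in \<open>auto simp: g_def\<close>)
  have "(\<lambda>k. \<integral>\<omega>. exp (- \<theta> * Z k \<omega>) \<partial>M) \<longlonglongrightarrow> (\<integral>\<omega>. exp (- \<theta> * L \<omega>) \<partial>N)"
  proof (rule tendsto_in_distr_laplace[OF d N sequentially_bot _ _ \<theta>])
    show "\<forall>\<^sub>F k in sequentially. AE \<omega> in M. 0 \<le> Z k \<omega>"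
      using eventually_ge_at_top[of 1]
    proof eventually_elim
      case (elim k)
      show ?case using nonneg by eventually_elim (use elim in auto)
    qed
    show "\<forall>\<^sub>F k in sequentially. Z k \<in> borel_measurable M"
      using eventually_ge_at_top[of 1] by eventually_elim (rule m)
  qed
  moreover have "(\<integral>\<omega>. exp (- \<theta> * Z (Suc k) \<omega>) \<partial>M) = (\<integral>\<omega>. g (Z (Suc 0) \<omega>) \<partial>M)" for k
  proof -
    have [measurable]: "Z (Suc k) \<in> borel_measurable M" by (rule m) simp
    have "(\<integral>\<omega>. exp (- \<theta> * Z (Suc k) \<omega>) \<partial>M) = (\<integral>\<omega>. g (Z (Suc k) \<omega>) \<partial>M)"
    proof (rule integral_cong_AE)
      show "AE \<omega> in M. exp (- \<theta> * Z (Suc k) \<omega>) = g (Z (Suc k) \<omega>)"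
        using nonneg by eventually_elim (simp add: g_def)
    qed measurable
    then show ?thesis using stationary_seq_same_integral(1)[OF st g, of k] by simp
  qed
  ultimately have "(\<lambda>k::nat. \<integral>\<omega>. g (Z (Suc 0) \<omega>) \<partial>M) \<longlonglongrightarrow> (\<integral>\<omega>. exp (- \<theta> * L \<omega>) \<partial>N)"
    by (subst (asm) filterlim_sequentially_Suc[symmetric]) simp
  then have lim: "(\<integral>\<omega>. g (Z (Suc 0) \<omega>) \<partial>M) = (\<integral>\<omega>. exp (- \<theta> * L \<omega>) \<partial>N)"
    using LIMSEQ_unique[OF tendsto_const] by blast
  show ?thesis
    using ergodic_average[OF stationary_seq_comp[OF st g] ergodic_seq_comp[OF er g] g_int] nonneg
  proof eventually_elim
    case (elim \<omega>)
    have "(\<Sum>i=1..n. exp (- \<theta> * Z i \<omega>)) = (\<Sum>i<n. g (Z (Suc i) \<omega>))" for n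
      using elim(2) by (simp add: sum.atLeast1_atMost_eq g_def)
    then show ?case using elim(1) by (simp only: lim)
  qed
qed

locale steady_fluid_queue = recurrent_fluid_queue +
  assumes steady_integrable: "\<forall>\<^sub>F t in at_top. integrable M (W t)"
    and steady_mean: "((\<lambda>t. (\<integral>\<omega>. W t \<omega> \<partial>M) / t) \<longlongrightarrow> 0) at_top"
    and \<xi>_measurable: "\<And>n. 1 \<le> n \<Longrightarrow> \<xi> n \<in> borel_measurable M"
    and \<eta>_measurable: "\<And>n. 1 \<le> n \<Longrightarrow> \<eta> n \<in> borel_measurable M"
begin

definition repair_total :: "real \<Rightarrow> 'a \<Rightarrow> real" where
  "repair_total t \<omega> = (\<Sum>k=1..num_events \<tau> t \<omega>. \<xi> k \<omega>)"

definition vacation_total :: "real \<Rightarrow> 'a \<Rightarrow> real" where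
  "vacation_total t \<omega> = (\<Sum>k=1..num_events \<sigma> t \<omega>. \<eta> k \<omega>)"

lemma total_nonneg: "AE \<omega> in M. \<forall>t. 0 \<le> repair_total t \<omega> \<and> 0 \<le> vacation_total t \<omega>"
  using AE_queue_path
proof eventually_elim
  case (elim \<omega>)
  interpret p: queue_path r X W0 \<tau> \<xi> \<sigma> \<eta> \<omega> by fact
  show ?case
    using p.repairs_nonneg p.vacations_nonneg
    by (simp add: repair_total_def vacation_total_def p.repairs_def p.vacations_def)
qed

lemma W_decompose: "W t \<omega> = W0 \<omega> + X t \<omega> - r * t + repair_total t \<omega> + vacation_total t \<omega>"
  by (simp add: waiting_time_def repair_total_def vacation_total_def)

text \<open>
  \<open>W0 \<le> W t + r * t\<close>, as all other contributions to \<open>W t\<close> are nonnegative.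
\<close>

lemma W0_integrable: "integrable M W0"
proof -
  obtain t where t: "0 < t" "integrable M (W t)"
    using eventually_conj[OF steady_integrable eventually_gt_at_top[of 0]]
    unfolding eventually_at_top_linorder by blast
  show ?thesis
  proof (rule Bochner_Integration.integrable_bound)
    show "integrable M (\<lambda>\<omega>. W t \<omega> + r * t)" using t by simp
    show "AE \<omega> in M. norm (W0 \<omega>) \<le> norm (W t \<omega> + r * t)"
      using initial_nonneg X_nonneg total_nonneg
    proof eventually_elim
      case (elim \<omega>)
      then have "0 \<le> X t \<omega>" "0 \<le> repair_total t \<omega>" "0 \<le> vacation_total t \<omega>" using t by auto
      then show ?case using elim(1) by (simp add: W_decompose)
    qed
  qed (rule W0_measurable)
qed

lemma total_integrable:
  assumes "0 \<le> t" "integrable M (W t)"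
  shows "integrable M (\<lambda>\<omega>. repair_total t \<omega> + vacation_total t \<omega>)"
proof -
  have "integrable M (\<lambda>\<omega>. W t \<omega> - W0 \<omega> - X t \<omega> + r * t)"
    using assms W0_integrable X_integrable by simp
  then show ?thesis by (simp add: W_decompose)
qed

text \<open>
  \<open>R t + V t = W t - W0 - X t + r * t\<close>, and each of \<open>W t / t\<close>, \<open>W0 / t\<close> and \<open>X t / t - E (X 1)\<close> vanishes
  in mean.
\<close>

lemma total_L1:
  "((\<lambda>t. \<integral>\<omega>. \<bar>(repair_total t \<omega> + vacation_total t \<omega>) / t - (r - mean_input)\<bar> \<partial>M) \<longlongrightarrow> 0) at_top"
proof (rule tendsto_sandwich[OF _ _ tendsto_const])
  show "\<forall>\<^sub>F t in at_top. 0 \<le> (\<integral>\<omega>. \<bar>(repair_total t \<omega> + vacation_total t \<omega>) / t - (r - mean_input)\<bar> \<partial>M)"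
    by simp
  have "((\<lambda>t. (\<integral>\<omega>. W0 \<omega> \<partial>M) / t) \<longlongrightarrow> 0) at_top"
    by (rule tendsto_divide_0[OF tendsto_const filterlim_at_top_imp_at_infinity[OF filterlim_ident]])
  then have "((\<lambda>t. (\<integral>\<omega>. W t \<omega> \<partial>M) / t + (\<integral>\<omega>. W0 \<omega> \<partial>M) / t + (\<integral>\<omega>. \<bar>X t \<omega> / t - mean_input\<bar> \<partial>M))
    \<longlongrightarrow> 0 + 0 + 0) at_top"
    by (intro tendsto_add steady_mean X_over_t_L1)
  then show "((\<lambda>t. (\<integral>\<omega>. W t \<omega> \<partial>M) / t + (\<integral>\<omega>. W0 \<omega> \<partial>M) / t + (\<integral>\<omega>. \<bar>X t \<omega> / t - mean_input\<bar> \<partial>M))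
    \<longlongrightarrow> 0) at_top" by simp
  show "\<forall>\<^sub>F t in at_top. (\<integral>\<omega>. \<bar>(repair_total t \<omega> + vacation_total t \<omega>) / t - (r - mean_input)\<bar> \<partial>M) \<le>
    (\<integral>\<omega>. W t \<omega> \<partial>M) / t + (\<integral>\<omega>. W0 \<omega> \<partial>M) / t + (\<integral>\<omega>. \<bar>X t \<omega> / t - mean_input\<bar> \<partial>M)"
    using steady_integrable eventually_gt_at_top[of 0]
  proof eventually_elim
    case (elim t)
    then have Xi: "integrable M (X t)" by (intro X_integrable) simp
    have "(\<integral>\<omega>. \<bar>(repair_total t \<omega> + vacation_total t \<omega>) / t - (r - mean_input)\<bar> \<partial>M) \<le>
      (\<integral>\<omega>. W t \<omega> / t + W0 \<omega> / t + \<bar>X t \<omega> / t - mean_input\<bar> \<partial>M)"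
    proof (rule integral_mono_AE)
      show "AE \<omega> in M. \<bar>(repair_total t \<omega> + vacation_total t \<omega>) / t - (r - mean_input)\<bar>
          \<le> W t \<omega> / t + W0 \<omega> / t + \<bar>X t \<omega> / t - mean_input\<bar>"
        using initial_nonneg AE_W_nonneg[of t, OF less_imp_le[OF elim(2)]]
      proof eventually_elim
        case w: (elim \<omega>)
        have "(repair_total t \<omega> + vacation_total t \<omega>) / t - (r - mean_input) =
            W t \<omega> / t - W0 \<omega> / t - (X t \<omega> / t - mean_input)"
          using elim(2) by (simp add: W_decompose field_simps)
        moreover have "0 \<le> W t \<omega> / t" "0 \<le> W0 \<omega> / t" using w elim by auto
        ultimately show ?case by linarith
      qed
    qed (use elim Xi W0_integrable total_integrable[of t] in auto)
    also have "\<dots> = (\<integral>\<omega>. W t \<omega> \<partial>M) / t + (\<integral>\<omega>. W0 \<omega> \<partial>M) / t + (\<integral>\<omega>. \<bar>X t \<omega> / t - mean_input\<bar> \<partial>M)"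
      using elim Xi W0_integrable by simp
    finally show ?case .
  qed
qed

text \<open>
  Covers failures and vacations alike. The sums converge in probability by
  \<open>random_index_conv_in_prob\<close>; since every summand is at most \<open>K\<close> times the corresponding down time, they
  are dominated by \<open>K\<close> times the total in \<open>total_L1\<close>, so their means converge too.
\<close>

lemma random_sum_mean_tendsto:
  assumes T: "(T, work, lam) \<in> {(\<tau>, \<xi>, lam_R), (\<sigma>, \<eta>, lam_V)}"
    and fm: "\<And>i. 1 \<le> i \<Longrightarrow> f i \<in> borel_measurable M"
    and f: "AE \<omega> in M. \<forall>i\<ge>1. 0 \<le> f i \<omega> \<and> f i \<omega> \<le> K * work i \<omega>" and K: "0 \<le> K"
    and avg: "AE \<omega> in M. (\<lambda>n. (\<Sum>i=1..n. f i \<omega>) / real n) \<longlonglongrightarrow> c"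
  shows "((\<lambda>t. (\<integral>\<omega>. (\<Sum>i=1..num_events T t \<omega>. f i \<omega>) \<partial>M) / t) \<longlongrightarrow> lam * c) at_top"
    and "\<forall>\<^sub>F t in at_top. integrable M (\<lambda>\<omega>. \<Sum>i=1..num_events T t \<omega>. f i \<omega>)"
proof -
  have T': "T \<in> {\<tau>, \<sigma>}" "0 < lam" "tendsto_in_prob M (\<lambda>n \<omega>. T n \<omega> / real n) (1 / lam)"
    using T rates_pos failure_rate vacation_rate by auto
  have meas: "(\<lambda>\<omega>. \<Sum>i=1..num_events T t \<omega>. f i \<omega>) \<in> borel_measurable M" for t
    by (rule random_sum_measurable_M[OF T'(1) fm])
  have dom: "AE \<omega> in M. \<forall>t. 0 \<le> (\<Sum>i=1..num_events T t \<omega>. f i \<omega>) \<and>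
      (\<Sum>i=1..num_events T t \<omega>. f i \<omega>) \<le> K * (repair_total t \<omega> + vacation_total t \<omega>)"
    using f total_nonneg
  proof eventually_elim
    case (elim \<omega>)
    show ?case
    proof (intro allI conjI)
      fix t
      show "0 \<le> (\<Sum>i=1..num_events T t \<omega>. f i \<omega>)" using elim by (intro sum_nonneg) auto
      have "(\<Sum>i=1..num_events T t \<omega>. f i \<omega>) \<le> (\<Sum>i=1..num_events T t \<omega>. K * work i \<omega>)"
        using elim by (intro sum_mono) auto
      also have "\<dots> = K * (\<Sum>i=1..num_events T t \<omega>. work i \<omega>)" by (simp add: sum_distrib_left)
      also have "\<dots> \<le> K * (repair_total t \<omega> + vacation_total t \<omega>)"
        using K T elim by (intro mult_left_mono) (auto simp: repair_total_def vacation_total_def)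
      finally show "(\<Sum>i=1..num_events T t \<omega>. f i \<omega>) \<le> K * (repair_total t \<omega> + vacation_total t \<omega>)" .
    qed
  qed
  have Bint: "\<forall>\<^sub>F t in at_top. integrable M (\<lambda>\<omega>. K * ((repair_total t \<omega> + vacation_total t \<omega>) / t))"
    using steady_integrable eventually_gt_at_top[of 0]
  proof eventually_elim
    case (elim t)
    then have "integrable M (\<lambda>\<omega>. repair_total t \<omega> + vacation_total t \<omega>)" using total_integrable[of t] by simp
    then show ?case by (intro integrable_mult_right integrable_divide)
  qed
  show "\<forall>\<^sub>F t in at_top. integrable M (\<lambda>\<omega>. \<Sum>i=1..num_events T t \<omega>. f i \<omega>)"
    using steady_integrable eventually_gt_at_top[of 0]
  proof eventually_elim
    case (elim t)
    then have int: "integrable M (\<lambda>\<omega>. K * (repair_total t \<omega> + vacation_total t \<omega>))"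
      using total_integrable[of t] by simp
    show ?case
    proof (rule Bochner_Integration.integrable_bound[OF int meas])
      show "AE \<omega> in M. norm (\<Sum>i=1..num_events T t \<omega>. f i \<omega>) \<le> norm (K * (repair_total t \<omega> + vacation_total t \<omega>))"
        using dom
      proof eventually_elim
        case (elim \<omega>)
        then show ?case using spec[OF elim, of t] unfolding real_norm_def by linarith
      qed
    qed
  qed
  have Sm: "(\<lambda>\<omega>. \<Sum>i=1..n. f i \<omega>) \<in> borel_measurable M" for n
    using fm by (intro borel_measurable_sum) auto
  have c: "0 \<le> c"
  proof -
    have "AE \<omega> in M. 0 \<le> c"
      using f avg
    proof eventually_elim
      case (elim \<omega>)
      show ?case
        by (rule LIMSEQ_le_const[OF elim(2)]) (use elim(1) in \<open>auto intro!: exI[of _ 0] divide_nonneg_nonneg sum_nonneg\<close>)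
    qed
    then show ?thesis by simp
  qed
  have "conv_in_prob M (\<lambda>t \<omega>. (\<lambda>n \<omega>. \<Sum>i=1..n. f i \<omega>) (num_events T t \<omega>) \<omega> / t) (lam * c) at_top"
  proof (rule random_index_conv_in_prob[OF _ _ T'(3,2) Sm _ _ c])
    show "T n \<in> borel_measurable M" if "1 \<le> n" for n
      using T'(1) \<tau>_measurable[OF that] \<sigma>_measurable[OF that] by auto
    show "AE \<omega> in M. \<forall>t\<ge>0. \<forall>n\<ge>1. (n \<le> num_events T t \<omega>) = (T n \<omega> \<le> t)"
      using AE_queue_path
    proof eventually_elim
      case (elim \<omega>)
      interpret p: queue_path r X W0 \<tau> \<xi> \<sigma> \<eta> \<omega> by fact
      show ?case using T'(1) p.\<tau>_count p.\<sigma>_count by auto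
    qed
    show "AE \<omega> in M. mono (\<lambda>n. \<Sum>i=1..n. f i \<omega>)"
      using f
    proof eventually_elim
      case (elim \<omega>)
      show ?case by (rule monoI, rule sum_mono2) (use elim in auto)
    qed
    show "conv_in_prob M (\<lambda>n \<omega>. (\<Sum>i=1..n. f i \<omega>) / real n) c sequentially"
      by (rule conv_in_prob_AE[OF _ avg]) (use Sm in measurable)
  qed
  then have prob: "conv_in_prob M (\<lambda>t \<omega>. (\<Sum>i=1..num_events T t \<omega>. f i \<omega>) / t) (lam * c) at_top" .
  have "((\<lambda>t. \<integral>\<omega>. (\<Sum>i=1..num_events T t \<omega>. f i \<omega>) / t \<partial>M) \<longlongrightarrow> lam * c) at_top"
  proof (rule mean_tendsto_if_dominated[OF _ Bint _ _ prob])
    show "\<forall>\<^sub>F t in at_top. (\<lambda>\<omega>. (\<Sum>i=1..num_events T t \<omega>. f i \<omega>) / t) \<in> borel_measurable M"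
      using meas by (intro always_eventually allI borel_measurable_divide) auto
    show "\<forall>\<^sub>F t in at_top. AE \<omega> in M. 0 \<le> (\<Sum>i=1..num_events T t \<omega>. f i \<omega>) / t \<and>
        (\<Sum>i=1..num_events T t \<omega>. f i \<omega>) / t \<le> K * ((repair_total t \<omega> + vacation_total t \<omega>) / t)"
      using eventually_gt_at_top[of 0]
    proof eventually_elim
      case t: (elim t)
      show ?case using dom
      proof eventually_elim
        case (elim \<omega>)
        then have *: "0 \<le> (\<Sum>i=1..num_events T t \<omega>. f i \<omega>)"
          "(\<Sum>i=1..num_events T t \<omega>. f i \<omega>) \<le> K * (repair_total t \<omega> + vacation_total t \<omega>)" by blast+
        then show ?case using divide_right_mono[OF *(2), of t] t by simp
      qed
    qed
    have "((\<lambda>t. K * (\<integral>\<omega>. \<bar>(repair_total t \<omega> + vacation_total t \<omega>) / t - (r - mean_input)\<bar> \<partial>M)) \<longlongrightarrow> K * 0) at_top"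
      by (intro tendsto_mult_left total_L1)
    moreover have "(\<integral>\<omega>. \<bar>K * ((repair_total t \<omega> + vacation_total t \<omega>) / t) - K * (r - mean_input)\<bar> \<partial>M) =
        K * (\<integral>\<omega>. \<bar>(repair_total t \<omega> + vacation_total t \<omega>) / t - (r - mean_input)\<bar> \<partial>M)" for t
      using K by (simp only: right_diff_distrib[symmetric] abs_mult abs_of_nonneg integral_mult_right_zero)
    ultimately show "((\<lambda>t. \<integral>\<omega>. \<bar>K * ((repair_total t \<omega> + vacation_total t \<omega>) / t) - K * (r - mean_input)\<bar> \<partial>M) \<longlongrightarrow> 0) at_top"
      by simp
  qed
  then show "((\<lambda>t. (\<integral>\<omega>. (\<Sum>i=1..num_events T t \<omega>. f i \<omega>) \<partial>M) / t) \<longlongrightarrow> lam * c) at_top" by simp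
qed

lemma iid_average:
  assumes iid: "iid_seq M Z" and g: "g \<in> borel_measurable borel" and int: "integrable M (\<lambda>\<omega>. g (Z 1 \<omega>))"
  shows "AE \<omega> in M. (\<lambda>n. (\<Sum>i=1..n. g (Z i \<omega>)) / real n) \<longlonglongrightarrow> (\<integral>\<omega>. g (Z 1 \<omega>) \<partial>M)"
  using ergodic_average[OF stationary_seq_comp[OF iid_seq_stationary[OF iid] g] ergodic_seq_comp[OF iid_seq_ergodic[OF iid] g]] int
  by (simp add: sum.atLeast1_atMost_eq)

end

section \<open>Decomposition of the workload\<close>

theorem theorem4p1:
  fixes M :: "'a measure" and F :: "real \<Rightarrow> 'a measure"
    and a r :: real and \<nu> :: "real measure"
    and X :: "real \<Rightarrow> 'a \<Rightarrow> real" and W0 :: "'a \<Rightarrow> real"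
    and \<tau> \<xi> \<sigma> \<eta> :: "nat \<Rightarrow> 'a \<Rightarrow> real"
    and N :: "'b measure" and W_inf :: "'b \<Rightarrow> real"
    and N' :: "'c measure" and W_minus W_plus :: "'c \<Rightarrow> real"
    and lam_R lam_V :: real
  defines "W \<equiv> waiting_time X r W0 \<tau> \<xi> \<sigma> \<eta>"
    and "Y \<equiv> \<lambda>t \<omega>. X t \<omega> - r * t"
    and "\<phi> \<equiv> net_exponent a \<nu> r"
  assumes queue: "fluid_queue M F a \<nu> r X W0 \<tau> \<xi> \<sigma> \<eta>"
    and steady_space: "prob_space N" "W_inf \<in> borel_measurable N"
    and steady_distr: "tendsto_in_distr M W N W_inf at_top"
    and steady_integrable: "\<forall>\<^sub>F t in at_top. integrable M (W t)"
    and steady_mean: "((\<lambda>t. (\<integral>\<omega>. W t \<omega> \<partial>M) / t) \<longlongrightarrow> 0) at_top"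
    and repair_iid: "iid_seq M \<xi>" and repair_mean: "integrable M (\<xi> 1)"
    and vacation_iid: "iid_seq M \<eta>" and vacation_mean: "integrable M (\<eta> 1)"
    and rates_pos: "0 < lam_R" "0 < lam_V"
    and failure_rate: "tendsto_in_prob M (\<lambda>n \<omega>. \<tau> n \<omega> / real n) (1 / lam_R)"
    and vacation_rate: "tendsto_in_prob M (\<lambda>n \<omega>. \<sigma> n \<omega> / real n) (1 / lam_V)"
    and after_failure:
      "stationary_seq M (\<lambda>k \<omega>. W (\<tau> (Suc k) \<omega>) \<omega>)"
      "ergodic_seq M (\<lambda>k \<omega>. W (\<tau> (Suc k) \<omega>) \<omega>)"
    and before_failure:
      "stationary_seq M (\<lambda>k \<omega>. W (\<tau> (Suc k) \<omega>) \<omega> - \<xi> (Suc k) \<omega>)"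
      "ergodic_seq M (\<lambda>k \<omega>. W (\<tau> (Suc k) \<omega>) \<omega> - \<xi> (Suc k) \<omega>)"
    and limit_space: "prob_space N'"
      "W_minus \<in> borel_measurable N'" "W_plus \<in> borel_measurable N'"
    and failure_distr:
      "tendsto_in_distr M (\<lambda>k \<omega>. (W (\<tau> k \<omega>) \<omega> - \<xi> k \<omega>, W (\<tau> k \<omega>) \<omega>))
         N' (\<lambda>\<omega>. (W_minus \<omega>, W_plus \<omega>)) sequentially"
    and repair_indep: "\<And>n. 1 \<le> n \<Longrightarrow>
      prob_space.indep_var M borel (\<xi> n) borel (\<lambda>\<omega>. of_bool (n \<le> num_events \<tau> 1 \<omega>) :: real)"
    and vacation_indep: "\<And>n. 1 \<le> n \<Longrightarrow>
      prob_space.indep_var M borel (\<eta> n) borel (\<lambda>\<omega>. of_bool (n \<le> num_events \<sigma> 1 \<omega>) :: real)"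
  shows "\<exists>p. 0 \<le> p \<and> p \<le> 1 \<and>
    lam_R = p * deriv_at_0 \<phi> / (\<integral>\<omega>. \<xi> 1 \<omega> \<partial>M) \<and>
    lam_V = (1 - p) * deriv_at_0 \<phi> / (\<integral>\<omega>. \<eta> 1 \<omega> \<partial>M) \<and>
    ((\<lambda>t. (\<integral>\<omega>. (\<Sum>k=1..num_events \<tau> t \<omega>. \<xi> k \<omega>) \<partial>M) / t)
       \<longlongrightarrow> - p * (\<integral>\<omega>. Y 1 \<omega> \<partial>M)) at_top \<and>
    ((\<lambda>t. (\<integral>\<omega>. (\<Sum>k=1..num_events \<sigma> t \<omega>. \<eta> k \<omega>) \<partial>M) / t)
       \<longlongrightarrow> - (1 - p) * (\<integral>\<omega>. Y 1 \<omega> \<partial>M)) at_top \<and>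
    (\<forall>\<theta>>0.
       ((\<lambda>t. \<integral>\<omega>. exp (- \<theta> * W t \<omega>) \<partial>M) \<longlongrightarrow> (\<integral>\<omega>. exp (- \<theta> * W_inf \<omega>) \<partial>N)) at_top \<and>
       (\<integral>\<omega>. exp (- \<theta> * W_inf \<omega>) \<partial>N) =
         \<theta> * deriv_at_0 \<phi> / \<phi> \<theta> *
           (p * (((\<integral>\<omega>. exp (- \<theta> * W_minus \<omega>) \<partial>N') - (\<integral>\<omega>. exp (- \<theta> * W_plus \<omega>) \<partial>N'))
                 / (\<theta> * (\<integral>\<omega>. \<xi> 1 \<omega> \<partial>M)))
            + (1 - p) * ((1 - (\<integral>\<omega>. exp (- \<theta> * \<eta> 1 \<omega>) \<partial>M))
                 / (\<theta> * (\<integral>\<omega>. \<eta> 1 \<omega> \<partial>M)))))"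
proof -
  interpret fluid_queue M F a \<nu> r X W0 \<tau> \<xi> \<sigma> \<eta> by (rule queue)
  have \<xi>m: "\<xi> n \<in> borel_measurable M" and \<eta>m: "\<eta> n \<in> borel_measurable M" if "1 \<le> n" for n
    using repair_iid vacation_iid that unfolding iid_seq_def indep_vars_def by auto
  interpret steady_fluid_queue M F a \<nu> r X W0 \<tau> \<xi> \<sigma> \<eta> lam_R lam_V
    by unfold_locales (fact rates_pos failure_rate vacation_rate steady_integrable[unfolded W_def]
        steady_mean[unfolded W_def] \<xi>m \<eta>m)+
  note W = W_def[symmetric]
  \<comment> \<open>\<open>d\<close> is both \<open>\<phi>'(0)\<close> and \<open>- E (Y 1)\<close>.\<close>
  define d where "d = r - mean_input"
  define E\<xi> where "E\<xi> = (\<integral>\<omega>. \<xi> 1 \<omega> \<partial>M)"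
  define E\<eta> where "E\<eta> = (\<integral>\<omega>. \<eta> 1 \<omega> \<partial>M)"
  have d: "0 < d" using mean_input_less by (simp add: d_def)
  have deriv: "deriv_at_0 \<phi> = d" unfolding \<phi>_def d_def by (rule deriv_net_exponent)
  have EY: "(\<integral>\<omega>. Y 1 \<omega> \<partial>M) = - d" unfolding Y_def d_def using X_integrable[of 1] by (simp add: prob_space)
  have E\<xi>: "0 < E\<xi>" unfolding E\<xi>_def
    by (rule integral_pos[OF repair_mean]) (use repair_pos in \<open>auto elim: eventually_mono\<close>)
  have E\<eta>: "0 < E\<eta>" unfolding E\<eta>_def
    by (rule integral_pos[OF vacation_mean]) (use vacation_pos in \<open>auto elim: eventually_mono\<close>)

  have R: "((\<lambda>t. (\<integral>\<omega>. (\<Sum>k=1..num_events \<tau> t \<omega>. \<xi> k \<omega>) \<partial>M) / t) \<longlongrightarrow> lam_R * E\<xi>) at_top"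
    and Rint: "\<forall>\<^sub>F t in at_top. integrable M (\<lambda>\<omega>. \<Sum>k=1..num_events \<tau> t \<omega>. \<xi> k \<omega>)"
  proof -
    have 1: "AE \<omega> in M. \<forall>i\<ge>1. 0 \<le> \<xi> i \<omega> \<and> \<xi> i \<omega> \<le> 1 * \<xi> i \<omega>" using repair_pos by eventually_elim (simp add: less_imp_le)
    have 2: "AE \<omega> in M. (\<lambda>n. (\<Sum>i=1..n. \<xi> i \<omega>) / real n) \<longlonglongrightarrow> E\<xi>"
      unfolding E\<xi>_def by (rule iid_average[OF repair_iid, of "\<lambda>x. x"]) (use repair_mean in auto)
    show "((\<lambda>t. (\<integral>\<omega>. (\<Sum>k=1..num_events \<tau> t \<omega>. \<xi> k \<omega>) \<partial>M) / t) \<longlongrightarrow> lam_R * E\<xi>) at_top"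
      "\<forall>\<^sub>F t in at_top. integrable M (\<lambda>\<omega>. \<Sum>k=1..num_events \<tau> t \<omega>. \<xi> k \<omega>)"
      using random_sum_mean_tendsto[OF _ \<xi>m 1 _ 2, of \<tau> lam_R] by auto
  qed
  have V: "((\<lambda>t. (\<integral>\<omega>. (\<Sum>k=1..num_events \<sigma> t \<omega>. \<eta> k \<omega>) \<partial>M) / t) \<longlongrightarrow> lam_V * E\<eta>) at_top"
    and Vint: "\<forall>\<^sub>F t in at_top. integrable M (\<lambda>\<omega>. \<Sum>k=1..num_events \<sigma> t \<omega>. \<eta> k \<omega>)"
  proof -
    have 1: "AE \<omega> in M. \<forall>i\<ge>1. 0 \<le> \<eta> i \<omega> \<and> \<eta> i \<omega> \<le> 1 * \<eta> i \<omega>" using vacation_pos by eventually_elim (simp add: less_imp_le)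
    have 2: "AE \<omega> in M. (\<lambda>n. (\<Sum>i=1..n. \<eta> i \<omega>) / real n) \<longlonglongrightarrow> E\<eta>"
      unfolding E\<eta>_def by (rule iid_average[OF vacation_iid, of "\<lambda>x. x"]) (use vacation_mean in auto)
    show "((\<lambda>t. (\<integral>\<omega>. (\<Sum>k=1..num_events \<sigma> t \<omega>. \<eta> k \<omega>) \<partial>M) / t) \<longlongrightarrow> lam_V * E\<eta>) at_top"
      "\<forall>\<^sub>F t in at_top. integrable M (\<lambda>\<omega>. \<Sum>k=1..num_events \<sigma> t \<omega>. \<eta> k \<omega>)"
      using random_sum_mean_tendsto[OF _ \<eta>m 1 _ 2, of \<sigma> lam_V] by auto
  qed

  have split: "lam_R * E\<xi> + lam_V * E\<eta> = d"
  proof -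
    let ?S = "\<lambda>t. (\<integral>\<omega>. repair_total t \<omega> \<partial>M) / t + (\<integral>\<omega>. vacation_total t \<omega> \<partial>M) / t"
    have "((\<lambda>t. ?S t - d) \<longlongrightarrow> 0) at_top"
    proof (rule Lim_null_comparison[OF _ total_L1])
      show "\<forall>\<^sub>F t in at_top. norm (?S t - d) \<le> (\<integral>\<omega>. \<bar>(repair_total t \<omega> + vacation_total t \<omega>) / t - (r - mean_input)\<bar> \<partial>M)"
        using Rint Vint
      proof eventually_elim
        case (elim t)
        then have int: "integrable M (repair_total t)" "integrable M (vacation_total t)"
          unfolding repair_total_def[abs_def] vacation_total_def[abs_def] by auto
        then have "?S t - d = (\<integral>\<omega>. (repair_total t \<omega> + vacation_total t \<omega>) / t - (r - mean_input) \<partial>M)"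
          by (simp add: prob_space d_def add_divide_distrib)
        then show ?case by (simp only: real_norm_def integral_abs_bound)
      qed
    qed
    then have "(?S \<longlongrightarrow> d) at_top" by (rule LIM_zero_cancel)
    moreover have "(?S \<longlongrightarrow> lam_R * E\<xi> + lam_V * E\<eta>) at_top"
      using tendsto_add[OF R V] unfolding repair_total_def vacation_total_def .
    ultimately show ?thesis using tendsto_unique[OF trivial_limit_at_top_linorder] by blast
  qed
  define p where "p = lam_R * E\<xi> / d"
  have p: "p * d = lam_R * E\<xi>" "(1 - p) * d = lam_V * E\<eta>" "0 \<le> p" "p \<le> 1"
  proof -
    show "p * d = lam_R * E\<xi>" using d by (simp add: p_def)
    then show "(1 - p) * d = lam_V * E\<eta>" using split by (simp add: left_diff_distrib)
    have "0 < lam_R * E\<xi>" "0 < lam_V * E\<eta>" using rates_pos E\<xi> E\<eta> by auto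
    then show "0 \<le> p" "p \<le> 1" using split d by (auto simp: p_def)
  qed

  have transform: "((\<lambda>t. \<integral>\<omega>. exp (- \<theta> * W t \<omega>) \<partial>M) \<longlongrightarrow> (\<integral>\<omega>. exp (- \<theta> * W_inf \<omega>) \<partial>N)) at_top \<and>
     \<phi> \<theta> * (\<integral>\<omega>. exp (- \<theta> * W_inf \<omega>) \<partial>N) =
       lam_R * ((\<integral>\<omega>. exp (- \<theta> * W_minus \<omega>) \<partial>N') - (\<integral>\<omega>. exp (- \<theta> * W_plus \<omega>) \<partial>N'))
       + lam_V * (1 - (\<integral>\<omega>. exp (- \<theta> * \<eta> 1 \<omega>) \<partial>M))" if \<theta>: "0 < \<theta>" for \<theta>
  proof
    let ?L = "\<integral>\<omega>. exp (- \<theta> * W_inf \<omega>) \<partial>N"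
    let ?cm = "\<integral>\<omega>. exp (- \<theta> * W_minus \<omega>) \<partial>N'" and ?cp = "\<integral>\<omega>. exp (- \<theta> * W_plus \<omega>) \<partial>N'"
      and ?ce = "\<integral>\<omega>. exp (- \<theta> * \<eta> 1 \<omega>) \<partial>M"
    show lim: "((\<lambda>t. \<integral>\<omega>. exp (- \<theta> * W t \<omega>) \<partial>M) \<longlongrightarrow> ?L) at_top"
    proof (rule tendsto_in_distr_laplace[OF steady_distr steady_space trivial_limit_at_top_linorder])
      show "\<forall>\<^sub>F t in at_top. AE \<omega> in M. 0 \<le> W t \<omega>"
        using eventually_ge_at_top[of 0] unfolding W_def by eventually_elim (rule AE_W_nonneg)
      show "\<forall>\<^sub>F t in at_top. W t \<in> borel_measurable M"
        using eventually_ge_at_top[of 0] unfolding W_def by eventually_elim (rule W_measurable)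
    qed (use \<theta> in simp)

    have fail: "AE \<omega> in M. \<forall>k\<ge>1. 0 < \<xi> k \<omega> \<and> \<xi> k \<omega> \<le> W (\<tau> k \<omega>) \<omega>"
      using AE_queue_path
    proof eventually_elim
      case (elim \<omega>)
      interpret p: queue_path r X W0 \<tau> \<xi> \<sigma> \<eta> \<omega> by fact
      show ?case using p.content_failure p.\<xi>_pos unfolding p.content_def W_def by blast
    qed
    have avg_m: "AE \<omega> in M. (\<lambda>n. (\<Sum>i=1..n. exp (- \<theta> * (W (\<tau> i \<omega>) \<omega> - \<xi> i \<omega>))) / real n) \<longlonglongrightarrow> ?cm"
    proof (rule ergodic_laplace_average[OF before_failure _ _ limit_space(1,2)])
      show "AE \<omega> in M. \<forall>k\<ge>1. 0 \<le> W (\<tau> k \<omega>) \<omega> - \<xi> k \<omega>" using fail by eventually_elim auto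
      show "tendsto_in_distr M (\<lambda>k \<omega>. W (\<tau> k \<omega>) \<omega> - \<xi> k \<omega>) N' W_minus sequentially"
        using tendsto_in_distr_continuous[OF failure_distr, of fst] by (simp add: continuous_on_fst)
    qed (use \<theta> in simp)
    have avg_p: "AE \<omega> in M. (\<lambda>n. (\<Sum>i=1..n. exp (- \<theta> * W (\<tau> i \<omega>) \<omega>)) / real n) \<longlonglongrightarrow> ?cp"
    proof (rule ergodic_laplace_average[OF after_failure _ _ limit_space(1,3)])
      show "AE \<omega> in M. \<forall>k\<ge>1. 0 \<le> W (\<tau> k \<omega>) \<omega>" using fail by eventually_elim force
      show "tendsto_in_distr M (\<lambda>k \<omega>. W (\<tau> k \<omega>) \<omega>) N' W_plus sequentially"
        using tendsto_in_distr_continuous[OF failure_distr, of snd] by (simp add: continuous_on_snd)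
    qed (use \<theta> in simp)
    define f where "f i \<omega> = exp (- \<theta> * (W (\<tau> i \<omega>) \<omega> - \<xi> i \<omega>)) - exp (- \<theta> * W (\<tau> i \<omega>) \<omega>)" for i \<omega>
    have f_meas: "f i \<in> borel_measurable M" if "1 \<le> i" for i
    proof -
      have "i = Suc (i - 1)" using that by simp
      then have [measurable]: "(\<lambda>\<omega>. W (\<tau> i \<omega>) \<omega>) \<in> borel_measurable M" "\<xi> i \<in> borel_measurable M"
        using stationary_seq_measurable[OF after_failure(1), of "i - 1"] \<xi>m[of i] that by auto
      show ?thesis unfolding f_def[abs_def] by measurable
    qed
    have f_bounds: "AE \<omega> in M. \<forall>i\<ge>1. 0 \<le> f i \<omega> \<and> f i \<omega> \<le> \<theta> * \<xi> i \<omega>"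
      using fail
    proof eventually_elim
      case (elim \<omega>)
      show ?case
      proof (intro allI impI)
        fix i :: nat assume "1 \<le> i"
        then have x: "0 < \<xi> i \<omega>" "\<xi> i \<omega> \<le> W (\<tau> i \<omega>) \<omega>" using elim by auto
        show "0 \<le> f i \<omega> \<and> f i \<omega> \<le> \<theta> * \<xi> i \<omega>"
          unfolding f_def by (rule exp_jump_bounds) (use x \<theta> in auto)
      qed
    qed
    have f_avg: "AE \<omega> in M. (\<lambda>n. (\<Sum>i=1..n. f i \<omega>) / real n) \<longlonglongrightarrow> ?cm - ?cp"
      using avg_m avg_p
    proof eventually_elim
      case (elim \<omega>)
      show ?case using tendsto_diff[OF elim] by (simp add: f_def sum_subtractf diff_divide_distrib)
    qed
    note Rl = random_sum_mean_tendsto[OF _ f_meas f_bounds _ f_avg, of \<tau> lam_R]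
    have repair_loss_eq: "repair_loss \<theta> t = (\<lambda>\<omega>. \<Sum>i=1..num_events \<tau> t \<omega>. f i \<omega>)" for t
      unfolding repair_loss_def[abs_def] f_def W_def ..

    define g where "g i \<omega> = 1 - exp (- \<theta> * \<eta> i \<omega>)" for i \<omega>
    have g_meas: "g i \<in> borel_measurable M" if "1 \<le> i" for i
      unfolding g_def[abs_def] using \<eta>m[OF that] by measurable
    have g_bounds: "AE \<omega> in M. \<forall>i\<ge>1. 0 \<le> g i \<omega> \<and> g i \<omega> \<le> \<theta> * \<eta> i \<omega>"
      using vacation_pos
    proof eventually_elim
      case (elim \<omega>)
      show ?case
      proof (intro allI impI)
        fix i :: nat assume "1 \<le> i"
        then have "0 < \<eta> i \<omega>" using elim by auto
        then show "0 \<le> g i \<omega> \<and> g i \<omega> \<le> \<theta> * \<eta> i \<omega>"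
          using exp_jump_bounds[of \<theta> "\<eta> i \<omega>" "\<eta> i \<omega>"] \<theta> by (simp add: g_def)
      qed
    qed
    have exp_int: "integrable M (\<lambda>\<omega>. exp (- \<theta> * \<eta> 1 \<omega>))"
    proof (rule integrable_const_bound[where B=1])
      show "AE \<omega> in M. norm (exp (- \<theta> * \<eta> 1 \<omega>)) \<le> 1"
        using vacation_pos by eventually_elim (use \<theta> in \<open>auto simp: less_imp_le\<close>)
    qed (use \<eta>m[of 1] in measurable)
    have g_avg: "AE \<omega> in M. (\<lambda>n. (\<Sum>i=1..n. g i \<omega>) / real n) \<longlonglongrightarrow> 1 - ?ce"
      using iid_average[OF vacation_iid, of "\<lambda>x. 1 - exp (- \<theta> * x)"] exp_int by (simp add: g_def prob_space)
    note Vl = random_sum_mean_tendsto[OF _ g_meas g_bounds _ g_avg, of \<sigma> lam_V]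
    have vacation_loss_eq: "vacation_loss \<theta> t = (\<lambda>\<omega>. \<Sum>i=1..num_events \<sigma> t \<omega>. g i \<omega>)" for t
      unfolding vacation_loss_def[abs_def] g_def ..

    have loss_meas: "repair_loss \<theta> t \<in> borel_measurable M" "vacation_loss \<theta> t \<in> borel_measurable M" for t
      unfolding repair_loss_eq vacation_loss_eq
      by (rule random_sum_measurable_M; simp add: f_meas g_meas)+
    \<comment> \<open>The limit of \<open>?B t / t\<close> is computed twice: as a time average of the transform of \<open>W\<close>, and term by
      term.\<close>
    let ?B = "\<lambda>t. \<integral>\<omega>. exp (- \<theta> * W t \<omega>) - exp (- \<theta> * W0 \<omega>) + repair_loss \<theta> t \<omega> + vacation_loss \<theta> t \<omega> \<partial>M"
    have B1: "((\<lambda>t. ?B t / t) \<longlongrightarrow> \<phi> \<theta> * ?L) at_top"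
    proof (rule grid_average_tendsto[where m="laplace_W \<theta>"])
      show "0 \<le> laplace_W \<theta> s \<and> laplace_W \<theta> s \<le> 1" if "0 \<le> s" for s
        using laplace_W_bounds[OF that, of \<theta>] \<theta> by simp
      show "(laplace_W \<theta> \<longlongrightarrow> ?L) at_top" using lim unfolding laplace_W_def[abs_def] W_def .
      show "0 < \<phi> \<theta>" unfolding \<phi>_def by (rule net_exponent_pos[OF \<theta>])
      show "(\<lambda>n. \<Sum>k<n. laplace_W \<theta> (real k * (t / real n)) * (exp (t / real n * \<phi> \<theta>) - 1)) \<longlonglongrightarrow> ?B t" if "0 < t" for t
        unfolding \<phi>_def W_def by (rule laplace_balance[OF that less_imp_le[OF \<theta>] loss_meas])
    qed
    have W0_int: "integrable M (\<lambda>\<omega>. exp (- \<theta> * W0 \<omega>))"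
    proof (rule integrable_const_bound[where B=1])
      show "AE \<omega> in M. norm (exp (- \<theta> * W0 \<omega>)) \<le> 1"
        using initial_nonneg by eventually_elim (use \<theta> in auto)
    qed (use W0_measurable in measurable)
    have over_t: "((\<lambda>t. c / t) \<longlongrightarrow> 0) at_top" for c :: real
      by (rule tendsto_divide_0[OF tendsto_const filterlim_at_top_imp_at_infinity[OF filterlim_ident]])
    have "((\<lambda>t. laplace_W \<theta> t / t) \<longlongrightarrow> 0) at_top"
      using tendsto_divide_0[OF lim filterlim_at_top_imp_at_infinity[OF filterlim_ident]]
      unfolding laplace_W_def W_def .
    then have B2: "((\<lambda>t. laplace_W \<theta> t / t - (\<integral>\<omega>. exp (- \<theta> * W0 \<omega>) \<partial>M) / t
        + (\<integral>\<omega>. (\<Sum>i=1..num_events \<tau> t \<omega>. f i \<omega>) \<partial>M) / t + (\<integral>\<omega>. (\<Sum>i=1..num_events \<sigma> t \<omega>. g i \<omega>) \<partial>M) / t)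
        \<longlongrightarrow> 0 - 0 + lam_R * (?cm - ?cp) + lam_V * (1 - ?ce)) at_top"
      by (intro tendsto_add tendsto_diff over_t Rl(1) Vl(1)) (use \<theta> in auto)
    have "\<forall>\<^sub>F t in at_top. integrable M (\<lambda>\<omega>. \<Sum>i=1..num_events \<tau> t \<omega>. f i \<omega>)"
      "\<forall>\<^sub>F t in at_top. integrable M (\<lambda>\<omega>. \<Sum>i=1..num_events \<sigma> t \<omega>. g i \<omega>)"
      using Rl(2) Vl(2) \<theta> by auto
    then have "\<forall>\<^sub>F t in at_top. laplace_W \<theta> t / t - (\<integral>\<omega>. exp (- \<theta> * W0 \<omega>) \<partial>M) / t
        + (\<integral>\<omega>. (\<Sum>i=1..num_events \<tau> t \<omega>. f i \<omega>) \<partial>M) / t + (\<integral>\<omega>. (\<Sum>i=1..num_events \<sigma> t \<omega>. g i \<omega>) \<partial>M) / t = ?B t / t"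
      using eventually_ge_at_top[of 0]
    proof eventually_elim
      case (elim t)
      have Wt: "integrable M (\<lambda>\<omega>. exp (- \<theta> * W t \<omega>))"
        unfolding W_def by (rule exp_W_integrable[OF elim(3) less_imp_le[OF \<theta>]])
      have "?B t = (\<integral>\<omega>. exp (- \<theta> * W t \<omega>) \<partial>M) - (\<integral>\<omega>. exp (- \<theta> * W0 \<omega>) \<partial>M)
        + (\<integral>\<omega>. (\<Sum>i=1..num_events \<tau> t \<omega>. f i \<omega>) \<partial>M) + (\<integral>\<omega>. (\<Sum>i=1..num_events \<sigma> t \<omega>. g i \<omega>) \<partial>M)"
        unfolding repair_loss_eq vacation_loss_eq using Wt W0_int elim by simp
      then show ?case
        unfolding laplace_W_def W_def by (simp only: add_divide_distrib diff_divide_distrib)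
    qed
    from tendsto_unique[OF trivial_limit_at_top_linorder B1 Lim_transform_eventually[OF B2 this]]
    show "\<phi> \<theta> * ?L = lam_R * (?cm - ?cp) + lam_V * (1 - ?ce)" by simp
  qed
  show ?thesis
  proof (intro exI[of _ p] conjI allI impI)
    show "0 \<le> p" "p \<le> 1" by fact+
    show "lam_R = p * deriv_at_0 \<phi> / (\<integral>\<omega>. \<xi> 1 \<omega> \<partial>M)"
      unfolding E\<xi>_def[symmetric] deriv using p E\<xi> by simp
    show "lam_V = (1 - p) * deriv_at_0 \<phi> / (\<integral>\<omega>. \<eta> 1 \<omega> \<partial>M)"
      unfolding E\<eta>_def[symmetric] deriv using p E\<eta> by simp
    show "((\<lambda>t. (\<integral>\<omega>. (\<Sum>k=1..num_events \<tau> t \<omega>. \<xi> k \<omega>) \<partial>M) / t) \<longlongrightarrow> - p * (\<integral>\<omega>. Y 1 \<omega> \<partial>M)) at_top"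
      using R p(1) by (simp add: EY)
    show "((\<lambda>t. (\<integral>\<omega>. (\<Sum>k=1..num_events \<sigma> t \<omega>. \<eta> k \<omega>) \<partial>M) / t) \<longlongrightarrow> - (1 - p) * (\<integral>\<omega>. Y 1 \<omega> \<partial>M)) at_top"
    proof -
      have "- (1 - p) * (\<integral>\<omega>. Y 1 \<omega> \<partial>M) = lam_V * E\<eta>" unfolding EY using p(2) by (simp only: minus_mult_minus)
      then show ?thesis using V by (simp only:)
    qed
    fix \<theta> :: real assume \<theta>: "0 < \<theta>"
    show "((\<lambda>t. \<integral>\<omega>. exp (- \<theta> * W t \<omega>) \<partial>M) \<longlongrightarrow> (\<integral>\<omega>. exp (- \<theta> * W_inf \<omega>) \<partial>N)) at_top"
      using transform[OF \<theta>] by blast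
    let ?L = "\<integral>\<omega>. exp (- \<theta> * W_inf \<omega>) \<partial>N"
    let ?cm = "\<integral>\<omega>. exp (- \<theta> * W_minus \<omega>) \<partial>N'" and ?cp = "\<integral>\<omega>. exp (- \<theta> * W_plus \<omega>) \<partial>N'"
      and ?ce = "\<integral>\<omega>. exp (- \<theta> * \<eta> 1 \<omega>) \<partial>M"
    have \<phi>pos: "0 < \<phi> \<theta>" unfolding \<phi>_def by (rule net_exponent_pos[OF \<theta>])
    have alg: "\<theta> * d / f * (p * (A / (\<theta> * x)) + (1 - p) * (B / (\<theta> * y))) = (p * d / x * A + (1 - p) * d / y * B) / f"
      if "f \<noteq> 0" "x \<noteq> 0" "y \<noteq> 0" for f x y A B :: real
      using \<theta> that by (simp add: field_simps)
    have "\<theta> * d / \<phi> \<theta> * (p * ((?cm - ?cp) / (\<theta> * E\<xi>)) + (1 - p) * ((1 - ?ce) / (\<theta> * E\<eta>))) =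
      (p * d / E\<xi> * (?cm - ?cp) + (1 - p) * d / E\<eta> * (1 - ?ce)) / \<phi> \<theta>"
      by (rule alg) (use \<phi>pos E\<xi> E\<eta> in auto)
    also have "\<dots> = (lam_R * (?cm - ?cp) + lam_V * (1 - ?ce)) / \<phi> \<theta>"
      using p E\<xi> E\<eta> by simp
    also have "\<dots> = ?L" using transform[OF \<theta>] \<phi>pos by (simp add: field_simps)
    finally show "?L = \<theta> * deriv_at_0 \<phi> / \<phi> \<theta> *
           (p * ((?cm - ?cp) / (\<theta> * (\<integral>\<omega>. \<xi> 1 \<omega> \<partial>M))) + (1 - p) * ((1 - ?ce) / (\<theta> * (\<integral>\<omega>. \<eta> 1 \<omega> \<partial>M))))"
      unfolding deriv E\<xi>_def[symmetric] E\<eta>_def[symmetric] by (rule sym)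
  qed
qed

end
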